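(* Let $M$ be a pointwise $k$-slant submanifold of a Kähler manifold $(\bar M,\varphi,g)$, with associated orthogonal decomposition $TM=\mathcal D_0\oplus\mathcal D_1\oplus\dots\oplus\mathcal D_k$ and slant functions $\theta_0=0,\theta_1,\dots,\theta_k$. Then: (i) for $i\in\{0,\dots,k\}$, $\mathcal D_i$ is an integrable distribution if and only if $$g(X,\nabla_YZ)=g(Y,\nabla_XZ)$$ for all $X,Y\in\Gamma(\mathcal D_i)$ and $Z\in\Gamma(\mathcal D_j)$, $j\in\{0,\dots,k\}$ with $j\neq i$; (ii) $\mathcal D_0$ is an integrable distribution if and only if $$h(X,TY)=h(TX,Y)$$ for all $X,Y\in\Gamma(\mathcal D_0)$; (iii) for $i\in\{0,\dots,k\}$ with $\theta_j(p)\neq\frac{\pi}{2}$ for all $p\in M$ and all $j\neq i$, $j\in\{0,\dots,k\}$, $\mathcal D_i$ is an integrable distribution if and only if $$\nabla_XTY-\nabla_YTX+A_{NX}Y-A_{NY}X\in\Gamma(\mathcal D_i)$$ for all $X,Y\in\Gamma(\mathcal D_i)$.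
   Context: An almost Hermitian manifold $(\bar M,\varphi,g)$ is a Riemannian manifold $(\bar M,g)$ with a $(1,1)$-tensor field $\varphi$ such that $\varphi^2=-I$ and $g(\varphi\cdot,\varphi\cdot)=g$. Here it is called Kähler if $\bar\nabla\varphi=0$, where $\bar\nabla$ is the Levi-Civita connection of $g$. Let $M$ be a submanifold of $\bar M$ defined by an injective immersion, with induced metric also denoted $g$ and Levi-Civita connection $\nabla$. The second fundamental form $h$, shape operator $A$ and normal connection $\nabla^\bot$ are given by $\bar\nabla_XY=\nabla_XY+h(X,Y)$ and $\bar\nabla_XV=-A_VX+\nabla^\bot_XV$ for $X,Y\in\Gamma(TM)$, $V\in\Gamma(T^\bot M)$; they satisfy $g(h(X,Y),V)=g(A_VX,Y)$. For $X\in\Gamma(TM)$ write $\varphi X=TX+NX$ with $TX$ tangent and $NX$ normal to $M$. A distribution $\mathcal D\subseteq TM$ is pointwise slant if, at each $p\in M$, the angle $\theta(p)$ between $\varphi X_p$ and $\mathcal D_p$ is nonzero and independent of the choice of $X_p\in\mathcal D_p\setminus\{0\}$; $\theta$ is its slant function. $M$ is a pointwise $k$-slant submanifold of $\bar M$ ($k\in\mathbb N$, $k\ge1$) if there exist mutually orthogonal smooth regular (constant rank) distributions $\mathcal D_0,\dots,\mathcal D_k$ on $M$ such that: $TM=\mathcal D_0\oplus\mathcal D_1\oplus\dots\oplus\mathcal D_k$; $T(\mathcal D_i)\subseteq\mathcal D_i$ for $i\in\{1,\dots,k\}$; $\mathcal D_0$ is invariant ($\varphi(\mathcal D_0)\subseteq\mathcal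 D_0$), possibly trivial; and $\mathcal D_1,\dots,\mathcal D_k$ are nontrivial pointwise slant distributions with slant functions $\theta_i(p)\in(0,\frac{\pi}{2}]$ that are pointwise distinct ($\theta_i(p)\ne\theta_j(p)$ for all $p\in M$ and $i\ne j$). By convention $\theta_0=0$. A distribution $\mathcal D$ is integrable if $[X,Y]\in\Gamma(\mathcal D)$ for all $X,Y\in\Gamma(\mathcal D)$. *)

theory Defs
  imports "HOL-Analysis.Analysis"
begin

section \<open>Smooth manifolds\<close>

text \<open>\<open>Ck_on k S f\<close> is meant for open \<open>S\<close> in a finite-dimensional space.\<close>

primrec Ck_on ::
  "nat \<Rightarrow> 'a::real_normed_vector set \<Rightarrow> ('a \<Rightarrow> 'b::real_normed_vector) \<Rightarrow> bool" where
  "Ck_on 0 S f \<longleftrightarrow> continuous_on S f"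
| "Ck_on (Suc k) S f \<longleftrightarrow>
     (\<forall>x\<in>S. f differentiable (at x)) \<and> (\<forall>v. Ck_on k S (\<lambda>x. frechet_derivative f (at x) v))"

definition smooth_on :: "'a::real_normed_vector set \<Rightarrow> ('a \<Rightarrow> 'b::real_normed_vector) \<Rightarrow> bool" where
  "smooth_on S f \<longleftrightarrow> (\<forall>k. Ck_on k S f)"

text \<open>A manifold is a whole type \<open>'p\<close> with an atlas of charts onto open subsets of the model
  space \<open>'e\<close>; the Hausdorff and countability axioms are carried by the type class constraint.\<close>

type_synonym ('p, 'e) chart = "'p set \<times> ('p \<Rightarrow> 'e)"

definition smooth_atlas ::
  "('p::{t2_space,second_countable_topology}, 'e::euclidean_space) chart set \<Rightarrow> bool" where
  "smooth_atlas A \<longleftrightarrow>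
     (\<Union>(U, c)\<in>A. U) = UNIV \<and>
     (\<forall>(U, c)\<in>A. open U \<and> open (c ` U) \<and> homeomorphism U (c ` U) c (inv_into U c)) \<and>
     (\<forall>(U, c)\<in>A. \<forall>(V, d)\<in>A. smooth_on (c ` (U \<inter> V)) (d \<circ> inv_into U c))"

definition smooth_fun_on ::
  "('p::{t2_space,second_countable_topology}, 'e::euclidean_space) chart set \<Rightarrow> 'p set \<Rightarrow>
    ('p \<Rightarrow> real) \<Rightarrow> bool" where
  "smooth_fun_on A S u \<longleftrightarrow> (\<forall>(U, c)\<in>A. smooth_on (c ` (U \<inter> S)) (u \<circ> inv_into U c))"

abbreviation "smooth_fun A \<equiv> smooth_fun_on A UNIV"

definition smooth_map ::
  "('p::{t2_space,second_countable_topology}, 'm::euclidean_space) chart set \<Rightarrow>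
   ('q::{t2_space,second_countable_topology}, 'n::euclidean_space) chart set \<Rightarrow>
    ('p \<Rightarrow> 'q) \<Rightarrow> bool" where
  "smooth_map A B f \<longleftrightarrow> continuous_on UNIV f \<and>
     (\<forall>(U, c)\<in>A. \<forall>(V, d)\<in>B. smooth_on (c ` (U \<inter> f -` V)) (d \<circ> f \<circ> inv_into U c))"

text \<open>For every point a chart around it is chosen once and for all, and the tangent space at \<open>p\<close>
  is the model space \<open>'e\<close>: the vector \<open>v\<close> stands for the tangent vector at \<open>p\<close> whose components in
  the chosen chart at \<open>p\<close> are \<open>v\<close>. As the chosen chart varies with the point, smoothness of
  a field of vectors is not smoothness of the underlying \<open>'e\<close>-valued function; it is tested on
  smooth functions below.\<close>

definition chart_at :: "('p, 'e) chart set \<Rightarrow> 'p \<Rightarrow> ('p, 'e) chart" where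
  "chart_at A p = (SOME c. c \<in> A \<and> p \<in> fst c)"

definition coord_at :: "('p, 'e) chart set \<Rightarrow> 'p \<Rightarrow> 'p \<Rightarrow> 'e" where
  "coord_at A p = snd (chart_at A p)"

definition param_at :: "('p, 'e) chart set \<Rightarrow> 'p \<Rightarrow> 'e \<Rightarrow> 'p" where
  "param_at A p = inv_into (fst (chart_at A p)) (snd (chart_at A p))"

text \<open>\<open>dir_deriv A p v u\<close> is the derivative \<open>v(u)\<close> of the function \<open>u\<close> along the tangent vector
  \<open>v\<close> at \<open>p\<close>.\<close>

definition dir_deriv ::
  "('p, 'e::euclidean_space) chart set \<Rightarrow> 'p \<Rightarrow> 'e \<Rightarrow> ('p \<Rightarrow> real) \<Rightarrow> real" where
  "dir_deriv A p v u = frechet_derivative (u \<circ> param_at A p) (at (coord_at A p p)) v"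

definition tangent_map ::
  "('p, 'm::euclidean_space) chart set \<Rightarrow> ('q, 'n::euclidean_space) chart set \<Rightarrow>
    ('p \<Rightarrow> 'q) \<Rightarrow> 'p \<Rightarrow> 'm \<Rightarrow> 'n" where
  "tangent_map A B f p =
     frechet_derivative (coord_at B (f p) \<circ> f \<circ> param_at A p) (at (coord_at A p p))"

definition vector_field_on ::
  "('p::{t2_space,second_countable_topology}, 'e::euclidean_space) chart set \<Rightarrow> 'p set \<Rightarrow>
    ('p \<Rightarrow> 'e) \<Rightarrow> bool" where
  "vector_field_on A S X \<longleftrightarrow>
     (\<forall>u. smooth_fun A u \<longrightarrow> smooth_fun_on A S (\<lambda>p. dir_deriv A p (X p) u))"

abbreviation "vector_field A \<equiv> vector_field_on A UNIV"

definition vector_field_along ::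
  "('p::{t2_space,second_countable_topology}, 'm::euclidean_space) chart set \<Rightarrow>
   ('q::{t2_space,second_countable_topology}, 'n::euclidean_space) chart set \<Rightarrow>
    ('p \<Rightarrow> 'q) \<Rightarrow> ('p \<Rightarrow> 'n) \<Rightarrow> bool" where
  "vector_field_along A B f V \<longleftrightarrow>
     (\<forall>u. smooth_fun B u \<longrightarrow> smooth_fun A (\<lambda>p. dir_deriv B (f p) (V p) u))"

definition lie_bracket ::
  "('p::{t2_space,second_countable_topology}, 'e::euclidean_space) chart set \<Rightarrow>
    ('p \<Rightarrow> 'e) \<Rightarrow> ('p \<Rightarrow> 'e) \<Rightarrow> 'p \<Rightarrow> 'e" where
  "lie_bracket A X Y p = (THE z. \<forall>u. smooth_fun A u \<longrightarrow>
     dir_deriv A p z u =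
       dir_deriv A p (X p) (\<lambda>q. dir_deriv A q (Y q) u) -
       dir_deriv A p (Y p) (\<lambda>q. dir_deriv A q (X q) u))"

section \<open>Riemannian metrics and connections\<close>

definition riemannian_metric ::
  "('p::{t2_space,second_countable_topology}, 'e::euclidean_space) chart set \<Rightarrow>
    ('p \<Rightarrow> 'e \<Rightarrow> 'e \<Rightarrow> real) \<Rightarrow> bool" where
  "riemannian_metric A g \<longleftrightarrow>
     (\<forall>p. bilinear (g p)) \<and>
     (\<forall>p v w. g p v w = g p w v) \<and>
     (\<forall>p v. v \<noteq> 0 \<longrightarrow> 0 < g p v v) \<and>
     (\<forall>X Y. vector_field A X \<longrightarrow> vector_field A Y \<longrightarrow> smooth_fun A (\<lambda>p. g p (X p) (Y p)))"

definition affine_connection ::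
  "('p::{t2_space,second_countable_topology}, 'e::euclidean_space) chart set \<Rightarrow>
    (('p \<Rightarrow> 'e) \<Rightarrow> ('p \<Rightarrow> 'e) \<Rightarrow> 'p \<Rightarrow> 'e) \<Rightarrow> bool" where
  "affine_connection A nab \<longleftrightarrow>
     (\<forall>X Y Z u. vector_field A X \<longrightarrow> vector_field A Y \<longrightarrow> vector_field A Z \<longrightarrow> smooth_fun A u \<longrightarrow>
        vector_field A (nab X Y) \<and>
        nab (\<lambda>p. X p + Y p) Z = (\<lambda>p. nab X Z p + nab Y Z p) \<and>
        nab X (\<lambda>p. Y p + Z p) = (\<lambda>p. nab X Y p + nab X Z p) \<and>
        nab (\<lambda>p. u p *\<^sub>R X p) Y = (\<lambda>p. u p *\<^sub>R nab X Y p) \<and>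
        nab X (\<lambda>p. u p *\<^sub>R Y p) =
          (\<lambda>p. u p *\<^sub>R nab X Y p + dir_deriv A p (X p) u *\<^sub>R Y p))"

definition levi_civita ::
  "('p::{t2_space,second_countable_topology}, 'e::euclidean_space) chart set \<Rightarrow>
    ('p \<Rightarrow> 'e \<Rightarrow> 'e \<Rightarrow> real) \<Rightarrow> (('p \<Rightarrow> 'e) \<Rightarrow> ('p \<Rightarrow> 'e) \<Rightarrow> 'p \<Rightarrow> 'e) \<Rightarrow> bool" where
  "levi_civita A g nab \<longleftrightarrow> affine_connection A nab \<and>
     (\<forall>X Y. vector_field A X \<longrightarrow> vector_field A Y \<longrightarrow>
        (\<lambda>p. nab X Y p - nab Y X p) = lie_bracket A X Y) \<and>
     (\<forall>X Y Z p. vector_field A X \<longrightarrow> vector_field A Y \<longrightarrow> vector_field A Z \<longrightarrow>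
        dir_deriv A p (X p) (\<lambda>q. g q (Y q) (Z q)) =
          g p (nab X Y p) (Z p) + g p (Y p) (nab X Z p))"

definition almost_hermitian ::
  "('q::{t2_space,second_countable_topology}, 'n::euclidean_space) chart set \<Rightarrow>
    ('q \<Rightarrow> 'n \<Rightarrow> 'n) \<Rightarrow> ('q \<Rightarrow> 'n \<Rightarrow> 'n \<Rightarrow> real) \<Rightarrow> bool" where
  "almost_hermitian B \<phi> g \<longleftrightarrow> riemannian_metric B g \<and>
     (\<forall>q. linear (\<phi> q)) \<and>
     (\<forall>X. vector_field B X \<longrightarrow> vector_field B (\<lambda>q. \<phi> q (X q))) \<and>
     (\<forall>q v. \<phi> q (\<phi> q v) = - v) \<and>
     (\<forall>q v w. g q (\<phi> q v) (\<phi> q w) = g q v w)"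

text \<open>The last conjunct is \<open>(nab\<^sub>X \<phi>) Y = nab\<^sub>X (\<phi> Y) - \<phi> (nab\<^sub>X Y) = 0\<close>.\<close>

definition kaehler ::
  "('q::{t2_space,second_countable_topology}, 'n::euclidean_space) chart set \<Rightarrow>
    ('q \<Rightarrow> 'n \<Rightarrow> 'n) \<Rightarrow> ('q \<Rightarrow> 'n \<Rightarrow> 'n \<Rightarrow> real) \<Rightarrow>
    (('q \<Rightarrow> 'n) \<Rightarrow> ('q \<Rightarrow> 'n) \<Rightarrow> 'q \<Rightarrow> 'n) \<Rightarrow> bool" where
  "kaehler B \<phi> g nab \<longleftrightarrow> smooth_atlas B \<and> almost_hermitian B \<phi> g \<and> levi_civita B g nab \<and>
     (\<forall>X Y. vector_field B X \<longrightarrow> vector_field B Y \<longrightarrow>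
        (\<lambda>q. nab X (\<lambda>r. \<phi> r (Y r)) q - \<phi> q (nab X Y q)) = (\<lambda>q. 0))"

section \<open>Submanifolds\<close>

definition injective_immersion ::
  "('p::{t2_space,second_countable_topology}, 'm::euclidean_space) chart set \<Rightarrow>
   ('q::{t2_space,second_countable_topology}, 'n::euclidean_space) chart set \<Rightarrow>
    ('p \<Rightarrow> 'q) \<Rightarrow> bool" where
  "injective_immersion A B f \<longleftrightarrow>
     smooth_map A B f \<and> inj f \<and> (\<forall>p. inj (tangent_map A B f p))"

definition induced_metric ::
  "('p, 'm::euclidean_space) chart set \<Rightarrow> ('q, 'n::euclidean_space) chart set \<Rightarrow> ('p \<Rightarrow> 'q) \<Rightarrow>
    ('q \<Rightarrow> 'n \<Rightarrow> 'n \<Rightarrow> real) \<Rightarrow> 'p \<Rightarrow> 'm \<Rightarrow> 'm \<Rightarrow> real" where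
  "induced_metric A B f g p v w = g (f p) (tangent_map A B f p v) (tangent_map A B f p w)"

text \<open>Vectors tangent to the ambient manifold along the submanifold are differentiated with the
  connection that the ambient connection induces on vector fields along the immersion \<open>f\<close>. It is
  determined by the connection axioms and by its values on restrictions \<open>W \<circ> f\<close> of ambient vector
  fields \<open>W\<close>.\<close>

definition induced_connection ::
  "('p::{t2_space,second_countable_topology}, 'm::euclidean_space) chart set \<Rightarrow>
   ('q::{t2_space,second_countable_topology}, 'n::euclidean_space) chart set \<Rightarrow> ('p \<Rightarrow> 'q) \<Rightarrow>
    (('q \<Rightarrow> 'n) \<Rightarrow> ('q \<Rightarrow> 'n) \<Rightarrow> 'q \<Rightarrow> 'n) \<Rightarrow> (('p \<Rightarrow> 'm) \<Rightarrow> ('p \<Rightarrow> 'n) \<Rightarrow> 'p \<Rightarrow> 'n) \<Rightarrow> bool" where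
  "induced_connection A B f nab D \<longleftrightarrow>
     (\<forall>X Y V W u. vector_field A X \<longrightarrow> vector_field A Y \<longrightarrow>
        vector_field_along A B f V \<longrightarrow> vector_field_along A B f W \<longrightarrow> smooth_fun A u \<longrightarrow>
        vector_field_along A B f (D X V) \<and>
        D (\<lambda>p. X p + Y p) V = (\<lambda>p. D X V p + D Y V p) \<and>
        D X (\<lambda>p. V p + W p) = (\<lambda>p. D X V p + D X W p) \<and>
        D (\<lambda>p. u p *\<^sub>R X p) V = (\<lambda>p. u p *\<^sub>R D X V p) \<and>
        D X (\<lambda>p. u p *\<^sub>R V p) = (\<lambda>p. u p *\<^sub>R D X V p + dir_deriv A p (X p) u *\<^sub>R V p)) \<and>
     (\<forall>X E W p. vector_field A X \<longrightarrow> vector_field B E \<longrightarrow> vector_field B W \<longrightarrow>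
        E (f p) = tangent_map A B f p (X p) \<longrightarrow>
        D X (W \<circ> f) p = nab E W (f p))"

text \<open>The tangential part of an ambient vector \<open>w\<close> at \<open>f p\<close>, as a tangent vector of the submanifold.\<close>

definition tan_part ::
  "('p, 'm::euclidean_space) chart set \<Rightarrow> ('q, 'n::euclidean_space) chart set \<Rightarrow> ('p \<Rightarrow> 'q) \<Rightarrow>
    ('q \<Rightarrow> 'n \<Rightarrow> 'n \<Rightarrow> real) \<Rightarrow> 'p \<Rightarrow> 'n \<Rightarrow> 'm" where
  "tan_part A B f g p w =
     (THE t. \<forall>v. g (f p) (w - tangent_map A B f p t) (tangent_map A B f p v) = 0)"

definition push_field ::
  "('p, 'm::euclidean_space) chart set \<Rightarrow> ('q, 'n::euclidean_space) chart set \<Rightarrow> ('p \<Rightarrow> 'q) \<Rightarrow>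
    ('p \<Rightarrow> 'm) \<Rightarrow> 'p \<Rightarrow> 'n" where
  "push_field A B f X p = tangent_map A B f p (X p)"

definition T_part ::
  "('p, 'm::euclidean_space) chart set \<Rightarrow> ('q, 'n::euclidean_space) chart set \<Rightarrow> ('p \<Rightarrow> 'q) \<Rightarrow>
    ('q \<Rightarrow> 'n \<Rightarrow> 'n) \<Rightarrow> ('q \<Rightarrow> 'n \<Rightarrow> 'n \<Rightarrow> real) \<Rightarrow> ('p \<Rightarrow> 'm) \<Rightarrow> 'p \<Rightarrow> 'm" where
  "T_part A B f \<phi> g X p = tan_part A B f g p (\<phi> (f p) (push_field A B f X p))"

definition N_part ::
  "('p, 'm::euclidean_space) chart set \<Rightarrow> ('q, 'n::euclidean_space) chart set \<Rightarrow> ('p \<Rightarrow> 'q) \<Rightarrow>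
    ('q \<Rightarrow> 'n \<Rightarrow> 'n) \<Rightarrow> ('q \<Rightarrow> 'n \<Rightarrow> 'n \<Rightarrow> real) \<Rightarrow> ('p \<Rightarrow> 'm) \<Rightarrow> 'p \<Rightarrow> 'n" where
  "N_part A B f \<phi> g X p =
     \<phi> (f p) (push_field A B f X p) - push_field A B f (T_part A B f \<phi> g X) p"

text \<open>Gauss and Weingarten formulas. In both, \<open>D\<close> is the induced connection; in the first,
  \<open>nab\<close> is the Levi-Civita connection of the submanifold.\<close>

definition second_fundamental_form ::
  "('p, 'm::euclidean_space) chart set \<Rightarrow> ('q, 'n::euclidean_space) chart set \<Rightarrow> ('p \<Rightarrow> 'q) \<Rightarrow>
    (('p \<Rightarrow> 'm) \<Rightarrow> ('p \<Rightarrow> 'n) \<Rightarrow> 'p \<Rightarrow> 'n) \<Rightarrow> (('p \<Rightarrow> 'm) \<Rightarrow> ('p \<Rightarrow> 'm) \<Rightarrow> 'p \<Rightarrow> 'm) \<Rightarrow>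
    ('p \<Rightarrow> 'm) \<Rightarrow> ('p \<Rightarrow> 'm) \<Rightarrow> 'p \<Rightarrow> 'n" where
  "second_fundamental_form A B f D nab X Y p =
     D X (push_field A B f Y) p - push_field A B f (nab X Y) p"

definition shape_operator ::
  "('p, 'm::euclidean_space) chart set \<Rightarrow> ('q, 'n::euclidean_space) chart set \<Rightarrow> ('p \<Rightarrow> 'q) \<Rightarrow>
    ('q \<Rightarrow> 'n \<Rightarrow> 'n \<Rightarrow> real) \<Rightarrow> (('p \<Rightarrow> 'm) \<Rightarrow> ('p \<Rightarrow> 'n) \<Rightarrow> 'p \<Rightarrow> 'n) \<Rightarrow>
    ('p \<Rightarrow> 'n) \<Rightarrow> ('p \<Rightarrow> 'm) \<Rightarrow> 'p \<Rightarrow> 'm" where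
  "shape_operator A B f g D V X p = - tan_part A B f g p (D X V p)"

section \<open>Distributions\<close>

definition regular_distribution ::
  "('p::{t2_space,second_countable_topology}, 'e::euclidean_space) chart set \<Rightarrow>
    ('p \<Rightarrow> 'e set) \<Rightarrow> bool" where
  "regular_distribution A \<D> \<longleftrightarrow> (\<exists>r.
     (\<forall>p. subspace (\<D> p) \<and> dim (\<D> p) = r) \<and>
     (\<forall>p. \<exists>U. open U \<and> p \<in> U \<and> (\<exists>E :: nat \<Rightarrow> 'p \<Rightarrow> 'e.
        (\<forall>i<r. vector_field_on A U (E i)) \<and>
        (\<forall>q\<in>U. span ((\<lambda>i. E i q) ` {..<r}) = \<D> q))))"

definition sections ::
  "('p::{t2_space,second_countable_topology}, 'e::euclidean_space) chart set \<Rightarrow>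
    ('p \<Rightarrow> 'e set) \<Rightarrow> ('p \<Rightarrow> 'e) set" where
  "sections A \<D> = {X. vector_field A X \<and> (\<forall>p. X p \<in> \<D> p)}"

definition integrable_distribution ::
  "('p::{t2_space,second_countable_topology}, 'e::euclidean_space) chart set \<Rightarrow>
    ('p \<Rightarrow> 'e set) \<Rightarrow> bool" where
  "integrable_distribution A \<D> \<longleftrightarrow>
     (\<forall>X\<in>sections A \<D>. \<forall>Y\<in>sections A \<D>. lie_bracket A X Y \<in> sections A \<D>)"

definition vec_angle :: "('e \<Rightarrow> 'e \<Rightarrow> real) \<Rightarrow> 'e \<Rightarrow> 'e \<Rightarrow> real" where
  "vec_angle G v w = arccos (G v w / (sqrt (G v v) * sqrt (G w w)))"

definition subspace_angle ::
  "('e::real_vector \<Rightarrow> 'e \<Rightarrow> real) \<Rightarrow> 'e \<Rightarrow> 'e set \<Rightarrow> real" where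
  "subspace_angle G v S = (INF w\<in>S - {0}. vec_angle G v w)"

definition pointwise_slant ::
  "('p, 'm::euclidean_space) chart set \<Rightarrow> ('q, 'n::euclidean_space) chart set \<Rightarrow> ('p \<Rightarrow> 'q) \<Rightarrow>
    ('q \<Rightarrow> 'n \<Rightarrow> 'n) \<Rightarrow> ('q \<Rightarrow> 'n \<Rightarrow> 'n \<Rightarrow> real) \<Rightarrow> ('p \<Rightarrow> 'm set) \<Rightarrow> ('p \<Rightarrow> real) \<Rightarrow> bool" where
  "pointwise_slant A B f \<phi> g \<D> \<theta> \<longleftrightarrow>
     (\<forall>p. \<theta> p \<noteq> 0 \<and> (\<forall>v\<in>\<D> p - {0}.
        subspace_angle (g (f p)) (\<phi> (f p) (tangent_map A B f p v)) (tangent_map A B f p ` \<D> p)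
          = \<theta> p))"

text \<open>The index \<open>0\<close> belongs to the invariant distribution, for which \<open>\<theta> 0 = 0\<close> by convention.\<close>

definition pointwise_k_slant ::
  "('p::{t2_space,second_countable_topology}, 'm::euclidean_space) chart set \<Rightarrow>
   ('q::{t2_space,second_countable_topology}, 'n::euclidean_space) chart set \<Rightarrow> ('p \<Rightarrow> 'q) \<Rightarrow>
    ('q \<Rightarrow> 'n \<Rightarrow> 'n) \<Rightarrow> ('q \<Rightarrow> 'n \<Rightarrow> 'n \<Rightarrow> real) \<Rightarrow>
    nat \<Rightarrow> (nat \<Rightarrow> 'p \<Rightarrow> 'm set) \<Rightarrow> (nat \<Rightarrow> 'p \<Rightarrow> real) \<Rightarrow> bool" where
  "pointwise_k_slant A B f \<phi> g k \<D> \<theta> \<longleftrightarrow>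
     1 \<le> k \<and>
     (\<forall>i\<le>k. regular_distribution A (\<D> i)) \<and>
     (\<forall>i\<le>k. \<forall>j\<le>k. i \<noteq> j \<longrightarrow>
        (\<forall>p. \<forall>v\<in>\<D> i p. \<forall>w\<in>\<D> j p. induced_metric A B f g p v w = 0)) \<and>
     (\<forall>p v. \<exists>!w. w \<in> (\<Pi>\<^sub>E i\<in>{..k}. \<D> i p) \<and> v = (\<Sum>i\<le>k. w i)) \<and>
     (\<forall>i\<in>{1..k}. \<forall>p. \<forall>v\<in>\<D> i p.
        tan_part A B f g p (\<phi> (f p) (tangent_map A B f p v)) \<in> \<D> i p) \<and>
     (\<forall>p. \<phi> (f p) ` tangent_map A B f p ` \<D> 0 p \<subseteq> tangent_map A B f p ` \<D> 0 p) \<and>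
     (\<forall>i\<in>{1..k}. (\<forall>p. \<D> i p \<noteq> {0}) \<and> pointwise_slant A B f \<phi> g (\<D> i) (\<theta> i) \<and>
        (\<forall>p. 0 < \<theta> i p \<and> \<theta> i p \<le> pi / 2)) \<and>
     (\<forall>i\<in>{1..k}. \<forall>j\<in>{1..k}. i \<noteq> j \<longrightarrow> (\<forall>p. \<theta> i p \<noteq> \<theta> j p)) \<and>
     (\<forall>p. \<theta> 0 p = 0)"

end

theory Submission
  imports Defs
begin

text \<open>Since \<open>\<nabla>\<close> is metric and torsion-free and the distributions are orthogonal,
  \<open>g([X,Y],Z) = g(X,\<nabla>\<^sub>YZ) - g(Y,\<nabla>\<^sub>XZ)\<close> for sections \<open>X\<close>, \<open>Y\<close> of \<open>\<D>\<^sub>i\<close> and \<open>Z\<close> of \<open>\<D>\<^sub>j\<close>; every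
  vector of \<open>\<D>\<^sub>j\<close> extends to a global section by a bump function, which gives (i).
  The connection induced along the immersion commutes with \<open>\<phi>\<close> and has torsion \<open>f\<^sub>*[X,Y]\<close>; the tangential and
  normal parts of \<open>\<phi>(f\<^sub>*[X,Y])\<close> are therefore \<open>\<nabla>\<^sub>XTY - \<nabla>\<^sub>YTX + A\<^sub>N\<^sub>XY - A\<^sub>N\<^sub>YX\<close> and, for sections of the
  invariant \<open>\<D>\<^sub>0\<close>, \<open>h(X,TY) - h(TX,Y)\<close>. As \<open>T\<close> preserves each \<open>\<D>\<^sub>j\<close> and the spaces \<open>N(\<D>\<^sub>j)\<close> are mutually
  orthogonal, \<open>N v = 0\<close> forces \<open>v \<in> \<D>\<^sub>0\<close>, and \<open>T v \<in> \<D>\<^sub>i\<close> forces \<open>v \<in> \<D>\<^sub>i\<close> unless some other slant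
  angle is a right angle.\<close>

section \<open>Smooth functions on open sets\<close>

text \<open>Smoothness is tested on global functions and connections act on global fields, whereas
  every computation is local. Hence the recurring device: frames and coefficients are multiplied by
  a bump function, and an identity is read off where the bump is 1. The Lie bracket and the
  tangential part are definite descriptions, so their existence must be shown before anything can be
  said of them; the tangential part must also vary smoothly, or \<open>T_part\<close> would not give
  vector fields. The connection \<open>D\<close> is known only by axioms and by its values on
  restrictions of ambient fields; its compatibility with \<open>\<phi>\<close>, metric and bracket
  is recovered by expanding in an ambient frame. The slant angles enter only at their extremes: a
  positive angle keeps phi v from being tangent, and an angle other than a right one keeps its
  tangential part from vanishing. The spaces N(D_j) are orthogonal because phi is an isometry: g(Nv,
  Nw) = g(v, w) - g(Tv, Tw), and T preserves each D_j.\<close>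

lemma has_derivative_cong_open:
  assumes "open T" "x \<in> T" "\<And>y. y \<in> T \<Longrightarrow> F y = G y"
  shows "(F has_derivative D) (at x) \<longleftrightarrow> (G has_derivative D) (at x)"
proof
  show "(G has_derivative D) (at x)" if "(F has_derivative D) (at x)"
    by (rule has_derivative_transform_within_open[OF that assms(1,2)]) (simp add: assms(3))
  show "(F has_derivative D) (at x)" if "(G has_derivative D) (at x)"
    by (rule has_derivative_transform_within_open[OF that assms(1,2)]) (simp add: assms(3))
qed

section \<open>Calculus of \<open>Ck_on\<close> and \<open>smooth_on\<close>\<close>

lemma Ck_on_subset: "Ck_on k S f \<Longrightarrow> T \<subseteq> S \<Longrightarrow> Ck_on k T f"
  by (induction k arbitrary: f) (auto intro: continuous_on_subset)

text \<open>Openness turns equality on \<open>S\<close> into equality near each point, so the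
  derivatives agree on \<open>S\<close> as well and the induction can pass to them.\<close>

lemma Ck_on_cong:
  assumes "open S" "\<And>x. x \<in> S \<Longrightarrow> f x = g x" "Ck_on k S f"
  shows "Ck_on k S g"
  using assms
proof (induction k arbitrary: f g)
  case 0
  then show ?case using continuous_on_cong[of S S f g] by simp
next
  case (Suc k)
  have der: "(f has_derivative f') (at x) \<longleftrightarrow> (g has_derivative f') (at x)" if "x \<in> S" for x f'
    using Suc.prems(1,2) that
      has_derivative_transform_within_open[of f f' x UNIV S g]
      has_derivative_transform_within_open[of g f' x UNIV S f] by auto
  have "frechet_derivative f (at x) v = frechet_derivative g (at x) v" if "x \<in> S" for x v
    using der[OF that] unfolding frechet_derivative_def by simp
  moreover have "g differentiable (at x)" if "x \<in> S" for x
  proof -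
    have "(f has_derivative frechet_derivative f (at x)) (at x)"
      using Suc.prems(3) that by (simp add: frechet_derivative_works[symmetric])
    then show ?thesis using der[OF that] differentiableI by blast
  qed
  moreover have "Ck_on k S (\<lambda>x. frechet_derivative g (at x) v)" for v
  proof (rule Suc.IH[OF Suc.prems(1)])
    show "Ck_on k S (\<lambda>x. frechet_derivative f (at x) v)" using Suc.prems(3) by simp
  qed (fact calculation(1))
  ultimately show ?case by simp
qed

text \<open>The derivatives in \<open>Ck_on\<close> are taken \<open>at x\<close>, not within
  \<open>S\<close>, so the condition at a point sees only a neighbourhood. This is what allows
  gluing over open covers.\<close>

lemma Ck_on_local:
  assumes "\<And>x. x \<in> S \<Longrightarrow> \<exists>T. open T \<and> x \<in> T \<and> Ck_on k T f"
  shows "Ck_on k S f"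
  using assms
proof (induction k arbitrary: f)
  case 0
  have "isCont f x" if x: "x \<in> S" for x
    using 0[OF x] continuous_on_eq_continuous_at by auto
  then show ?case by (simp add: continuous_at_imp_continuous_on)
next
  case (Suc k)
  have "Ck_on k S (\<lambda>x. frechet_derivative f (at x) v)" for v
    using Suc.prems by (intro Suc.IH) fastforce
  moreover have "f differentiable (at x)" if "x \<in> S" for x
    using Suc.prems[OF that] by auto
  ultimately show ?case by auto
qed

text \<open>Product, chain and quotient rule leave undifferentiated factors in the derivative; their
  induction steps need those factors at the lower order.\<close>

lemma Ck_on_SucD: "Ck_on (Suc k) S f \<Longrightarrow> Ck_on k S f"
proof (induction k arbitrary: f)
  case 0
  then show ?case
    by (auto intro!: continuous_at_imp_continuous_on differentiable_imp_continuous_within)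
next
  case (Suc k)
  then show ?case by auto
qed

lemma Ck_on_const [simp]: "Ck_on k S (\<lambda>x. c)"
  by (induction k arbitrary: c) auto

lemma Ck_on_ident [simp]: "Ck_on k S (\<lambda>x. x)"
  by (cases k) auto

lemma Ck_on_bounded_linear:
  assumes L: "bounded_linear L" and S: "open S" and f: "Ck_on k S f"
  shows "Ck_on k S (\<lambda>x. L (f x))"
  using f
proof (induction k arbitrary: f)
  case 0
  then show ?case using bounded_linear.continuous_on[OF L] by auto
next
  case (Suc k)
  have der: "((\<lambda>x. L (f x)) has_derivative (\<lambda>v. L (frechet_derivative f (at x) v))) (at x)"
    if "x \<in> S" for x
    using Suc.prems that
    by (intro bounded_linear.has_derivative[OF L]) (simp add: frechet_derivative_works[symmetric])
  have "Ck_on k S (\<lambda>x. frechet_derivative (\<lambda>x. L (f x)) (at x) v)" for v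
  proof (rule Ck_on_cong[OF S])
    show "Ck_on k S (\<lambda>x. L (frechet_derivative f (at x) v))" using Suc by auto
    show "L (frechet_derivative f (at x) v) = frechet_derivative (\<lambda>x. L (f x)) (at x) v"
      if "x \<in> S" for x using frechet_derivative_at[OF der[OF that]] by metis
  qed
  then show ?case using differentiableI[OF der] by simp
qed

lemma Ck_on_add:
  assumes S: "open S" and "Ck_on k S f" "Ck_on k S g"
  shows "Ck_on k S (\<lambda>x. f x + g x)"
  using assms(2,3)
proof (induction k arbitrary: f g)
  case 0
  then show ?case by (auto intro: continuous_on_add)
next
  case (Suc k)
  have der: "((\<lambda>x. f x + g x) has_derivative
      (\<lambda>v. frechet_derivative f (at x) v + frechet_derivative g (at x) v)) (at x)"
    if "x \<in> S" for x
    using Suc.prems that by (intro has_derivative_add) (auto simp: frechet_derivative_works[symmetric])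
  have "Ck_on k S (\<lambda>x. frechet_derivative (\<lambda>x. f x + g x) (at x) v)" for v
  proof (rule Ck_on_cong[OF S])
    show "Ck_on k S (\<lambda>x. frechet_derivative f (at x) v + frechet_derivative g (at x) v)"
      using Suc by auto
    show "frechet_derivative f (at x) v + frechet_derivative g (at x) v
      = frechet_derivative (\<lambda>x. f x + g x) (at x) v"
      if "x \<in> S" for x using frechet_derivative_at[OF der[OF that]] by metis
  qed
  then show ?case using differentiableI[OF der] by simp
qed

lemma Ck_on_sum:
  assumes "open S" "\<And>i. i \<in> I \<Longrightarrow> Ck_on k S (f i)"
  shows "Ck_on k S (\<lambda>x. \<Sum>i\<in>I. f i x)"
  using assms(2)
proof (induction I rule: infinite_finite_induct)
  case (insert i I)
  have "Ck_on k S (\<lambda>x. f i x + (\<Sum>i\<in>I. f i x))"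
    using insert.IH insert.prems by (intro Ck_on_add[OF assms(1)]) simp_all
  then show ?case using insert.hyps by simp
qed simp_all

text \<open>One product rule for multiplication, scaling and inner product.\<close>

lemma Ck_on_bilinear:
  assumes P: "bounded_bilinear P" and S: "open S" and "Ck_on k S f" "Ck_on k S g"
  shows "Ck_on k S (\<lambda>x. P (f x) (g x))"
  using assms(3,4)
proof (induction k arbitrary: f g)
  case 0
  then show ?case using bounded_bilinear.continuous_on[OF P] by auto
next
  case (Suc k)
  have der: "((\<lambda>x. P (f x) (g x)) has_derivative
      (\<lambda>v. P (f x) (frechet_derivative g (at x) v) + P (frechet_derivative f (at x) v) (g x))) (at x)"
    if "x \<in> S" for x
    using Suc.prems that
    by (intro bounded_bilinear.FDERIV[OF P]) (auto simp: frechet_derivative_works[symmetric])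
  have "Ck_on k S (\<lambda>x. frechet_derivative (\<lambda>x. P (f x) (g x)) (at x) v)" for v
  proof (rule Ck_on_cong[OF S])
    show "Ck_on k S (\<lambda>x. P (f x) (frechet_derivative g (at x) v)
        + P (frechet_derivative f (at x) v) (g x))"
      using Suc.prems Ck_on_SucD[OF Suc.prems(1)] Ck_on_SucD[OF Suc.prems(2)]
      by (intro Ck_on_add[OF S] Suc.IH) auto
    show "P (f x) (frechet_derivative g (at x) v) + P (frechet_derivative f (at x) v) (g x)
      = frechet_derivative (\<lambda>x. P (f x) (g x)) (at x) v"
      if "x \<in> S" for x using frechet_derivative_at[OF der[OF that]] by metis
  qed
  then show ?case using differentiableI[OF der] by simp
qed

lemma Ck_on_compose:
  fixes f :: "'a::real_normed_vector \<Rightarrow> 'b::euclidean_space" and g :: "'b \<Rightarrow> 'c::real_normed_vector"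
  assumes S: "open S" and fS: "f ` S \<subseteq> T" and "Ck_on k S f" "Ck_on k T g"
  shows "Ck_on k S (\<lambda>x. g (f x))"
  using assms(3,4)
proof (induction k arbitrary: g)
  case 0
  then show ?case using continuous_on_compose2[of T g S f] fS by auto
next
  case (Suc k)
  have lin: "linear (frechet_derivative g (at (f x)))" if "x \<in> S" for x
    using Suc.prems fS that by (intro linear_frechet_derivative) auto
  \<comment> \<open>\<open>Ck_on\<close> controls derivatives in fixed directions only, while the
    chain rule evaluates the derivative of \<open>g\<close> in the moving direction given by that of
    \<open>f\<close>. Expanding this direction in \<open>Basis\<close> leaves fixed directions with
    scalar coefficients; hence the Euclidean middle space.\<close>
  have der: "((\<lambda>x. g (f x)) has_derivative
      (\<lambda>v. \<Sum>b\<in>Basis. (frechet_derivative f (at x) v \<bullet> b) *\<^sub>R frechet_derivative g (at (f x)) b)) (at x)"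
    if "x \<in> S" for x
  proof -
    have D: "((\<lambda>x. g (f x)) has_derivative
      (\<lambda>v. frechet_derivative g (at (f x)) (frechet_derivative f (at x) v))) (at x)"
    proof (rule has_derivative_compose[of f "frechet_derivative f (at x)"])
      show "(f has_derivative frechet_derivative f (at x)) (at x)"
        using Suc.prems(1) that by (simp add: frechet_derivative_works[symmetric])
      have "f x \<in> T" using that fS by auto
      then show "(g has_derivative frechet_derivative g (at (f x))) (at (f x))"
        using Suc.prems(2) by (simp add: frechet_derivative_works[symmetric])
    qed
    have "frechet_derivative g (at (f x)) w
        = (\<Sum>b\<in>Basis. (w \<bullet> b) *\<^sub>R frechet_derivative g (at (f x)) b)" for w
    proof -
      have "frechet_derivative g (at (f x)) (\<Sum>b\<in>Basis. (w \<bullet> b) *\<^sub>R b)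
        = (\<Sum>b\<in>Basis. (w \<bullet> b) *\<^sub>R frechet_derivative g (at (f x)) b)"
        using lin[OF that] by (simp add: linear_sum linear_scale)
      then show ?thesis by (simp add: euclidean_representation)
    qed
    then show ?thesis by (intro has_derivative_eq_rhs[OF D] ext)
  qed
  have "Ck_on k S (\<lambda>x. frechet_derivative (\<lambda>x. g (f x)) (at x) v)" for v
  proof (rule Ck_on_cong[OF S])
    have "Ck_on k S (\<lambda>x. frechet_derivative g (at (f x)) b)" for b
      using Suc.prems Ck_on_SucD[OF Suc.prems(1)] by (intro Suc.IH) auto
    then show "Ck_on k S (\<lambda>x. \<Sum>b\<in>Basis. (frechet_derivative f (at x) v \<bullet> b) *\<^sub>R
        frechet_derivative g (at (f x)) b)"
      using Suc.prems
      by (intro Ck_on_sum[OF S] Ck_on_bilinear[OF bounded_bilinear_scaleR S]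
          Ck_on_bounded_linear[OF bounded_linear_inner_left S]) auto
    show "(\<Sum>b\<in>Basis. (frechet_derivative f (at x) v \<bullet> b) *\<^sub>R frechet_derivative g (at (f x)) b)
      = frechet_derivative (\<lambda>x. g (f x)) (at x) v"
      if "x \<in> S" for x using frechet_derivative_at[OF der[OF that]] by metis
  qed
  then show ?case using differentiableI[OF der] by simp
qed

lemma Ck_on_inverse:
  fixes f :: "'a::real_normed_vector \<Rightarrow> real"
  assumes S: "open S" and "Ck_on k S f" and nz: "\<And>x. x \<in> S \<Longrightarrow> f x \<noteq> 0"
  shows "Ck_on k S (\<lambda>x. inverse (f x))"
  using assms(2)
proof (induction k)
  case 0
  then show ?case using nz by (auto intro: continuous_on_inverse)
next
  case (Suc k)
  note mult = Ck_on_bilinear[OF bounded_bilinear_mult S]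
  have der: "((\<lambda>x. inverse (f x)) has_derivative
      (\<lambda>v. - 1 * (inverse (f x) * frechet_derivative f (at x) v * inverse (f x)))) (at x)"
    if "x \<in> S" for x
  proof -
    have "(f has_derivative frechet_derivative f (at x)) (at x)"
      using Suc.prems that by (simp add: frechet_derivative_works[symmetric])
    from Deriv.has_derivative_inverse[OF nz[OF that] this] show ?thesis by simp
  qed
  have "Ck_on k S (\<lambda>x. frechet_derivative (\<lambda>x. inverse (f x)) (at x) v)" for v
  proof (rule Ck_on_cong[OF S])
    \<comment> \<open>The derivative of the reciprocal is a product of the reciprocal itself and the
      derivative of \<open>f\<close>, so the induction hypothesis for the same \<open>f\<close>
      suffices.\<close>
    have "Ck_on k S (\<lambda>x. inverse (f x))" by (rule Suc.IH[OF Ck_on_SucD[OF Suc.prems]])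
    then show "Ck_on k S (\<lambda>x. - 1 * (inverse (f x) * frechet_derivative f (at x) v * inverse (f x)))"
      using Suc.prems by (intro mult) auto
    show "- 1 * (inverse (f x) * frechet_derivative f (at x) v * inverse (f x))
      = frechet_derivative (\<lambda>x. inverse (f x)) (at x) v"
      if "x \<in> S" for x using frechet_derivative_at[OF der[OF that]] by metis
  qed
  then show ?case using differentiableI[OF der] by simp
qed

lemma smooth_on_cong: "open S \<Longrightarrow> (\<And>x. x \<in> S \<Longrightarrow> f x = g x) \<Longrightarrow> smooth_on S f \<Longrightarrow> smooth_on S g"
  unfolding smooth_on_def using Ck_on_cong by blast

lemma smooth_on_mono: "smooth_on S f \<Longrightarrow> T \<subseteq> S \<Longrightarrow> smooth_on T f"
  unfolding smooth_on_def using Ck_on_subset by blast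

lemma smooth_on_local:
  "(\<And>x. x \<in> S \<Longrightarrow> \<exists>T. open T \<and> x \<in> T \<and> smooth_on T f) \<Longrightarrow> smooth_on S f"
  unfolding smooth_on_def by (meson Ck_on_local)

lemma smooth_on_const [simp]: "smooth_on S (\<lambda>x. c)"
  by (simp add: smooth_on_def)

lemma smooth_on_ident [simp]: "smooth_on S (\<lambda>x. x)"
  by (simp add: smooth_on_def)

lemma smooth_on_bounded_linear:
  "bounded_linear L \<Longrightarrow> open S \<Longrightarrow> smooth_on S f \<Longrightarrow> smooth_on S (\<lambda>x. L (f x))"
  by (simp add: smooth_on_def Ck_on_bounded_linear)

lemma smooth_on_add:
  "open S \<Longrightarrow> smooth_on S f \<Longrightarrow> smooth_on S g \<Longrightarrow> smooth_on S (\<lambda>x. f x + g x)"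
  by (simp add: smooth_on_def Ck_on_add)

lemma smooth_on_bilinear:
  "bounded_bilinear P \<Longrightarrow> open S \<Longrightarrow> smooth_on S f \<Longrightarrow> smooth_on S g \<Longrightarrow> smooth_on S (\<lambda>x. P (f x) (g x))"
  by (simp add: smooth_on_def Ck_on_bilinear)

lemmas smooth_on_mult = smooth_on_bilinear[OF bounded_bilinear_mult]

lemma smooth_on_compose:
  fixes f :: "'a::real_normed_vector \<Rightarrow> 'b::euclidean_space"
  shows "open S \<Longrightarrow> f ` S \<subseteq> T \<Longrightarrow> smooth_on S f \<Longrightarrow> smooth_on T g \<Longrightarrow> smooth_on S (\<lambda>x. g (f x))"
  by (simp add: smooth_on_def Ck_on_compose[of S f T])

lemma smooth_on_inverse:
  fixes f :: "'a::real_normed_vector \<Rightarrow> real"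
  shows "open S \<Longrightarrow> smooth_on S f \<Longrightarrow> (\<And>x. x \<in> S \<Longrightarrow> f x \<noteq> 0) \<Longrightarrow> smooth_on S (\<lambda>x. inverse (f x))"
  by (simp add: smooth_on_def Ck_on_inverse)

lemma smooth_on_differentiable: "smooth_on S f \<Longrightarrow> x \<in> S \<Longrightarrow> f differentiable (at x)"
  unfolding smooth_on_def by (metis Ck_on.simps(2))

lemma smooth_on_derivative: "smooth_on S f \<Longrightarrow> smooth_on S (\<lambda>x. frechet_derivative f (at x) v)"
  unfolding smooth_on_def by (metis Ck_on.simps(2))

lemma smooth_on_continuous: "smooth_on S f \<Longrightarrow> continuous_on S f"
  unfolding smooth_on_def by (metis Ck_on.simps(1))

section \<open>Smooth cut-off functions on Euclidean space\<close>

text \<open>The classical flat function is the case \<open>n = 0\<close>. The powers of 1/x make the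
  span of the family closed under differentiation, so smoothness is one induction over the order
  with \<open>n\<close> arbitrary.\<close>

definition exp_bump :: "nat \<Rightarrow> real \<Rightarrow> real" where
  "exp_bump n x = (if 0 < x then exp (- inverse x) * inverse x ^ n else 0)"

text \<open>Substituting y = 1/x on the right of 0 gives y^n / e^y for y tending to
  infinity.\<close>

lemma exp_bump_tendsto_0: "(exp_bump n \<longlongrightarrow> 0) (at 0)"
proof -
  have "((\<lambda>y. y ^ n / exp y) \<longlongrightarrow> 0) (at_top :: real filter)"
    by (rule tendsto_power_div_exp_0)
  then have "((\<lambda>x. inverse x ^ n / exp (inverse x)) \<longlongrightarrow> 0) (at_right (0::real))"
    by (rule filterlim_compose[OF _ filterlim_inverse_at_top_right])
  then have "(exp_bump n \<longlongrightarrow> 0) (at_right 0)"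
    by (rule tendsto_cong[THEN iffD1, rotated])
      (auto simp: eventually_at_filter exp_bump_def exp_minus field_simps)
  moreover have "(exp_bump n \<longlongrightarrow> 0) (at_left 0)"
    by (rule tendsto_eventually) (auto simp: eventually_at_filter exp_bump_def)
  ultimately show ?thesis by (simp add: filterlim_at_split)
qed

lemma has_derivative_exp_bump:
  "(exp_bump n has_real_derivative exp_bump (n + 2) x - n * exp_bump (n + 1) x) (at x)"
proof -
  consider "x < 0" | "x = 0" | "0 < x" by linarith
  then show ?thesis
  proof cases
    case 1
    have "((\<lambda>x. 0) has_real_derivative 0) (at x)" by simp
    then have "(exp_bump n has_real_derivative 0) (at x)"
      by (rule DERIV_cong_ev[THEN iffD1, OF refl _ refl, rotated])
        (use 1 in \<open>auto simp: exp_bump_def eventually_nhds intro!: exI[of _ "{..<0}"]\<close>)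
    then show ?thesis using 1 by (simp add: exp_bump_def)
  next
    case 2
    \<comment> \<open>Dividing by \<open>h\<close> just raises the power of 1/h, so the difference
      quotient at 0 is the next member of the family; at \<open>h = 0\<close> both sides are
      0.\<close>
    have "(\<lambda>h. (exp_bump n (0 + h) - exp_bump n 0) / h) = exp_bump (n + 1)"
      by (auto simp: exp_bump_def fun_eq_iff field_simps)
    then have "(exp_bump n has_real_derivative 0) (at 0)"
      using exp_bump_tendsto_0[of "n + 1"] by (simp add: DERIV_def)
    then show ?thesis using 2 by (simp add: exp_bump_def)
  next
    case 3
    have "((\<lambda>x. exp (- inverse x) * inverse x ^ n) has_real_derivative
      exp (- inverse x) * inverse x ^ (n + 2) - n * (exp (- inverse x) * inverse x ^ (n + 1))) (at x)"
    \<comment> \<open>The power rule produces the exponent \<open>n - 1\<close>, which truncates at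
      \<open>n = 0\<close>.\<close>
    proof (cases n)
      case 0
      then show ?thesis
        using 3 by (auto intro!: derivative_eq_intros simp: field_simps power2_eq_square)
    next
      case (Suc m)
      have "((\<lambda>x. inverse x ^ n) has_real_derivative - (n * inverse x ^ (n + 1))) (at x)"
        by (rule DERIV_cong[OF DERIV_power[OF DERIV_inverse]]) (use 3 in \<open>simp_all add: Suc\<close>)
      moreover have "((\<lambda>x. exp (- inverse x)) has_real_derivative exp (- inverse x) * inverse x ^ 2) (at x)"
        using 3 by (auto intro!: derivative_eq_intros simp: power2_eq_square)
      ultimately have "((\<lambda>x. exp (- inverse x) * inverse x ^ n) has_real_derivative
        exp (- inverse x) * inverse x ^ 2 * inverse x ^ n + - (n * inverse x ^ (n + 1)) * exp (- inverse x)) (at x)"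
        by (rule DERIV_mult[rotated])
      then show ?thesis by (rule DERIV_cong) (simp add: algebra_simps power_add power2_eq_square)
    qed
    then have "(exp_bump n has_real_derivative
      exp (- inverse x) * inverse x ^ (n + 2) - n * (exp (- inverse x) * inverse x ^ (n + 1))) (at x)"
      by (rule DERIV_cong_ev[THEN iffD1, OF refl _ refl, rotated])
        (use 3 in \<open>auto simp: exp_bump_def eventually_nhds intro!: exI[of _ "{0<..}"]\<close>)
    then show ?thesis using 3 by (simp add: exp_bump_def)
  qed
qed

lemma smooth_on_exp_bump: "smooth_on UNIV (exp_bump n)"
proof -
  have "Ck_on k UNIV (exp_bump n)" for k
  proof (induction k arbitrary: n)
    case 0
    then show ?case
      using has_derivative_exp_bump
      by (auto intro!: continuous_at_imp_continuous_on DERIV_isCont)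
  next
    case (Suc k)
    have der: "(exp_bump n has_derivative
        (\<lambda>v. (exp_bump (n + 2) x + (- real n) * exp_bump (n + 1) x) * v)) (at x)" for x
      using has_derivative_exp_bump[of n x] by (simp add: has_field_derivative_def)
    have "Ck_on k UNIV (\<lambda>x. (exp_bump (n + 2) x + (- real n) * exp_bump (n + 1) x) * v)" for v
      using Suc.IH by (intro Ck_on_bilinear[OF bounded_bilinear_mult] Ck_on_add) auto
    moreover have "frechet_derivative (exp_bump n) (at x) v
        = (exp_bump (n + 2) x + (- real n) * exp_bump (n + 1) x) * v" for v x
      using frechet_derivative_at[OF der[of x]] by metis
    ultimately show ?case using differentiableI[OF der] by simp
  qed
  then show ?thesis by (simp add: smooth_on_def)
qed

lemma exp_bump_0: "exp_bump 0 x = (if 0 < x then exp (- inverse x) else 0)"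
  by (simp add: exp_bump_def)

text \<open>The quotient a / (a + b), where \<open>a\<close> is positive exactly inside radius r and
  \<open>b\<close> exactly outside radius r / sqrt 2. The two regions overlap and cover the space,
  so the denominator never vanishes.\<close>

lemma ex_smooth_cutoff:
  fixes x0 :: "'a::euclidean_space"
  assumes "0 < r"
  shows "\<exists>\<rho> :: 'a \<Rightarrow> real. smooth_on UNIV \<rho> \<and> (\<exists>V. open V \<and> x0 \<in> V \<and> V \<subseteq> cball x0 r \<and> (\<forall>x\<in>V. \<rho> x = 1)) \<and>
    (\<forall>x. x \<notin> cball x0 r \<longrightarrow> \<rho> x = 0)"
proof -
  \<comment> \<open>The squared distance is polynomial, hence smooth at the centre too, where the
    norm is not.\<close>
  define s where "s x = (x - x0) \<bullet> (x - x0)" for x :: 'a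
  define c where "c = r\<^sup>2"
  have c: "c > 0" using assms by (simp add: c_def)
  define a where "a x = exp_bump 0 (c + (-1) * s x)" for x
  define b where "b x = exp_bump 0 (s x + (- c / 2))" for x
  have "smooth_on UNIV (\<lambda>x::'a. x - x0)"
    using smooth_on_add[of UNIV "\<lambda>x. x" "\<lambda>x. - x0"] by simp
  then have s: "smooth_on UNIV s"
    unfolding s_def by (intro smooth_on_bilinear[OF bounded_bilinear_inner]) auto
  have "smooth_on UNIV (\<lambda>x. c + (-1) * s x)" "smooth_on UNIV (\<lambda>x. s x + (- c / 2))"
    using s by (intro smooth_on_add smooth_on_mult; simp)+
  then have a: "smooth_on UNIV a" and b: "smooth_on UNIV b"
    unfolding a_def b_def
    by (auto intro: smooth_on_compose[OF _ _ _ smooth_on_exp_bump, of UNIV])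
  have nz: "a x + b x \<noteq> 0" for x
  proof -
    have "a x \<ge> 0" "b x \<ge> 0" "s x < c \<or> s x > c / 2"
      using c by (auto simp: a_def b_def exp_bump_0)
    moreover have "a x > 0" if "s x < c" using that by (simp add: a_def exp_bump_0)
    moreover have "b x > 0" if "s x > c/2" using that by (simp add: b_def exp_bump_0)
    ultimately show ?thesis by fastforce
  qed
  define \<rho> where "\<rho> x = a x * inverse (a x + b x)" for x
  \<comment> \<open>Inside this radius the squared distance is below \<open>c / 2\<close>, so
    \<open>b\<close> is 0 and the quotient is 1.\<close>
  define V where "V = ball x0 (r / sqrt 2)"
  have sd: "s x = (dist x0 x)\<^sup>2" for x
    by (simp add: s_def dist_norm power2_norm_eq_inner[symmetric] norm_minus_commute)
  have "\<rho> x = 1" if "x \<in> V" for x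
  proof -
    have "dist x0 x < r / sqrt 2" using that by (simp add: V_def)
    then have "(dist x0 x)\<^sup>2 < (r / sqrt 2)\<^sup>2" by (intro power_strict_mono) auto
    then have "s x < c / 2" by (simp add: sd c_def power_divide)
    then have "b x = 0" by (simp add: b_def exp_bump_0)
    then show ?thesis using nz[of x] by (simp add: \<rho>_def)
  qed
  moreover have "\<rho> x = 0" if "x \<notin> cball x0 r" for x
  proof -
    have "r < dist x0 x" using that by simp
    then have "r\<^sup>2 < (dist x0 x)\<^sup>2" using assms by (intro power_strict_mono) auto
    then show ?thesis by (simp add: \<rho>_def a_def exp_bump_0 sd c_def)
  qed
  moreover have "smooth_on UNIV \<rho>"
    unfolding \<rho>_def using a b nz by (intro smooth_on_mult smooth_on_inverse smooth_on_add) auto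
  moreover have "r / sqrt 2 \<le> r" using assms by (simp add: field_simps)
  then have "V \<subseteq> cball x0 r" "x0 \<in> V" "open V" using assms unfolding V_def by auto
  ultimately show ?thesis by blast
qed

section \<open>Symmetry of second derivatives\<close>

text \<open>The mean value theorem is applied along \<open>a\<close> to the increment of
  \<open>f\<close> in the direction \<open>b\<close>, and then along \<open>b\<close> to the
  derivative obtained. The value is that the second difference on the left does not change when
  \<open>a\<close> and \<open>b\<close> are exchanged.\<close>

lemma second_difference_mean_value:
  fixes f :: "'a::euclidean_space \<Rightarrow> real"
  assumes f: "smooth_on S f" and "0 < h"
    and S: "\<And>s t. 0 \<le> s \<Longrightarrow> s \<le> h \<Longrightarrow> 0 \<le> t \<Longrightarrow> t \<le> h \<Longrightarrow> x + s *\<^sub>R a + t *\<^sub>R b \<in> S"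
  shows "\<exists>s t. 0 \<le> s \<and> s \<le> h \<and> 0 \<le> t \<and> t \<le> h \<and>
    f (x + h *\<^sub>R a + h *\<^sub>R b) - f (x + h *\<^sub>R a) - f (x + h *\<^sub>R b) + f x =
    h * h * frechet_derivative (\<lambda>y. frechet_derivative f (at y) a) (at (x + s *\<^sub>R a + t *\<^sub>R b)) b"
proof -
  let ?f = "\<lambda>y. frechet_derivative f (at y) a"
  let ?ff = "\<lambda>y. frechet_derivative ?f (at y) b"
  have d: "((\<lambda>s. f (z + s *\<^sub>R v)) has_derivative (\<lambda>u. u * frechet_derivative f (at (z + s *\<^sub>R v)) v)) (at s)"
    if f: "smooth_on S f" "z + s *\<^sub>R v \<in> S" for f :: "'a \<Rightarrow> real" and z v s
  proof -
    have D: "(f has_derivative frechet_derivative f (at (z + s *\<^sub>R v))) (at (z + s *\<^sub>R v))"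
      using smooth_on_differentiable[OF f] frechet_derivative_works by blast
    have "((\<lambda>s. f (z + s *\<^sub>R v)) has_derivative (\<lambda>u. frechet_derivative f (at (z + s *\<^sub>R v)) (u *\<^sub>R v))) (at s)"
      by (rule has_derivative_compose[of "\<lambda>s. z + s *\<^sub>R v" "\<lambda>u. u *\<^sub>R v", OF _ D])
        (auto intro!: derivative_eq_intros)
    then show ?thesis
      using linear_frechet_derivative[OF smooth_on_differentiable[OF f]] by (simp add: linear_scale)
  qed
  let ?\<phi> = "\<lambda>s. f ((x + h *\<^sub>R b) + s *\<^sub>R a) - f (x + s *\<^sub>R a)"
  have "\<exists>s\<in>{0<..<h}. ?\<phi> h - ?\<phi> 0 =
     (h - 0) * ?f ((x + h *\<^sub>R b) + s *\<^sub>R a) - (h - 0) * ?f (x + s *\<^sub>R a)"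
  proof (rule mvt_simple[OF \<open>0 < h\<close>])
    fix s assume "0 \<le> s" "s \<le> h"
    then have "x + h *\<^sub>R b + s *\<^sub>R a \<in> S" "x + s *\<^sub>R a \<in> S"
      using S[of s h] S[of s 0] \<open>0 < h\<close> by (simp_all add: algebra_simps)
    then have "(?\<phi> has_derivative (\<lambda>u. u * ?f ((x + h *\<^sub>R b) + s *\<^sub>R a) - u * ?f (x + s *\<^sub>R a))) (at s)"
      by (intro has_derivative_diff d f)
    then show "(?\<phi> has_derivative (\<lambda>u. u * ?f ((x + h *\<^sub>R b) + s *\<^sub>R a) - u * ?f (x + s *\<^sub>R a)))
        (at s within {0..h})"
      by (rule has_derivative_at_withinI)
  qed
  then obtain s where s: "0 < s" "s < h" and
    eq: "?\<phi> h - ?\<phi> 0 = h * (?f (x + s *\<^sub>R a + h *\<^sub>R b) - ?f (x + s *\<^sub>R a))"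
    by (auto simp: algebra_simps)
  have "\<exists>t\<in>{0<..<h}. ?f ((x + s *\<^sub>R a) + h *\<^sub>R b) - ?f ((x + s *\<^sub>R a) + 0 *\<^sub>R b)
      = (h - 0) * ?ff ((x + s *\<^sub>R a) + t *\<^sub>R b)"
  proof (rule mvt_simple[OF \<open>0 < h\<close>])
    fix t assume "0 \<le> t" "t \<le> h"
    then have "x + s *\<^sub>R a + t *\<^sub>R b \<in> S" using S s by simp
    from d[OF smooth_on_derivative[OF f] this]
    show "((\<lambda>t. ?f (x + s *\<^sub>R a + t *\<^sub>R b)) has_derivative (\<lambda>u. u * ?ff (x + s *\<^sub>R a + t *\<^sub>R b)))
      (at t within {0..h})"
      by (rule has_derivative_at_withinI)
  qed
  then obtain t where t: "0 < t" "t < h" and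
    eq2: "?f (x + s *\<^sub>R a + h *\<^sub>R b) - ?f (x + s *\<^sub>R a) = h * ?ff (x + s *\<^sub>R a + t *\<^sub>R b)"
    by auto
  show ?thesis
    using s t eq eq2 by (intro exI[of _ s] exI[of _ t]) (auto simp: algebra_simps)
qed

lemma symmetric_second_derivative:
  fixes f :: "'a::euclidean_space \<Rightarrow> real"
  assumes f: "smooth_on S f" and S: "open S" "x \<in> S"
  shows "frechet_derivative (\<lambda>y. frechet_derivative f (at y) a) (at x) b =
    frechet_derivative (\<lambda>y. frechet_derivative f (at y) b) (at x) a"
proof -
  define F where "F a b y = frechet_derivative (\<lambda>y. frechet_derivative f (at y) a) (at y) b" for a b y
  have cont: "isCont (F a b) x" for a b
    using S smooth_on_continuous[OF smooth_on_derivative[OF smooth_on_derivative[OF f, of a], of b]]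
    by (simp add: F_def[abs_def] continuous_on_eq_continuous_at)
  have "\<bar>F a b x - F b a x\<bar> \<le> \<epsilon>" if "\<epsilon> > 0" for \<epsilon>
  proof -
    have ev: "\<forall>\<^sub>F y in nhds x. dist (F a b y) (F a b x) < \<epsilon> / 2" for a b
      using cont[of a b] \<open>\<epsilon> > 0\<close> unfolding isCont_def tendsto_at_iff_tendsto_nhds
      by (intro tendstoD) auto
    have "\<forall>\<^sub>F y in nhds x. y \<in> S \<and> dist (F a b y) (F a b x) < \<epsilon> / 2 \<and> dist (F b a y) (F b a x) < \<epsilon> / 2"
      using ev[of a b] ev[of b a] eventually_nhds_in_open[OF S] by eventually_elim auto
    then obtain d where d: "d > 0" and
      near: "\<And>y. dist y x < d \<Longrightarrow> y \<in> S \<and> dist (F a b y) (F a b x) < \<epsilon> / 2 \<and> dist (F b a y) (F b a x) < \<epsilon> / 2"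
      unfolding eventually_nhds_metric by blast
    \<comment> \<open>Small enough that the whole parallelogram spanned at \<open>x\<close> by
      \<open>h\<close> times \<open>a\<close> and \<open>b\<close> stays within distance
      \<open>d\<close>; the summand 1 gives a positive denominator and a strict bound.\<close>
    define h where "h = d / (norm a + norm b + 1)"
    have n: "norm a + norm b + 1 > 0" by (simp add: add_nonneg_pos)
    have h: "h > 0" using d n by (simp add: h_def)
    have close: "dist (x + s *\<^sub>R a + t *\<^sub>R b) x < d" if "0 \<le> s" "s \<le> h" "0 \<le> t" "t \<le> h" for s t
    proof -
      have "norm (s *\<^sub>R a + t *\<^sub>R b) \<le> s * norm a + t * norm b"
        using norm_triangle_ineq[of "s *\<^sub>R a" "t *\<^sub>R b"] that by simp
      also have "\<dots> \<le> h * norm a + h * norm b"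
        using that by (intro add_mono mult_right_mono) auto
      also have "\<dots> < h * (norm a + norm b + 1)" using h by (simp add: algebra_simps)
      also have "\<dots> = d" using n by (simp add: h_def)
      finally show ?thesis by (simp add: dist_norm algebra_simps)
    qed
    obtain s t where st: "0 \<le> s" "s \<le> h" "0 \<le> t" "t \<le> h" and
      1: "f (x + h *\<^sub>R a + h *\<^sub>R b) - f (x + h *\<^sub>R a) - f (x + h *\<^sub>R b) + f x =
        h * h * F a b (x + s *\<^sub>R a + t *\<^sub>R b)"
      using second_difference_mean_value[OF f h, of x a b] close near unfolding F_def by blast
    have close': "dist (x + s *\<^sub>R b + t *\<^sub>R a) x < d" if "0 \<le> s" "s \<le> h" "0 \<le> t" "t \<le> h" for s t
      using close[of t s] that by (simp add: algebra_simps)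
    obtain s' t' where st': "0 \<le> s'" "s' \<le> h" "0 \<le> t'" "t' \<le> h" and
      2: "f (x + h *\<^sub>R b + h *\<^sub>R a) - f (x + h *\<^sub>R b) - f (x + h *\<^sub>R a) + f x =
        h * h * F b a (x + s' *\<^sub>R b + t' *\<^sub>R a)"
      using second_difference_mean_value[OF f h, of x b a] close' near unfolding F_def by blast
    \<comment> \<open>Both mixed derivatives, at nearby points, compute the same second
      difference.\<close>
    have "h * h * F a b (x + s *\<^sub>R a + t *\<^sub>R b) = h * h * F b a (x + s' *\<^sub>R b + t' *\<^sub>R a)"
      using 1 2 by (simp add: algebra_simps)
    then have "F a b (x + s *\<^sub>R a + t *\<^sub>R b) = F b a (x + s' *\<^sub>R b + t' *\<^sub>R a)" using h by simp
    moreover have "dist (F a b (x + s *\<^sub>R a + t *\<^sub>R b)) (F a b x) < \<epsilon> / 2"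
      "dist (F b a (x + s' *\<^sub>R b + t' *\<^sub>R a)) (F b a x) < \<epsilon> / 2"
      using near[OF close[OF st]] near[OF close'[OF st']] by blast+
    ultimately show ?thesis unfolding dist_real_def by linarith
  qed
  then have "F a b x = F b a x" using dense_ge[of 0 "\<bar>F a b x - F b a x\<bar>"] by auto
  then show ?thesis by (simp add: F_def)
qed

section \<open>Smooth manifolds\<close>

locale manifold =
  fixes A :: "('p::{t2_space,second_countable_topology}, 'e::euclidean_space) chart set"
  assumes atlas: "smooth_atlas A"
begin

section \<open>Charts and smooth functions on open subsets\<close>

lemma chartD:
  assumes "(U, c) \<in> A"
  shows "open U" "open (c ` U)" "homeomorphism U (c ` U) c (inv_into U c)" "inj_on c U"
proof -
  show "open U" "open (c ` U)" and h: "homeomorphism U (c ` U) c (inv_into U c)"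
    using atlas assms unfolding smooth_atlas_def by fast+
  show "inj_on c U" using h unfolding homeomorphism_def by (metis inj_on_inverseI)
qed

lemma transition_smooth:
  "(U, c) \<in> A \<Longrightarrow> (V, d) \<in> A \<Longrightarrow> smooth_on (c ` (U \<inter> V)) (d \<circ> inv_into U c)"
  using atlas unfolding smooth_atlas_def by fast

lemma chart_image_open:
  assumes "(U, c) \<in> A" "open S"
  shows "open (c ` (U \<inter> S))"
proof -
  have "openin (top_of_set (c ` U)) (c ` (U \<inter> S))"
    using chartD[OF assms(1)] assms(2) by (intro homeomorphism_imp_open_map) auto
  then show ?thesis using chartD[OF assms(1)] openin_open_trans by blast
qed

lemma chart_at_mem: "chart_at A p \<in> A" and in_chart_at: "p \<in> fst (chart_at A p)"
proof -
  have "\<exists>c. c \<in> A \<and> p \<in> fst c"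
  proof -
    have "(\<Union>(U, c)\<in>A. U) = UNIV"
      using atlas unfolding smooth_atlas_def by (rule conjunct1)
    then have "p \<in> (\<Union>(U, c)\<in>A. U)" by (simp only: UNIV_I)
    then show ?thesis by auto
  qed
  from someI_ex[OF this] show "chart_at A p \<in> A" "p \<in> fst (chart_at A p)"
    by (simp_all add: chart_at_def)
qed

abbreviation "cdom p \<equiv> fst (chart_at A p)"

lemma coord_at_chart: "(cdom p, coord_at A p) \<in> A"
  using chart_at_mem[of p] by (simp add: coord_at_def)

lemma param_at_eq: "param_at A p = inv_into (cdom p) (coord_at A p)"
  by (simp add: param_at_def coord_at_def)

lemma param_coord [simp]: "q \<in> cdom p \<Longrightarrow> param_at A p (coord_at A p q) = q"
  using chartD(4)[OF coord_at_chart[of p]] by (simp add: param_at_eq)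

lemma open_dom [simp]: "open (cdom p)"
  using chartD(1)[OF coord_at_chart] .

lemma open_coord_image [simp]: "open S \<Longrightarrow> open (coord_at A p ` (cdom p \<inter> S))"
  using chart_image_open[OF coord_at_chart] .

text \<open>Smoothness in one chart carries over to all others by composing with the transition
  maps.\<close>

lemma chart_smooth_fun:
  assumes Uc: "(U, c) \<in> A" and W: "open W" "W \<subseteq> U" and u: "smooth_on (c ` W) (u \<circ> inv_into U c)"
  shows "smooth_fun_on A W u"
  unfolding smooth_fun_on_def
proof clarify
  fix V d assume Vd: "(V, d) \<in> A"
  have o: "open (d ` (V \<inter> W))" using chart_image_open[OF Vd W(1)] .
  have inv: "inv_into V d (d q) = q" if "q \<in> V" for q using chartD(4)[OF Vd] that by simp
  have inv': "inv_into U c (c q) = q" if "q \<in> U" for q using chartD(4)[OF Uc] that by simp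
  have "smooth_on (d ` (V \<inter> W)) (\<lambda>x. (u \<circ> inv_into U c) ((c \<circ> inv_into V d) x))"
  proof (rule smooth_on_compose[OF o _ _ u])
    show "smooth_on (d ` (V \<inter> W)) (c \<circ> inv_into V d)"
      using transition_smooth[OF Vd Uc] by (rule smooth_on_mono) (use W in auto)
  qed (auto simp: inv)
  then show "smooth_on (d ` (V \<inter> W)) (u \<circ> inv_into V d)"
    by (rule smooth_on_cong[OF o, rotated]) (use W inv inv' in auto)
qed

lemma smooth_fun_on_local:
  assumes "\<And>p. p \<in> S \<Longrightarrow> \<exists>W. open W \<and> p \<in> W \<and> smooth_fun_on A W u"
  shows "smooth_fun_on A S u"
  unfolding smooth_fun_on_def
proof clarify
  fix U c assume Uc: "(U, c) \<in> A"
  show "smooth_on (c ` (U \<inter> S)) (u \<circ> inv_into U c)"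
  proof (rule smooth_on_local)
    fix x assume "x \<in> c ` (U \<inter> S)"
    then obtain p where p: "p \<in> U" "p \<in> S" "x = c p" by auto
    obtain W where W: "open W" "p \<in> W" "smooth_fun_on A W u" using assms[OF p(2)] by blast
    then show "\<exists>T. open T \<and> x \<in> T \<and> smooth_on T (u \<circ> inv_into U c)"
      using chart_image_open[OF Uc W(1)] p Uc unfolding smooth_fun_on_def by blast
  qed
qed

lemma smooth_fun_onD:
  "smooth_fun_on A S u \<Longrightarrow> (U, c) \<in> A \<Longrightarrow> smooth_on (c ` (U \<inter> S)) (u \<circ> inv_into U c)"
  unfolding smooth_fun_on_def by blast

lemma smooth_fun_on_mono: "smooth_fun_on A S u \<Longrightarrow> T \<subseteq> S \<Longrightarrow> smooth_fun_on A T u"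
  by (rule smooth_fun_on_def[THEN iffD2]) (auto dest!: smooth_fun_onD intro: smooth_on_mono)

lemma smooth_fun_on_cong:
  assumes "open S" "\<And>q. q \<in> S \<Longrightarrow> u q = w q" "smooth_fun_on A S u"
  shows "smooth_fun_on A S w"
  unfolding smooth_fun_on_def
proof clarify
  fix U c assume Uc: "(U, c) \<in> A"
  show "smooth_on (c ` (U \<inter> S)) (w \<circ> inv_into U c)"
    using assms(2) chartD(4)[OF Uc]
    by (intro smooth_on_cong[OF chart_image_open[OF Uc assms(1)] _ smooth_fun_onD[OF assms(3) Uc]]) auto
qed

lemma smooth_fun_on_const [simp]: "smooth_fun_on A S (\<lambda>q. a)"
  by (auto simp: smooth_fun_on_def comp_def)

lemma smooth_fun_on_add:
  assumes "open S" "smooth_fun_on A S u" "smooth_fun_on A S w"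
  shows "smooth_fun_on A S (\<lambda>q. u q + w q)"
  unfolding smooth_fun_on_def
proof clarify
  fix U c assume Uc: "(U, c) \<in> A"
  show "smooth_on (c ` (U \<inter> S)) ((\<lambda>q. u q + w q) \<circ> inv_into U c)"
    using smooth_on_add[OF chart_image_open[OF Uc assms(1)] smooth_fun_onD[OF assms(2) Uc]
        smooth_fun_onD[OF assms(3) Uc]] by (simp add: comp_def)
qed

lemma smooth_fun_on_mult:
  assumes "open S" "smooth_fun_on A S u" "smooth_fun_on A S w"
  shows "smooth_fun_on A S (\<lambda>q. u q * w q)"
  unfolding smooth_fun_on_def
proof clarify
  fix U c assume Uc: "(U, c) \<in> A"
  show "smooth_on (c ` (U \<inter> S)) ((\<lambda>q. u q * w q) \<circ> inv_into U c)"
    using smooth_on_mult[OF chart_image_open[OF Uc assms(1)] smooth_fun_onD[OF assms(2) Uc]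
        smooth_fun_onD[OF assms(3) Uc]] by (simp add: comp_def)
qed

lemma smooth_fun_on_inverse:
  assumes "open S" "smooth_fun_on A S u" "\<And>q. q \<in> S \<Longrightarrow> u q \<noteq> 0"
  shows "smooth_fun_on A S (\<lambda>q. inverse (u q))"
  unfolding smooth_fun_on_def
proof clarify
  fix U c assume Uc: "(U, c) \<in> A"
  show "smooth_on (c ` (U \<inter> S)) ((\<lambda>q. inverse (u q)) \<circ> inv_into U c)"
    unfolding comp_def
  proof (rule smooth_on_inverse[OF chart_image_open[OF Uc assms(1)]])
    show "smooth_on (c ` (U \<inter> S)) (\<lambda>x. u (inv_into U c x))"
      using smooth_fun_onD[OF assms(2) Uc] by (simp add: comp_def)
  qed (use assms(3) chartD(4)[OF Uc] in auto)
qed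

lemma smooth_fun_on_diff:
  assumes "open S" "smooth_fun_on A S u" "smooth_fun_on A S w"
  shows "smooth_fun_on A S (\<lambda>q. u q - w q)"
proof -
  have "smooth_fun_on A S (\<lambda>q. u q + (-1) * w q)"
    by (intro smooth_fun_on_add smooth_fun_on_mult smooth_fun_on_const assms)
  then show ?thesis by simp
qed

lemma smooth_fun_on_sum:
  assumes "open S" "\<And>i. i \<in> I \<Longrightarrow> smooth_fun_on A S (u i)"
  shows "smooth_fun_on A S (\<lambda>q. \<Sum>i\<in>I. u i q)"
  using assms(2)
proof (induction I rule: infinite_finite_induct)
  case (insert i I)
  have "smooth_fun_on A S (\<lambda>x. u i x + (\<Sum>i\<in>I. u i x))"
    using insert.IH insert.prems by (intro smooth_fun_on_add[OF assms(1)]) simp_all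
  then show ?case using insert.hyps by simp
qed simp_all

section \<open>Tangent vectors as derivations\<close>

definition diff_at :: "'p \<Rightarrow> ('p \<Rightarrow> real) \<Rightarrow> bool" where
  "diff_at p u \<longleftrightarrow> (u \<circ> param_at A p) differentiable (at (coord_at A p p))"

lemma smooth_fun_on_diff_at: "smooth_fun_on A S u \<Longrightarrow> p \<in> S \<Longrightarrow> diff_at p u"
  using smooth_fun_onD[OF _ coord_at_chart[of p]] in_chart_at[of p]
  unfolding diff_at_def param_at_eq by (intro smooth_on_differentiable) auto

lemma smooth_fun_diff_at: "smooth_fun A u \<Longrightarrow> diff_at p u"
  by (rule smooth_fun_on_diff_at) auto

lemma diff_at_deriv:
  "diff_at p u \<Longrightarrow> ((u \<circ> param_at A p) has_derivative (\<lambda>v. dir_deriv A p v u)) (at (coord_at A p p))"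
  unfolding diff_at_def dir_deriv_def by (simp add: frechet_derivative_works[symmetric])

lemma dir_deriv_eqI:
  "((u \<circ> param_at A p) has_derivative D) (at (coord_at A p p)) \<Longrightarrow> dir_deriv A p v u = D v"
  unfolding dir_deriv_def by (metis frechet_derivative_at)

lemma param_near:
  assumes "open W" "p \<in> W"
  obtains T where "open T" "coord_at A p p \<in> T" "\<And>x. x \<in> T \<Longrightarrow> param_at A p x \<in> W \<inter> cdom p"
    "\<And>x. x \<in> T \<Longrightarrow> coord_at A p (param_at A p x) = x"
  using assms in_chart_at[of p] by (intro that[of "coord_at A p ` (cdom p \<inter> W)"]) auto

text \<open>Tangent vectors act on germs. This is what makes cutting off harmless: a cut-off
  function has the derivative of the original wherever the bump is 1 nearby.\<close>

lemma dir_deriv_cong: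
  assumes "open W" "p \<in> W" "\<And>q. q \<in> W \<Longrightarrow> u q = w q"
  shows "dir_deriv A p v u = dir_deriv A p v w" and "diff_at p u \<longleftrightarrow> diff_at p w"
proof -
  obtain T where T: "open T" "coord_at A p p \<in> T" "\<And>x. x \<in> T \<Longrightarrow> param_at A p x \<in> W \<inter> cdom p"
    "\<And>x. x \<in> T \<Longrightarrow> coord_at A p (param_at A p x) = x"
    by (rule param_near[OF assms(1,2)]) (rule that)
  have der: "((u \<circ> param_at A p) has_derivative D) (at (coord_at A p p)) \<longleftrightarrow>
    ((w \<circ> param_at A p) has_derivative D) (at (coord_at A p p))" for D
  proof (rule has_derivative_cong_open[OF T(1,2)])
    fix x assume "x \<in> T"
    then have "param_at A p x \<in> W" using T(3) by blast
    from assms(3)[OF this] show "(u \<circ> param_at A p) x = (w \<circ> param_at A p) x" by (simp only: comp_apply)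
  qed
  then show "diff_at p u \<longleftrightarrow> diff_at p w" unfolding diff_at_def differentiable_def by simp
  show "dir_deriv A p v u = dir_deriv A p v w"
    unfolding dir_deriv_def frechet_derivative_def using der by simp
qed

lemma dir_deriv_linear: "diff_at p u \<Longrightarrow> linear (\<lambda>v. dir_deriv A p v u)"
  unfolding diff_at_def dir_deriv_def by (rule linear_frechet_derivative)

lemma dir_deriv_vec_add: "diff_at p u \<Longrightarrow> dir_deriv A p (v + w) u = dir_deriv A p v u + dir_deriv A p w u"
  using linear_add[OF dir_deriv_linear] .

lemma dir_deriv_vec_scale: "diff_at p u \<Longrightarrow> dir_deriv A p (a *\<^sub>R v) u = a * dir_deriv A p v u"
  using linear_scale[OF dir_deriv_linear] by simp

lemma dir_deriv_vec_diff: "diff_at p u \<Longrightarrow> dir_deriv A p (v - w) u = dir_deriv A p v u - dir_deriv A p w u"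
  using linear_diff[OF dir_deriv_linear] .

lemma dir_deriv_vec_sum: "diff_at p u \<Longrightarrow> dir_deriv A p (\<Sum>i\<in>I. v i) u = (\<Sum>i\<in>I. dir_deriv A p (v i) u)"
  using linear_sum[OF dir_deriv_linear] .

lemma dir_deriv_const [simp]: "dir_deriv A p v (\<lambda>q. a) = 0"
  by (rule dir_deriv_eqI) (simp add: comp_def)

lemma diff_at_const [simp]: "diff_at p (\<lambda>q. a)"
  by (simp add: diff_at_def comp_def)

lemma
  assumes "diff_at p u" "diff_at p w"
  shows dir_deriv_add: "dir_deriv A p v (\<lambda>q. u q + w q) = dir_deriv A p v u + dir_deriv A p v w"
    and diff_at_add: "diff_at p (\<lambda>q. u q + w q)"
proof -
  have *: "(((\<lambda>q. u q + w q) \<circ> param_at A p) has_derivative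
    (\<lambda>v. dir_deriv A p v u + dir_deriv A p v w)) (at (coord_at A p p))"
    using has_derivative_add[OF diff_at_deriv[OF assms(1)] diff_at_deriv[OF assms(2)]] by (simp add: comp_def)
  show "dir_deriv A p v (\<lambda>q. u q + w q) = dir_deriv A p v u + dir_deriv A p v w"
    by (rule dir_deriv_eqI[OF *])
  show "diff_at p (\<lambda>q. u q + w q)" unfolding diff_at_def using * differentiableI by blast
qed

lemma
  assumes "diff_at p u" "diff_at p w"
  shows dir_deriv_mult: "dir_deriv A p v (\<lambda>q. u q * w q) = dir_deriv A p v u * w p + u p * dir_deriv A p v w"
    and diff_at_mult: "diff_at p (\<lambda>q. u q * w q)"
proof -
  have *: "(((\<lambda>q. u q * w q) \<circ> param_at A p) has_derivative
    (\<lambda>v. u p * dir_deriv A p v w + dir_deriv A p v u * w p)) (at (coord_at A p p))"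
    using has_derivative_mult[OF diff_at_deriv[OF assms(1)] diff_at_deriv[OF assms(2)]] in_chart_at[of p]
    by (simp add: comp_def)
  show "dir_deriv A p v (\<lambda>q. u q * w q) = dir_deriv A p v u * w p + u p * dir_deriv A p v w"
    using dir_deriv_eqI[OF *] by simp
  show "diff_at p (\<lambda>q. u q * w q)" unfolding diff_at_def using * differentiableI by blast
qed

lemma
  assumes "\<And>i. i \<in> I \<Longrightarrow> diff_at p (u i)"
  shows dir_deriv_sum: "dir_deriv A p v (\<lambda>q. \<Sum>i\<in>I. u i q) = (\<Sum>i\<in>I. dir_deriv A p v (u i))"
    and diff_at_sum: "diff_at p (\<lambda>q. \<Sum>i\<in>I. u i q)"
proof -
  have "dir_deriv A p v (\<lambda>q. \<Sum>i\<in>I. u i q) = (\<Sum>i\<in>I. dir_deriv A p v (u i)) \<and>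
    diff_at p (\<lambda>q. \<Sum>i\<in>I. u i q)"
    using assms
  proof (induction I rule: infinite_finite_induct)
    case (insert i I)
    have "diff_at p (u i)" "diff_at p (\<lambda>q. \<Sum>i\<in>I. u i q)" using insert by auto
    from dir_deriv_add[OF this] diff_at_add[OF this] show ?case using insert by simp
  qed simp_all
  then show "dir_deriv A p v (\<lambda>q. \<Sum>i\<in>I. u i q) = (\<Sum>i\<in>I. dir_deriv A p v (u i))"
    "diff_at p (\<lambda>q. \<Sum>i\<in>I. u i q)" by auto
qed

section \<open>Vector fields, bump functions and extension\<close>

lemma vector_field_onD:
  "vector_field_on A S X \<Longrightarrow> smooth_fun A u \<Longrightarrow> smooth_fun_on A S (\<lambda>p. dir_deriv A p (X p) u)"
  unfolding vector_field_on_def by blast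

lemma vector_field_on_zero: "vector_field_on A S (\<lambda>p. 0)"
  unfolding vector_field_on_def
  using linear_0[OF dir_deriv_linear[OF smooth_fun_diff_at]] by simp

lemma vector_field_on_diff:
  "open S \<Longrightarrow> vector_field_on A S X \<Longrightarrow> vector_field_on A S Y \<Longrightarrow> vector_field_on A S (\<lambda>p. X p - Y p)"
  unfolding vector_field_on_def
  by (simp add: dir_deriv_vec_diff[OF smooth_fun_diff_at] smooth_fun_on_diff)

lemma vector_field_on_scale:
  "open S \<Longrightarrow> smooth_fun_on A S w \<Longrightarrow> vector_field_on A S X \<Longrightarrow> vector_field_on A S (\<lambda>p. w p *\<^sub>R X p)"
  unfolding vector_field_on_def
  by (simp add: dir_deriv_vec_scale[OF smooth_fun_diff_at] smooth_fun_on_mult)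

lemma vector_field_on_sum:
  "open S \<Longrightarrow> (\<And>i. i \<in> I \<Longrightarrow> vector_field_on A S (X i)) \<Longrightarrow> vector_field_on A S (\<lambda>p. \<Sum>i\<in>I. X i p)"
  unfolding vector_field_on_def
  by (simp add: dir_deriv_vec_sum[OF smooth_fun_diff_at] smooth_fun_on_sum)

text \<open>The closed set \<open>K\<close> is kept in the conclusion because extension by zero
  needs an open set, the complement of \<open>K\<close>, on which \<open>\<rho>\<close> vanishes and
  which covers the manifold together with \<open>W\<close>.\<close>

lemma ex_bump:
  assumes W: "open W" "p \<in> W"
  obtains \<rho> V K where "smooth_fun A \<rho>" "open V" "p \<in> V" "V \<subseteq> K" "closed K" "K \<subseteq> W"
    "\<And>q. q \<in> V \<Longrightarrow> \<rho> q = 1" "\<And>q. q \<notin> K \<Longrightarrow> \<rho> q = 0"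
proof -
  let ?U = "cdom p" and ?c = "coord_at A p" and ?i = "param_at A p"
  have hom: "homeomorphism ?U (?c ` ?U) ?c ?i"
    using chartD(3)[OF coord_at_chart[of p]] by (simp add: param_at_eq)
  obtain r where r: "r > 0" "cball (?c p) r \<subseteq> ?c ` (?U \<inter> W)"
    using open_contains_cball[of "?c ` (?U \<inter> W)"] W in_chart_at[of p] open_coord_image by blast
  obtain \<kappa> V' where \<kappa>: "smooth_on UNIV \<kappa>" "open V'" "?c p \<in> V'" "V' \<subseteq> cball (?c p) r"
    "\<And>x. x \<in> V' \<Longrightarrow> \<kappa> x = 1" "\<And>x. x \<notin> cball (?c p) r \<Longrightarrow> (\<kappa> x :: real) = 0"
    using ex_smooth_cutoff[OF r(1), of "?c p"] by blast
  define K where "K = ?i ` cball (?c p) r"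
  define V where "V = ?c -` V' \<inter> ?U"
  define \<rho> where "\<rho> q = (if q \<in> ?U then \<kappa> (?c q) else 0)" for q
  have "continuous_on (cball (?c p) r) ?i"
    using homeomorphism_cont2[OF hom] r by (auto intro: continuous_on_subset)
  \<comment> \<open>Compact as the image of a closed ball, hence closed in the Hausdorff
    space.\<close>
  then have K: "closed K" unfolding K_def by (intro compact_imp_closed compact_continuous_image) auto
  have V: "open V"
    using continuous_on_open_vimage[OF open_dom, of p ?c] homeomorphism_cont1[OF hom] \<kappa>(2)
    by (auto simp: V_def)
  have KW: "K \<subseteq> W \<inter> ?U" using r(2) by (auto simp: K_def)
  have outK: "\<rho> q = 0" if "q \<notin> K" for q
    using \<kappa>(6)[of "?c q"] that param_coord[of q p] unfolding \<rho>_def K_def by force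
  have inV: "\<rho> q = 1" if "q \<in> V" for q
    using that \<kappa>(5) by (simp add: V_def \<rho>_def)
  have VK: "V \<subseteq> K"
  proof
    fix q assume "q \<in> V"
    then have "\<rho> q = 1" by (rule inV)
    then show "q \<in> K" using outK[of q] by auto
  qed
  have "smooth_fun_on A ?U \<rho>"
  proof (rule chart_smooth_fun[OF coord_at_chart])
    show "smooth_on (?c ` ?U) (\<rho> \<circ> inv_into ?U ?c)"
      using chartD(2)[OF coord_at_chart[of p]]
      by (rule smooth_on_cong[OF _ _ smooth_on_mono[OF \<kappa>(1)]])
        (auto simp: \<rho>_def param_at_eq[symmetric])
  qed auto
  moreover have "smooth_fun_on A (- K) \<rho>"
    by (rule smooth_fun_on_cong[of _ "\<lambda>q. 0"]) (use K outK in auto)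
  ultimately have "smooth_fun A \<rho>"
    using K KW by (intro smooth_fun_on_local) (metis Compl_iff IntE open_Compl open_dom subsetD)
  then show ?thesis
    using V VK K KW inV outK in_chart_at[of p] \<kappa>(3) by (intro that[of \<rho> V K]) (auto simp: V_def)
qed

text \<open>Whatever values \<open>u\<close> has outside \<open>W\<close>, the product is smooth on
  \<open>W\<close> and zero on the complement of \<open>K\<close>, and these open sets
  cover.\<close>

lemma smooth_fun_extend:
  assumes "smooth_fun A \<rho>" "closed K" "K \<subseteq> W" "open W" "\<And>q. q \<notin> K \<Longrightarrow> \<rho> q = 0"
    and "smooth_fun_on A W u"
  shows "smooth_fun A (\<lambda>q. \<rho> q * u q)"
proof (rule smooth_fun_on_local)
  have "smooth_fun_on A W (\<lambda>q. \<rho> q * u q)"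
    using assms smooth_fun_on_mono[OF assms(1)] by (intro smooth_fun_on_mult) auto
  moreover have "smooth_fun_on A (- K) (\<lambda>q. \<rho> q * u q)"
    by (rule smooth_fun_on_cong[of _ "\<lambda>q. 0"]) (use assms in auto)
  ultimately show "\<exists>S. open S \<and> q \<in> S \<and> smooth_fun_on A S (\<lambda>q. \<rho> q * u q)" for q
    using assms by (metis Compl_iff open_Compl subsetD)
qed

lemma vector_field_extend:
  assumes "smooth_fun A \<rho>" "closed K" "K \<subseteq> W" "open W" "\<And>q. q \<notin> K \<Longrightarrow> \<rho> q = 0"
    and "vector_field_on A W X"
  shows "vector_field A (\<lambda>q. \<rho> q *\<^sub>R X q)"
  unfolding vector_field_on_def
proof clarify
  fix u assume u: "smooth_fun A u"
  from smooth_fun_extend[OF assms(1-5) vector_field_onD[OF assms(6) u]]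
  show "smooth_fun A (\<lambda>p. dir_deriv A p (\<rho> p *\<^sub>R X p) u)"
    by (simp add: dir_deriv_vec_scale[OF smooth_fun_diff_at[OF u]])
qed

section \<open>Coordinate frames and the Lie bracket\<close>

lemma transition_differentiable:
  assumes "r \<in> cdom p" "r \<in> cdom q"
  shows "(coord_at A p \<circ> param_at A q) differentiable (at (coord_at A q r))"
proof -
  have "smooth_on (coord_at A q ` (cdom q \<inter> cdom p)) (coord_at A p \<circ> param_at A q)"
    unfolding param_at_eq by (rule transition_smooth[OF coord_at_chart coord_at_chart])
  then show ?thesis by (rule smooth_on_differentiable) (use assms in auto)
qed

lemma transition_inverse:
  assumes "r \<in> cdom p" "r \<in> cdom q"
  shows "frechet_derivative (coord_at A p \<circ> param_at A q) (at (coord_at A q r))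
    (frechet_derivative (coord_at A q \<circ> param_at A p) (at (coord_at A p r)) v) = v"
proof -
  have "((coord_at A p \<circ> param_at A q) \<circ> (coord_at A q \<circ> param_at A p) has_derivative
    frechet_derivative (coord_at A p \<circ> param_at A q) (at (coord_at A q r)) \<circ>
    frechet_derivative (coord_at A q \<circ> param_at A p) (at (coord_at A p r))) (at (coord_at A p r))"
    using transition_differentiable[OF assms] transition_differentiable[OF assms(2,1)] assms
    by (intro diff_chain_at) (simp_all add: frechet_derivative_works[symmetric])
  then have "((\<lambda>x. x) has_derivative
    frechet_derivative (coord_at A p \<circ> param_at A q) (at (coord_at A q r)) \<circ>
    frechet_derivative (coord_at A q \<circ> param_at A p) (at (coord_at A p r))) (at (coord_at A p r))"
    by (rule has_derivative_transform_within_open[OF _ open_coord_image[OF open_dom[of q], of p]])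
      (use assms in auto)
  from has_derivative_unique[OF this has_derivative_ident] show ?thesis by (metis comp_apply)
qed

text \<open>A vector at \<open>q\<close> is given in the chart chosen at \<open>q\<close>, which may
  change abruptly with \<open>q\<close>. Converting it to the single chart chosen at
  \<open>p\<close> makes smooth dependence on \<open>q\<close> accessible.\<close>

lemma dir_deriv_in_chart:
  assumes u: "smooth_fun_on A S u" and q: "q \<in> S" "q \<in> cdom p" and S: "open S"
  shows "dir_deriv A q v u = frechet_derivative (u \<circ> param_at A p) (at (coord_at A p q))
    (frechet_derivative (coord_at A p \<circ> param_at A q) (at (coord_at A q q)) v)"
proof -
  have "(u \<circ> param_at A p) differentiable (at (coord_at A p q))"
    using smooth_on_differentiable[OF smooth_fun_onD[OF u coord_at_chart[of p]]] q
    by (auto simp: param_at_eq)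
  then have "((u \<circ> param_at A p) \<circ> (coord_at A p \<circ> param_at A q) has_derivative
    frechet_derivative (u \<circ> param_at A p) (at (coord_at A p q)) \<circ>
    frechet_derivative (coord_at A p \<circ> param_at A q) (at (coord_at A q q))) (at (coord_at A q q))"
    using transition_differentiable[OF q(2) in_chart_at] in_chart_at[of q]
    by (intro diff_chain_at) (simp_all add: frechet_derivative_works[symmetric])
  then have "(u \<circ> param_at A q has_derivative
    frechet_derivative (u \<circ> param_at A p) (at (coord_at A p q)) \<circ>
    frechet_derivative (coord_at A p \<circ> param_at A q) (at (coord_at A q q))) (at (coord_at A q q))"
    by (rule has_derivative_transform_within_open[OF _ open_coord_image[OF open_dom[of p], of q]])
      (use q in_chart_at[of q] in auto)
  from dir_deriv_eqI[OF this] show ?thesis by simp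
qed

text \<open>The frame fields are cut-off coordinate fields, whence they commute at the centre.\<close>

lemma ex_frame:
  obtains U and E :: "'e \<Rightarrow> 'p \<Rightarrow> 'e" and z :: "'e \<Rightarrow> 'p \<Rightarrow> real" where "open U" "p \<in> U" "\<And>b. vector_field A (E b)" "\<And>b. smooth_fun A (z b)"
    "\<And>q (v::'e). q \<in> U \<Longrightarrow> v = (\<Sum>b\<in>Basis. dir_deriv A q v (z b) *\<^sub>R E b q)"
    "\<And>u a b. smooth_fun A u \<Longrightarrow> dir_deriv A p (E a p) (\<lambda>q. dir_deriv A q (E b q) u) =
      dir_deriv A p (E b p) (\<lambda>q. dir_deriv A q (E a q) u)"
proof -
  let ?c = "coord_at A p"
  obtain \<rho> V K where \<rho>: "smooth_fun A \<rho>" "open V" "p \<in> V" "V \<subseteq> K" "closed K" "K \<subseteq> cdom p"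
    "\<And>q. q \<in> V \<Longrightarrow> \<rho> q = 1" "\<And>q. q \<notin> K \<Longrightarrow> \<rho> q = 0"
    using ex_bump[OF open_dom in_chart_at] by metis
  \<comment> \<open>\<open>L q\<close> converts components in the chart at \<open>p\<close> into
    components in the chart chosen at \<open>q\<close>, and \<open>F q\<close> converts back. So
    \<open>L q b\<close> is the coordinate vector \<open>b\<close> of the chart at \<open>p\<close>,
    seen at \<open>q\<close>.\<close>
  define L where "L q = frechet_derivative (coord_at A q \<circ> param_at A p) (at (?c q))" for q
  define F where "F q = frechet_derivative (?c \<circ> param_at A q) (at (coord_at A q q))" for q
  have FL: "F q (L q v) = v" "L q (F q v) = v" if "q \<in> cdom p" for q v
    using transition_inverse[OF that in_chart_at] transition_inverse[OF in_chart_at that]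
    by (simp_all add: F_def L_def)
  have linL: "linear (L q)" if "q \<in> cdom p" for q
    unfolding L_def using transition_differentiable[OF in_chart_at that] by (rule linear_frechet_derivative)
  define E where "E b q = \<rho> q *\<^sub>R L q b" for b q
  define z where "z b q = \<rho> q * (?c q \<bullet> b)" for b q
  have der: "dir_deriv A q (L q b) u = frechet_derivative (u \<circ> param_at A p) (at (?c q)) b"
    if "q \<in> cdom p" "smooth_fun A u" for q b u
    using dir_deriv_in_chart[OF that(2) _ that(1)] FL(1)[OF that(1)] by (simp add: F_def)
  have Lvf: "vector_field_on A (cdom p) (\<lambda>q. L q b)" for b
    unfolding vector_field_on_def
  proof clarify
    fix u assume u: "smooth_fun A u"
    have s: "smooth_on (?c ` cdom p) (u \<circ> param_at A p)"
      using smooth_fun_onD[OF u coord_at_chart[of p]] by (simp add: param_at_eq)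
    show "smooth_fun_on A (cdom p) (\<lambda>q. dir_deriv A q (L q b) u)"
    proof (rule chart_smooth_fun[OF coord_at_chart])
      show "smooth_on (?c ` cdom p) ((\<lambda>q. dir_deriv A q (L q b) u) \<circ> inv_into (cdom p) ?c)"
        using chartD(2)[OF coord_at_chart[of p]]
        by (rule smooth_on_cong[OF _ _ smooth_on_derivative[OF s, of b]])
          (auto simp: param_at_eq[symmetric] der[OF _ u])
    qed auto
  qed
  have E: "vector_field A (E b)" for b
    unfolding E_def[abs_def] by (rule vector_field_extend[OF \<rho>(1,5,6) _ \<rho>(8) Lvf]) auto
  have cs: "smooth_fun_on A (cdom p) (\<lambda>q. ?c q \<bullet> b)" for b
  proof (rule chart_smooth_fun[OF coord_at_chart])
    show "smooth_on (?c ` cdom p) ((\<lambda>q. ?c q \<bullet> b) \<circ> inv_into (cdom p) ?c)"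
      using chartD(2)[OF coord_at_chart[of p]]
      by (rule smooth_on_cong[OF _ _ smooth_on_bounded_linear[OF bounded_linear_inner_left _ smooth_on_ident]])
        (auto simp: param_at_eq[symmetric] chartD(2)[OF coord_at_chart[of p]])
  qed auto
  have z: "smooth_fun A (z b)" for b
    unfolding z_def[abs_def] by (rule smooth_fun_extend[OF \<rho>(1,5,6) _ \<rho>(8) cs]) auto
  have repr: "v = (\<Sum>b\<in>Basis. dir_deriv A q v (z b) *\<^sub>R E b q)" if q: "q \<in> V" for q v
  proof -
    have qp: "q \<in> cdom p" using q \<rho> by auto
    have "dir_deriv A q v (z b) = F q v \<bullet> b" for b
    proof -
      have "dir_deriv A q v (z b) = dir_deriv A q v (\<lambda>q. ?c q \<bullet> b)"
        by (rule dir_deriv_cong[OF \<rho>(2) q]) (simp add: z_def \<rho>(7))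
      also have "\<dots> = frechet_derivative ((\<lambda>q. ?c q \<bullet> b) \<circ> param_at A p) (at (?c q)) (F q v)"
        unfolding F_def by (rule dir_deriv_in_chart[OF cs qp qp]) auto
      also have "\<dots> = F q v \<bullet> b"
      proof -
        have "((\<lambda>q. ?c q \<bullet> b) \<circ> param_at A p has_derivative (\<lambda>w. w \<bullet> b)) (at (?c q))"
          by (rule has_derivative_transform_within_open
              [OF bounded_linear_imp_has_derivative[OF bounded_linear_inner_left] open_coord_image[OF open_UNIV, of p]])
            (use qp in auto)
        then show ?thesis by (metis frechet_derivative_at)
      qed
      finally show ?thesis .
    qed
    then have "(\<Sum>b\<in>Basis. dir_deriv A q v (z b) *\<^sub>R E b q) = L q (\<Sum>b\<in>Basis. (F q v \<bullet> b) *\<^sub>R b)"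
      using linL[OF qp] by (simp add: E_def \<rho>(7)[OF q] linear_sum linear_scale)
    then show ?thesis by (simp add: euclidean_representation FL[OF qp])
  qed
  \<comment> \<open>Near \<open>p\<close> the cut-off disappears and the iterated derivative is an
    ordinary mixed derivative of \<open>u\<close> in the chart, to which the symmetry of second
    derivatives applies.\<close>
  have comm: "dir_deriv A p (E a p) (\<lambda>q. dir_deriv A q (E b q) u) =
      frechet_derivative (\<lambda>x. frechet_derivative (u \<circ> param_at A p) (at x) b) (at (?c p)) a"
    if u: "smooth_fun A u" for a b u
  proof -
    have "dir_deriv A p (E a p) (\<lambda>q. dir_deriv A q (E b q) u) = dir_deriv A p (L p a) (\<lambda>q. dir_deriv A q (L q b) u)"
      unfolding E_def using \<rho>(7)[OF \<rho>(3)]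
      by (simp add: dir_deriv_cong(1)[OF \<rho>(2,3), of "\<lambda>q. dir_deriv A q (\<rho> q *\<^sub>R L q b) u"
            "\<lambda>q. dir_deriv A q (L q b) u"] \<rho>(7))
    also have "\<dots> = frechet_derivative ((\<lambda>q. dir_deriv A q (L q b) u) \<circ> param_at A p) (at (?c p)) (F p (L p a))"
      unfolding F_def by (rule dir_deriv_in_chart[OF vector_field_onD[OF Lvf u]]) (auto simp: in_chart_at)
    also have "\<dots> = frechet_derivative ((\<lambda>q. dir_deriv A q (L q b) u) \<circ> param_at A p) (at (?c p)) a"
      using FL(1)[OF in_chart_at] by simp
    also have "\<dots> = frechet_derivative (\<lambda>x. frechet_derivative (u \<circ> param_at A p) (at x) b) (at (?c p)) a"
    proof -
      have s: "smooth_on (?c ` cdom p) (u \<circ> param_at A p)"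
        using smooth_fun_onD[OF u coord_at_chart[of p]] by (simp add: param_at_eq)
      have "(\<lambda>x. frechet_derivative (u \<circ> param_at A p) (at x) b) differentiable (at (?c p))"
        using smooth_on_differentiable[OF smooth_on_derivative[OF s]] in_chart_at[of p] by auto
      then have "((\<lambda>x. frechet_derivative (u \<circ> param_at A p) (at x) b) has_derivative
        frechet_derivative (\<lambda>x. frechet_derivative (u \<circ> param_at A p) (at x) b) (at (?c p))) (at (?c p))"
        by (simp add: frechet_derivative_works[symmetric])
      then have "(((\<lambda>q. dir_deriv A q (L q b) u) \<circ> param_at A p) has_derivative
        frechet_derivative (\<lambda>x. frechet_derivative (u \<circ> param_at A p) (at x) b) (at (?c p))) (at (?c p))"
        by (rule has_derivative_transform_within_open[OF _ open_coord_image[OF open_UNIV, of p]])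
          (use in_chart_at[of p] der[OF _ u] in auto)
      from frechet_derivative_at[OF this] show ?thesis by metis
    qed
    finally show ?thesis .
  qed
  show ?thesis
  proof (rule that[of V E z, OF \<rho>(2,3)])
    show "vector_field A (E b)" for b by (rule E)
    show "smooth_fun A (z b)" for b by (rule z)
    show "v = (\<Sum>b\<in>Basis. dir_deriv A q v (z b) *\<^sub>R E b q)" if "q \<in> V" for q v by (rule repr[OF that])
    fix u a b assume u: "smooth_fun A u"
    have s: "smooth_on (?c ` cdom p) (u \<circ> param_at A p)"
      using smooth_fun_onD[OF u coord_at_chart[of p]] by (simp add: param_at_eq)
    show "dir_deriv A p (E a p) (\<lambda>q. dir_deriv A q (E b q) u) =
      dir_deriv A p (E b p) (\<lambda>q. dir_deriv A q (E a q) u)"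
      unfolding comm[OF u] using chartD(2)[OF coord_at_chart[of p]] in_chart_at[of p]
      by (intro symmetric_second_derivative[OF s]) auto
  qed
qed

text \<open>The frame coefficients of a vector are its derivatives of the global functions
  \<open>z b\<close>. This gives the uniqueness required by the description of the bracket, and
  later lets vector identities be checked on functions.\<close>

lemma tangent_vector_eqI:
  assumes "\<And>u. smooth_fun A u \<Longrightarrow> dir_deriv A p v u = dir_deriv A p w u"
  shows "v = w"
proof -
  obtain U and E :: "'e \<Rightarrow> 'p \<Rightarrow> 'e" and z where U: "open U" "p \<in> U"
    and E: "\<And>b. vector_field A (E b)" and z: "\<And>b. smooth_fun A (z b)"
    and repr: "\<And>q (v::'e). q \<in> U \<Longrightarrow> v = (\<Sum>b\<in>Basis. dir_deriv A q v (z b) *\<^sub>R E b q)"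
    and comm: "\<And>u a b. smooth_fun A u \<Longrightarrow> dir_deriv A p (E a p) (\<lambda>q. dir_deriv A q (E b q) u) =
      dir_deriv A p (E b p) (\<lambda>q. dir_deriv A q (E a q) u)"
    by (rule ex_frame[of p]) (rule that)
  have "v = (\<Sum>b\<in>Basis. dir_deriv A p v (z b) *\<^sub>R E b p)" by (rule repr[OF U(2)])
  also have "\<dots> = (\<Sum>b\<in>Basis. dir_deriv A p w (z b) *\<^sub>R E b p)" by (simp add: assms z)
  also have "\<dots> = w" by (rule repr[OF U(2), symmetric])
  finally show ?thesis .
qed

text \<open>The definite description in the definition of the bracket denotes: in a commuting frame the
  commutator of two derivations has no second-order part.\<close>

lemma dir_deriv_lie_bracket:
  assumes X: "vector_field A X" and Y: "vector_field A Y" and u: "smooth_fun A u"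
  shows "dir_deriv A p (lie_bracket A X Y p) u =
    dir_deriv A p (X p) (\<lambda>q. dir_deriv A q (Y q) u) - dir_deriv A p (Y p) (\<lambda>q. dir_deriv A q (X q) u)"
proof -
  obtain U and E :: "'e \<Rightarrow> 'p \<Rightarrow> 'e" and z where U: "open U" "p \<in> U"
    and E: "\<And>b. vector_field A (E b)" and z: "\<And>b. smooth_fun A (z b)"
    and repr: "\<And>q (v::'e). q \<in> U \<Longrightarrow> v = (\<Sum>b\<in>Basis. dir_deriv A q v (z b) *\<^sub>R E b q)"
    and comm: "\<And>u a b. smooth_fun A u \<Longrightarrow> dir_deriv A p (E a p) (\<lambda>q. dir_deriv A q (E b q) u) =
      dir_deriv A p (E b p) (\<lambda>q. dir_deriv A q (E a q) u)"
    by (rule ex_frame[of p]) (rule that)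
  define co where "co X b q = dir_deriv A q (X q) (z b)" for X b q
  \<comment> \<open>The Leibniz rule splits X(Y u) into a first-order part with coefficients X(Y^b)
    and a second-order part with coefficients X^a Y^b.\<close>
  have second: "dir_deriv A p (X p) (\<lambda>q. dir_deriv A q (Y q) u) =
     dir_deriv A p (\<Sum>b\<in>Basis. dir_deriv A p (X p) (co Y b) *\<^sub>R E b p) u +
     (\<Sum>a\<in>Basis. \<Sum>b\<in>Basis. co X a p * co Y b p * dir_deriv A p (E a p) (\<lambda>q. dir_deriv A q (E b q) u))"
    if X: "vector_field A X" and Y: "vector_field A Y" and u: "smooth_fun A u" for X Y u
  proof -
    have co: "smooth_fun A (co Y b)" for b
      unfolding co_def[abs_def] using vector_field_onD[OF Y z] .
    have Eu: "smooth_fun A (\<lambda>q. dir_deriv A q (E b q) u)" for b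
      using vector_field_onD[OF E u] .
    have "dir_deriv A q v u = (\<Sum>b\<in>Basis. dir_deriv A q v (z b) * dir_deriv A q (E b q) u)"
      if "q \<in> U" for q v
    proof -
      have "dir_deriv A q v u = dir_deriv A q (\<Sum>b\<in>Basis. dir_deriv A q v (z b) *\<^sub>R E b q) u"
        by (rule arg_cong[where f = "\<lambda>w. dir_deriv A q w u"], rule repr[OF that])
      then show ?thesis
        by (simp add: dir_deriv_vec_sum[OF smooth_fun_diff_at[OF u]] dir_deriv_vec_scale[OF smooth_fun_diff_at[OF u]])
    qed
    then have "dir_deriv A p (X p) (\<lambda>q. dir_deriv A q (Y q) u) =
        dir_deriv A p (X p) (\<lambda>q. \<Sum>b\<in>Basis. co Y b q * dir_deriv A q (E b q) u)"
      by (intro dir_deriv_cong[OF U]) (simp add: co_def)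
    also have "\<dots> = (\<Sum>b\<in>Basis. dir_deriv A p (X p) (co Y b) * dir_deriv A p (E b p) u)
        + (\<Sum>b\<in>Basis. co Y b p * dir_deriv A p (X p) (\<lambda>q. dir_deriv A q (E b q) u))"
      using co Eu by (simp add: dir_deriv_sum diff_at_mult dir_deriv_mult smooth_fun_diff_at sum.distrib)
    also have "(\<Sum>b\<in>Basis. co Y b p * dir_deriv A p (X p) (\<lambda>q. dir_deriv A q (E b q) u)) =
      (\<Sum>b\<in>Basis. \<Sum>a\<in>Basis. co Y b p * (co X a p * dir_deriv A p (E a p) (\<lambda>q. dir_deriv A q (E b q) u)))"
    proof (rule sum.cong[OF refl])
      fix b :: 'e
      have "dir_deriv A p (X p) (\<lambda>q. dir_deriv A q (E b q) u) =
        dir_deriv A p (\<Sum>a\<in>Basis. co X a p *\<^sub>R E a p) (\<lambda>q. dir_deriv A q (E b q) u)"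
        unfolding co_def
        by (rule arg_cong[where f = "\<lambda>w. dir_deriv A p w (\<lambda>q. dir_deriv A q (E b q) u)"], rule repr[OF U(2)])
      then show "co Y b p * dir_deriv A p (X p) (\<lambda>q. dir_deriv A q (E b q) u) =
        (\<Sum>a\<in>Basis. co Y b p * (co X a p * dir_deriv A p (E a p) (\<lambda>q. dir_deriv A q (E b q) u)))"
        using smooth_fun_diff_at[OF Eu]
        by (simp add: dir_deriv_vec_sum dir_deriv_vec_scale sum_distrib_left)
    qed
    also have "\<dots> = (\<Sum>a\<in>Basis. \<Sum>b\<in>Basis. co X a p * co Y b p *
        dir_deriv A p (E a p) (\<lambda>q. dir_deriv A q (E b q) u))"
      by (subst sum.swap) (simp add: mult.assoc mult.left_commute)
    finally show ?thesis
      using smooth_fun_diff_at[OF u]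
      by (simp add: dir_deriv_vec_sum dir_deriv_vec_scale)
  qed
  \<comment> \<open>The coordinate formula for the bracket, with coefficients X(Y^b) -
    Y(X^b).\<close>
  define Z where "Z = (\<Sum>b\<in>Basis. dir_deriv A p (X p) (co Y b) *\<^sub>R E b p)
    - (\<Sum>b\<in>Basis. dir_deriv A p (Y p) (co X b) *\<^sub>R E b p)"
  have Z: "dir_deriv A p Z u = dir_deriv A p (X p) (\<lambda>q. dir_deriv A q (Y q) u) -
      dir_deriv A p (Y p) (\<lambda>q. dir_deriv A q (X q) u)" if u: "smooth_fun A u" for u
  proof -
    have "(\<Sum>a\<in>Basis. \<Sum>b\<in>Basis. co X a p * co Y b p * dir_deriv A p (E a p) (\<lambda>q. dir_deriv A q (E b q) u)) =
      (\<Sum>b\<in>Basis. \<Sum>a\<in>Basis. co X a p * co Y b p * dir_deriv A p (E b p) (\<lambda>q. dir_deriv A q (E a q) u))"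
      by (subst sum.swap) (simp add: comm[OF u])
    then show ?thesis
      unfolding Z_def second[OF X Y u] second[OF Y X u] dir_deriv_vec_diff[OF smooth_fun_diff_at[OF u]]
      by (simp add: mult.commute)
  qed
  have "\<forall>u. smooth_fun A u \<longrightarrow> dir_deriv A p (lie_bracket A X Y p) u =
     dir_deriv A p (X p) (\<lambda>q. dir_deriv A q (Y q) u) - dir_deriv A p (Y p) (\<lambda>q. dir_deriv A q (X q) u)"
    unfolding lie_bracket_def
  proof (rule theI[of _ Z])
    show "\<forall>u. smooth_fun A u \<longrightarrow> dir_deriv A p Z u =
     dir_deriv A p (X p) (\<lambda>q. dir_deriv A q (Y q) u) - dir_deriv A p (Y p) (\<lambda>q. dir_deriv A q (X q) u)"
      using Z by blast
    fix Z' assume "\<forall>u. smooth_fun A u \<longrightarrow> dir_deriv A p Z' u =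
     dir_deriv A p (X p) (\<lambda>q. dir_deriv A q (Y q) u) - dir_deriv A p (Y p) (\<lambda>q. dir_deriv A q (X q) u)"
    then show "Z' = Z" using Z by (intro tangent_vector_eqI[of p]) simp
  qed
  then show ?thesis using u by simp
qed

text \<open>A combination of the local spanning fields with constant coefficients, cut off by a
  bump. Scaling and the value 0 outside \<open>K\<close> keep it in the distribution, since its
  fibres are subspaces.\<close>

lemma ex_section:
  assumes D: "regular_distribution A \<D>" and v: "v \<in> \<D> p"
  obtains Z where "Z \<in> sections A \<D>" "Z p = v"
proof -
  obtain r where sub: "\<And>p. subspace (\<D> p)" and loc: "\<And>p. \<exists>U. open U \<and> p \<in> U \<and> (\<exists>E :: nat \<Rightarrow> 'p \<Rightarrow> 'e.
        (\<forall>i<r. vector_field_on A U (E i)) \<and> (\<forall>q\<in>U. span ((\<lambda>i. E i q) ` {..<r}) = \<D> q))"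
    using D unfolding regular_distribution_def by blast
  from loc[of p] obtain U and E :: "nat \<Rightarrow> 'p \<Rightarrow> 'e" where U: "open U" "p \<in> U" and
    E: "\<And>i. i < r \<Longrightarrow> vector_field_on A U (E i)" "\<And>q. q \<in> U \<Longrightarrow> span ((\<lambda>i. E i q) ` {..<r}) = \<D> q"
    by blast
  have "v \<in> span ((\<lambda>i. E i p) ` {..<r})" using v E(2) U by simp
  then obtain c where c: "v = (\<Sum>w\<in>(\<lambda>i. E i p) ` {..<r}. c w *\<^sub>R w)"
    by (auto simp: span_finite)
  define S where "S = (\<lambda>i. E i p) ` {..<r}"
  \<comment> \<open>Several spanning fields may take the same value at \<open>p\<close>, while the
    combination runs over the set of values; one index is selected for each value.\<close>
  define \<iota> where "\<iota> w = (SOME i. i < r \<and> E i p = w)" for w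
  have \<iota>: "\<iota> w < r \<and> E (\<iota> w) p = w" if "w \<in> S" for w
  proof -
    from that obtain i where "i < r \<and> E i p = w" by (auto simp: S_def)
    then show ?thesis unfolding \<iota>_def by (rule someI)
  qed
  obtain \<rho> V K where \<rho>: "smooth_fun A \<rho>" "p \<in> V" "closed K" "K \<subseteq> U"
    "\<And>q. q \<in> V \<Longrightarrow> \<rho> q = 1" "\<And>q. q \<notin> K \<Longrightarrow> \<rho> q = 0"
    using ex_bump[OF U] by metis
  define Z where "Z q = \<rho> q *\<^sub>R (\<Sum>w\<in>S. c w *\<^sub>R E (\<iota> w) q)" for q
  have "vector_field_on A U (\<lambda>q. \<Sum>w\<in>S. c w *\<^sub>R E (\<iota> w) q)"
    using E(1) U \<iota> by (intro vector_field_on_sum vector_field_on_scale) auto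
  from vector_field_extend[OF \<rho>(1,3,4) U(1) \<rho>(6) this]
  have "vector_field A Z" by (simp add: Z_def[abs_def])
  moreover have "Z q \<in> \<D> q" for q
  proof (cases "q \<in> K")
    case True
    then have "(\<Sum>w\<in>S. c w *\<^sub>R E (\<iota> w) q) \<in> span ((\<lambda>i. E i q) ` {..<r})"
      using \<iota> by (intro span_sum span_scale span_base) auto
    then show ?thesis using E(2) True \<rho> sub by (auto simp: Z_def intro!: subspace_scale)
  next
    case False
    then show ?thesis using \<rho> sub by (auto simp: Z_def intro: subspace_0)
  qed
  moreover have "Z p = v" using \<iota> by (simp add: Z_def \<rho> c S_def[symmetric])
  ultimately show ?thesis by (intro that[of Z]) (auto simp: sections_def)
qed

lemma ex_vector_field: obtains Z where "vector_field A Z" "Z p = v"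
proof -
  obtain U and E :: "'e \<Rightarrow> 'p \<Rightarrow> 'e" and z where U: "open U" "p \<in> U"
    and E: "\<And>b. vector_field A (E b)" and z: "\<And>b. smooth_fun A (z b)"
    and repr: "\<And>q (v::'e). q \<in> U \<Longrightarrow> v = (\<Sum>b\<in>Basis. dir_deriv A q v (z b) *\<^sub>R E b q)"
    and comm: "\<And>u a b. smooth_fun A u \<Longrightarrow> dir_deriv A p (E a p) (\<lambda>q. dir_deriv A q (E b q) u) =
      dir_deriv A p (E b p) (\<lambda>q. dir_deriv A q (E a q) u)"
    by (rule ex_frame[of p]) (rule that)
  have "vector_field A (\<lambda>q. \<Sum>b\<in>Basis. dir_deriv A p v (z b) *\<^sub>R E b q)"
    using E by (intro vector_field_on_sum vector_field_on_scale) auto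
  then show ?thesis by (rule that) (rule repr[OF U(2), symmetric])
qed

end

section \<open>Vector fields along a smooth map\<close>

locale smooth_mapping = M: manifold A + N: manifold B
  for A :: "('p::{t2_space,second_countable_topology}, 'm::euclidean_space) chart set"
    and B :: "('q::{t2_space,second_countable_topology}, 'n::euclidean_space) chart set" +
  fixes f :: "'p \<Rightarrow> 'q"
  assumes smooth: "smooth_map A B f"
begin

lemma open_vimage_map: "open V \<Longrightarrow> open (f -` V)"
  using smooth continuous_on_open_vimage[OF open_UNIV, of f] by (auto simp: smooth_map_def)

lemma map_in_charts:
  "(U, c) \<in> A \<Longrightarrow> (V, d) \<in> B \<Longrightarrow> smooth_on (c ` (U \<inter> f -` V)) (d \<circ> f \<circ> inv_into U c)"
  using smooth unfolding smooth_map_def by fast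

lemma smooth_fun_pullback:
  assumes u: "smooth_fun B u"
  shows "smooth_fun A (\<lambda>q. u (f q))"
proof (rule M.smooth_fun_on_local)
  fix p
  define U c V d where "U = M.cdom p" and "c = coord_at A p" and "V = N.cdom (f p)" and "d = coord_at B (f p)"
  have Uc: "(U, c) \<in> A" and Vd: "(V, d) \<in> B"
    using M.coord_at_chart N.coord_at_chart by (simp_all add: U_def c_def V_def d_def)
  define W where "W = U \<inter> f -` V"
  have W: "open W" "p \<in> W" "W \<subseteq> U"
    using M.in_chart_at N.in_chart_at M.chartD(1)[OF Uc] open_vimage_map[OF N.chartD(1)[OF Vd]]
    by (auto simp: W_def U_def V_def)
  have o: "open (c ` W)" using M.chart_image_open[OF Uc W(1)] W(3) by (simp add: Int_absorb1)
  have inv: "inv_into U c (c q) = q" if "q \<in> U" for q using M.chartD(4)[OF Uc] that by simp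
  have inv': "inv_into V d (d q) = q" if "q \<in> V" for q using N.chartD(4)[OF Vd] that by simp
  have "smooth_on (d ` V) (u \<circ> inv_into V d)" using N.smooth_fun_onD[OF u Vd] by simp
  then have "smooth_on (c ` W) (\<lambda>x. (u \<circ> inv_into V d) ((d \<circ> f \<circ> inv_into U c) x))"
  proof (rule smooth_on_compose[OF o, of "d \<circ> f \<circ> inv_into U c" "d ` V", rotated 2])
    show "(d \<circ> f \<circ> inv_into U c) ` c ` W \<subseteq> d ` V" by (auto simp: W_def inv)
    show "smooth_on (c ` W) (d \<circ> f \<circ> inv_into U c)" using map_in_charts[OF Uc Vd] by (simp add: W_def)
  qed
  then have "smooth_on (c ` W) ((\<lambda>q. u (f q)) \<circ> inv_into U c)"
    by (rule smooth_on_cong[OF o, rotated]) (auto simp: W_def inv inv')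
  from M.chart_smooth_fun[OF Uc W(1,3) this]
  show "\<exists>W. open W \<and> p \<in> W \<and> smooth_fun_on A W (\<lambda>q. u (f q))" using W by blast
qed

lemma coordinate_map_deriv:
  "((coord_at B (f p) \<circ> f \<circ> param_at A p) has_derivative tangent_map A B f p) (at (coord_at A p p))"
proof -
  have "smooth_on (coord_at A p ` (M.cdom p \<inter> f -` N.cdom (f p))) (coord_at B (f p) \<circ> f \<circ> param_at A p)"
    unfolding M.param_at_eq by (rule map_in_charts[OF M.coord_at_chart N.coord_at_chart])
  then have "(coord_at B (f p) \<circ> f \<circ> param_at A p) differentiable (at (coord_at A p p))"
    by (rule smooth_on_differentiable) (use M.in_chart_at[of p] N.in_chart_at[of "f p"] in auto)
  then show ?thesis unfolding tangent_map_def by (simp add: frechet_derivative_works[symmetric])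
qed

lemma linear_tangent_map: "linear (tangent_map A B f p)"
  using coordinate_map_deriv[of p] by (rule has_derivative_linear)

text \<open>The chain rule: the pushed-forward vector differentiates \<open>u\<close> as the
  original vector differentiates the pullback.\<close>

lemma dir_deriv_tangent_map:
  assumes u: "smooth_fun B u"
  shows "dir_deriv B (f p) (tangent_map A B f p v) u = dir_deriv A p v (\<lambda>q. u (f q))"
proof -
  let ?c = "coord_at A p" and ?d = "coord_at B (f p)"
  have D: "((u \<circ> param_at B (f p)) has_derivative (\<lambda>w. dir_deriv B (f p) w u))
      (at ((?d \<circ> f \<circ> param_at A p) (?c p)))"
    using N.diff_at_deriv[OF N.smooth_fun_diff_at[OF u]] M.in_chart_at[of p] by simp
  have o: "open (?c ` (M.cdom p \<inter> f -` N.cdom (f p)))"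
    by (intro M.open_coord_image open_vimage_map N.open_dom)
  from diff_chain_at[OF coordinate_map_deriv D]
  have "(((\<lambda>q. u (f q)) \<circ> param_at A p) has_derivative
      (\<lambda>w. dir_deriv B (f p) w u) \<circ> tangent_map A B f p) (at (?c p))"
    by (rule has_derivative_transform_within_open[OF _ o])
      (use M.in_chart_at[of p] N.in_chart_at[of "f p"] in auto)
  from M.dir_deriv_eqI[OF this] show ?thesis by simp
qed

lemma vector_field_alongD:
  "vector_field_along A B f V \<Longrightarrow> smooth_fun B u \<Longrightarrow> smooth_fun A (\<lambda>p. dir_deriv B (f p) (V p) u)"
  unfolding vector_field_along_def by blast

lemma along_scale:
  "smooth_fun A w \<Longrightarrow> vector_field_along A B f V \<Longrightarrow> vector_field_along A B f (\<lambda>p. w p *\<^sub>R V p)"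
  unfolding vector_field_along_def
  by (simp add: N.dir_deriv_vec_scale[OF N.smooth_fun_diff_at] M.smooth_fun_on_mult)

lemma along_sum:
  "(\<And>i. i \<in> I \<Longrightarrow> vector_field_along A B f (V i)) \<Longrightarrow> vector_field_along A B f (\<lambda>p. \<Sum>i\<in>I. V i p)"
  unfolding vector_field_along_def
  by (simp add: N.dir_deriv_vec_sum[OF N.smooth_fun_diff_at] M.smooth_fun_on_sum)

lemma along_restrict: "vector_field B E \<Longrightarrow> vector_field_along A B f (E \<circ> f)"
  unfolding vector_field_along_def comp_def
  using smooth_fun_pullback N.vector_field_onD by blast

lemma along_push: "vector_field A X \<Longrightarrow> vector_field_along A B f (push_field A B f X)"
  unfolding vector_field_along_def push_field_def
  by (simp add: dir_deriv_tangent_map M.vector_field_onD smooth_fun_pullback)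

text \<open>The fields \<open>E b\<close> form a frame only near \<open>f p\<close>. The factor
  \<open>\<rho>\<close> makes the expansion valid at every \<open>q\<close>, both sides being 0 far
  away, so that axioms about global fields along \<open>f\<close> can be applied to it.\<close>

lemma ex_frame_along:
  obtains Q \<rho> and E :: "'n \<Rightarrow> 'q \<Rightarrow> 'n" and z :: "'n \<Rightarrow> 'q \<Rightarrow> real"
  where "open Q" "p \<in> Q" "smooth_fun A \<rho>" "\<And>q. q \<in> Q \<Longrightarrow> \<rho> q = 1"
    "\<And>b. vector_field B (E b)" "\<And>b. smooth_fun B (z b)"
    "\<And>q (w::'n). \<rho> q *\<^sub>R w = (\<Sum>b\<in>Basis. (\<rho> q * dir_deriv B (f q) w (z b)) *\<^sub>R E b (f q))"
proof -
  obtain U and E :: "'n \<Rightarrow> 'q \<Rightarrow> 'n" and z where U: "open U" "f p \<in> U"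
    and E: "\<And>b. vector_field B (E b)" and z: "\<And>b. smooth_fun B (z b)"
    and repr: "\<And>q (v::'n). q \<in> U \<Longrightarrow> v = (\<Sum>b\<in>Basis. dir_deriv B q v (z b) *\<^sub>R E b q)"
    and comm: "\<And>u a b. smooth_fun B u \<Longrightarrow> dir_deriv B (f p) (E a (f p)) (\<lambda>q. dir_deriv B q (E b q) u) =
      dir_deriv B (f p) (E b (f p)) (\<lambda>q. dir_deriv B q (E a q) u)"
    by (rule N.ex_frame[of "f p"]) (rule that)
  have U': "open (f -` U)" "p \<in> f -` U" using U open_vimage_map by auto
  obtain \<rho> V K where \<rho>: "smooth_fun A \<rho>" "open V" "p \<in> V" "V \<subseteq> K" "closed K" "K \<subseteq> f -` U"
    "\<And>q. q \<in> V \<Longrightarrow> \<rho> q = 1" "\<And>q. q \<notin> K \<Longrightarrow> \<rho> q = 0"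
    by (rule M.ex_bump[OF U']) (rule that)
  show ?thesis
  proof (rule that[of V \<rho> E z])
    show "\<rho> q *\<^sub>R w = (\<Sum>b\<in>Basis. (\<rho> q * dir_deriv B (f q) w (z b)) *\<^sub>R E b (f q))" for q w
    proof (cases "q \<in> K")
      case True
      then have "f q \<in> U" using \<rho>(6) by auto
      then have "\<rho> q *\<^sub>R w = \<rho> q *\<^sub>R (\<Sum>b\<in>Basis. dir_deriv B (f q) w (z b) *\<^sub>R E b (f q))"
        by (intro arg_cong[where f = "\<lambda>w. \<rho> q *\<^sub>R w"] repr)
      then show ?thesis by (simp add: scaleR_sum_right)
    next
      case False
      then show ?thesis by (simp add: \<rho>(8))
    qed
  qed (fact \<rho> E z)+
qed

end

section \<open>Representation of functionals and smooth solution of positive definite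
  systems\<close>

text \<open>Sending t to its products with the basis vectors is injective by definiteness, hence
  surjective in finite dimension. It supplies the existence of the tangential part.\<close>

lemma posdef_representation:
  fixes G :: "'a::euclidean_space \<Rightarrow> 'a \<Rightarrow> real"
  assumes G: "bilinear G" and pos: "\<And>v. v \<noteq> 0 \<Longrightarrow> 0 < G v v" and l: "linear l"
  shows "\<exists>t. \<forall>v. G t v = l v"
proof -
  define h where "h t = (\<Sum>b\<in>Basis. G t b *\<^sub>R b)" for t
  have G1: "linear (\<lambda>t. G t v)" and G2: "linear (G t)" for v t
    using G by (simp_all add: bilinear_def)
  have h: "linear h"
    by (rule linearI)
      (simp_all add: h_def linear_add[OF G1] linear_scale[OF G1] scaleR_sum_right algebra_simps sum.distrib)
  have ext: "a = b" if "linear a" "linear b" "\<And>i. i \<in> Basis \<Longrightarrow> a i = b i" for a b :: "'a \<Rightarrow> real"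
    using linear_eq_stdbasis[OF that] .
  have hb: "h t \<bullet> b = G t b" if "b \<in> Basis" for t b
    using that by (simp add: h_def inner_sum_left inner_Basis if_distrib cong: if_cong)
  have "inj h"
  proof (subst linear_injective_0[OF h], clarify)
    fix t assume "h t = 0"
    then have "G t b = (\<lambda>x. 0) b" if "b \<in> Basis" for b using hb[OF that, of t] by simp
    then have "G t = (\<lambda>x. 0)" by (intro ext G2) (auto intro: linear_zero)
    then have "G t t = 0" by simp
    then show "t = 0" using pos[of t] by fastforce
  qed
  then have "surj h" using linear_injective_imp_surjective[OF h] by blast
  then obtain t where t: "h t = (\<Sum>b\<in>Basis. l b *\<^sub>R b)" by (metis surjD)
  have "G t b = l b" if "b \<in> Basis" for b
    using hb[OF that, of t] t that by (simp add: inner_sum_left inner_Basis if_distrib cong: if_cong)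
  then have "G t = l" by (intro ext G2 l)
  then show ?thesis by auto
qed

text \<open>Gaussian elimination by induction on the index set. The pivot \<open>G i i\<close> is
  positive, so dividing by it is smooth, and the eliminated system is again symmetric and positive
  definite. It will be applied to Gram matrices of frames, whose solutions are the coefficients of a
  tangential part.\<close>

lemma (in manifold) posdef_system_smooth:
  assumes "finite I" and S: "open S"
    and "\<And>a b. a \<in> I \<Longrightarrow> b \<in> I \<Longrightarrow> smooth_fun_on A S (G a b)"
    and "\<And>a. a \<in> I \<Longrightarrow> smooth_fun_on A S (s a)"
    and "\<And>a b q. q \<in> S \<Longrightarrow> a \<in> I \<Longrightarrow> b \<in> I \<Longrightarrow> G a b q = G b a q"
    and "\<And>q x i. q \<in> S \<Longrightarrow> i \<in> I \<Longrightarrow> x i \<noteq> 0 \<Longrightarrow> 0 < (\<Sum>a\<in>I. \<Sum>b\<in>I. x a * x b * G a b q)"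
    and "\<And>q a. q \<in> S \<Longrightarrow> a \<in> I \<Longrightarrow> (\<Sum>b\<in>I. G a b q * t b q) = s a q"
    and "b \<in> I"
  shows "smooth_fun_on A S (t b)"
  using assms(1,3-8)
proof (induction I arbitrary: G s b rule: finite_induct)
  case (insert i I)
  note sm = insert.prems(1) and sms = insert.prems(2) and sym = insert.prems(3) and pos = insert.prems(4)
    and sys = insert.prems(5)
  have split: "(\<Sum>a\<in>insert i I. F a) = F i + (\<Sum>a\<in>I. F a)" for F :: "_ \<Rightarrow> real"
    using insert.hyps by simp
  have Gii: "G i i q > 0" if "q \<in> S" for q
  proof -
    let ?x = "\<lambda>a. if a = i then 1 else 0 :: real"
    have "0 < (\<Sum>a\<in>insert i I. \<Sum>b\<in>insert i I. ?x a * ?x b * G a b q)"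
      using that by (intro pos[of q i]) auto
    also have "(\<Sum>a\<in>I. ?x a * y a) = 0" for y
      using insert.hyps by (intro sum.neutral) auto
    then have "(\<Sum>a\<in>insert i I. \<Sum>b\<in>insert i I. ?x a * ?x b * G a b q) = G i i q"
      unfolding split using insert.hyps by (simp add: mult.assoc sum_distrib_left[symmetric])
    finally show ?thesis .
  qed
  define r where "r q = inverse (G i i q)" for q
  have r: "smooth_fun_on A S r" unfolding r_def[abs_def]
    using Gii by (intro smooth_fun_on_inverse S sm) force+
  have rG: "r q * G i i q = 1" if "q \<in> S" for q using Gii[OF that] by (simp add: r_def)
  \<comment> \<open>The Schur complement of the pivot: what remains of row \<open>a\<close> when row
    \<open>i\<close> is used to eliminate the unknown \<open>i\<close>.\<close>
  define G' where "G' a b q = G a b q - r q * (G a i q * G i b q)" for a b q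
  define s' where "s' a q = s a q - r q * (G a i q * s i q)" for a q
  have tI: "smooth_fun_on A S (t b)" if "b \<in> I" for b
  proof (rule insert.IH[of G' s' b])
    show "smooth_fun_on A S (G' a b)" if "a \<in> I" "b \<in> I" for a b
      unfolding G'_def[abs_def] using that r sm by (intro smooth_fun_on_diff smooth_fun_on_mult S) auto
    show "smooth_fun_on A S (s' a)" if "a \<in> I" for a
      unfolding s'_def[abs_def] using that r sm sms by (intro smooth_fun_on_diff smooth_fun_on_mult S) auto
    show "G' a b q = G' b a q" if "q \<in> S" "a \<in> I" "b \<in> I" for a b q
      unfolding G'_def using sym[OF that(1), of a b] sym[OF that(1), of a i] sym[OF that(1), of i b] that
      by (simp add: mult.commute)
    show "(\<Sum>b\<in>I. G' a b q * t b q) = s' a q" if "q \<in> S" "a \<in> I" for q a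
    proof -
      have ea: "G a i q * t i q + (\<Sum>b\<in>I. G a b q * t b q) = s a q"
        and ei: "G i i q * t i q + (\<Sum>b\<in>I. G i b q * t b q) = s i q"
        using sys[OF that(1), of a] sys[OF that(1), of i] that(2) unfolding split by auto
      have "(\<Sum>b\<in>I. G' a b q * t b q) =
        (\<Sum>b\<in>I. G a b q * t b q) - r q * G a i q * (\<Sum>b\<in>I. G i b q * t b q)"
        unfolding G'_def by (simp add: algebra_simps sum_subtractf sum_distrib_left)
      also have "\<dots> = (s a q - G a i q * t i q) - r q * G a i q * (s i q - G i i q * t i q)"
        using ea ei by (simp only: eq_diff_eq[symmetric] add.commute[of "G _ i q * t i q"])
      also have "\<dots> = s' a q - G a i q * t i q * (1 - r q * G i i q)"
        unfolding s'_def by (simp add: algebra_simps)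
      finally show ?thesis using rG[OF that(1)] by simp
    qed
    show "0 < (\<Sum>a\<in>I. \<Sum>b\<in>I. x a * x b * G' a b q)" if q: "q \<in> S" and j: "j \<in> I" "x j \<noteq> 0" for q x j
    proof -
      define c where "c = (\<Sum>b\<in>I. G i b q * x b)"
      \<comment> \<open>The value at \<open>i\<close> minimises the quadratic form in that
        coordinate with the others fixed; at the minimum the form of \<open>G\<close> equals the
        form of \<open>G'\<close>, which is therefore positive.\<close>
      define y where "y a = (if a = i then - r q * c else x a)" for a
      have yI: "y a = x a" if "a \<in> I" for a using that insert.hyps by (auto simp: y_def)
      have c': "(\<Sum>a\<in>I. x a * G a i q) = c"
        unfolding c_def using sym[OF q] by (intro sum.cong) (auto simp: mult.commute)
      have "0 < (\<Sum>a\<in>insert i I. \<Sum>b\<in>insert i I. y a * y b * G a b q)"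
        using j yI by (intro pos[OF q, of j]) auto
      also have "\<dots> = (y i * y i * G i i q + (\<Sum>b\<in>I. y i * x b * G i b q)) +
        (\<Sum>a\<in>I. x a * y i * G a i q + (\<Sum>b\<in>I. x a * x b * G a b q))"
        unfolding split by (simp add: yI)
      also have "(\<Sum>b\<in>I. y i * x b * G i b q) = y i * c"
        unfolding c_def sum_distrib_left by (intro sum.cong) auto
      also have "(\<Sum>a\<in>I. x a * y i * G a i q + (\<Sum>b\<in>I. x a * x b * G a b q)) =
        y i * c + (\<Sum>a\<in>I. \<Sum>b\<in>I. x a * x b * G a b q)"
        unfolding sum.distrib c'[symmetric] sum_distrib_left by (simp add: algebra_simps)
      also have "y i * y i * G i i q + y i * c + (y i * c + (\<Sum>a\<in>I. \<Sum>b\<in>I. x a * x b * G a b q)) =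
        (\<Sum>a\<in>I. \<Sum>b\<in>I. x a * x b * G a b q) - r q * c * c * (2 - r q * G i i q)"
        by (simp add: y_def algebra_simps)
      also have "\<dots> = (\<Sum>a\<in>I. \<Sum>b\<in>I. x a * x b * G a b q) - r q * (c * c)"
        using rG[OF q] by simp
      also have "c * c = (\<Sum>a\<in>I. \<Sum>b\<in>I. (x a * G a i q) * (G i b q * x b))"
        unfolding c'[symmetric] by (simp add: c_def[symmetric] c' sum_product[symmetric])
      also have "(\<Sum>a\<in>I. \<Sum>b\<in>I. x a * x b * G a b q) - r q * \<dots> = (\<Sum>a\<in>I. \<Sum>b\<in>I. x a * x b * G' a b q)"
        unfolding G'_def sum_distrib_left sum_subtractf[symmetric] by (intro sum.cong) (auto simp: algebra_simps)
      finally show ?thesis .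
    qed
  qed (use that in auto)
  show ?case
  proof (cases "b = i")
    case True
    have "smooth_fun_on A S (\<lambda>q. r q * (s i q - (\<Sum>b\<in>I. G i b q * t b q)))"
      using r sm sms tI by (intro smooth_fun_on_mult smooth_fun_on_diff smooth_fun_on_sum S) auto
    then have "smooth_fun_on A S (t i)"
    proof (rule smooth_fun_on_cong[OF S, rotated])
      fix q assume q: "q \<in> S"
      have "G i i q * t i q + (\<Sum>b\<in>I. G i b q * t b q) = s i q" using sys[OF q, of i] unfolding split by simp
      then have "s i q - (\<Sum>b\<in>I. G i b q * t b q) = G i i q * t i q" by linarith
      then have "r q * (s i q - (\<Sum>b\<in>I. G i b q * t b q)) = r q * G i i q * t i q" by (simp only: mult.assoc)
      then show "r q * (s i q - (\<Sum>b\<in>I. G i b q * t b q)) = t i q" using rG[OF q] by simp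
    qed
    then show ?thesis using True by simp
  next
    case False
    then show ?thesis using tI insert.prems by auto
  qed
qed simp

section \<open>Submanifolds of Kaehler manifolds\<close>

locale kaehler_submanifold =
  fixes A :: "('p::{t2_space,second_countable_topology}, 'm::euclidean_space) chart set"
    and B :: "('q::{t2_space,second_countable_topology}, 'n::euclidean_space) chart set"
    and f :: "'p \<Rightarrow> 'q"
    and \<phi> :: "'q \<Rightarrow> 'n \<Rightarrow> 'n"
    and g :: "'q \<Rightarrow> 'n \<Rightarrow> 'n \<Rightarrow> real"
    and nabbar :: "('q \<Rightarrow> 'n) \<Rightarrow> ('q \<Rightarrow> 'n) \<Rightarrow> 'q \<Rightarrow> 'n"
    and D :: "('p \<Rightarrow> 'm) \<Rightarrow> ('p \<Rightarrow> 'n) \<Rightarrow> 'p \<Rightarrow> 'n"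
    and nab :: "('p \<Rightarrow> 'm) \<Rightarrow> ('p \<Rightarrow> 'm) \<Rightarrow> 'p \<Rightarrow> 'm"
  assumes kaehler: "kaehler B \<phi> g nabbar"
    and atlas: "smooth_atlas A"
    and immersion: "injective_immersion A B f"
    and lc: "levi_civita A (induced_metric A B f g) nab"
    and conn: "induced_connection A B f nabbar D"

sublocale kaehler_submanifold \<subseteq> smooth_mapping A B f
  using kaehler atlas immersion
  by unfold_locales (auto simp: kaehler_def injective_immersion_def)

context kaehler_submanifold
begin

section \<open>Induced metric and tangential projection\<close>

abbreviation "push \<equiv> tangent_map A B f"
abbreviation "along \<equiv> vector_field_along A B f"
abbreviation "tanp \<equiv> tan_part A B f g"
abbreviation "G \<equiv> induced_metric A B f g"

lemma hermitian: "almost_hermitian B \<phi> g" and ambient_lc: "levi_civita B g nabbar"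
  using kaehler by (simp_all add: kaehler_def)

lemma nabbar_phi:
  "vector_field B X \<Longrightarrow> vector_field B Y \<Longrightarrow> nabbar X (\<lambda>r. \<phi> r (Y r)) q = \<phi> q (nabbar X Y q)"
  using kaehler unfolding kaehler_def by (simp add: fun_eq_iff)

lemma bilinear_g: "bilinear (g q)" and g_sym: "g q v w = g q w v" and g_pos: "v \<noteq> 0 \<Longrightarrow> 0 < g q v v"
  and g_smooth: "vector_field B X \<Longrightarrow> vector_field B Y \<Longrightarrow> smooth_fun B (\<lambda>q. g q (X q) (Y q))"
  using hermitian unfolding almost_hermitian_def riemannian_metric_def by blast+

lemma linear_phi: "linear (\<phi> q)" and phi_vf: "vector_field B X \<Longrightarrow> vector_field B (\<lambda>q. \<phi> q (X q))"
  and phi_phi: "\<phi> q (\<phi> q v) = - v" and g_phi: "g q (\<phi> q v) (\<phi> q w) = g q v w"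
  using hermitian unfolding almost_hermitian_def by blast+

lemma g_nonneg: "0 \<le> g q v v"
  using g_pos[of v q] bilinear_lzero[OF bilinear_g, of q] by (cases "v = 0") auto

lemma g_eq_0: "g q v v = 0 \<Longrightarrow> v = 0"
  using g_pos[of v q] by fastforce

lemma inj_push: "inj (push p)"
  using immersion by (simp add: injective_immersion_def)

lemma push_eq_0: "push p v = 0 \<Longrightarrow> v = 0"
  using inj_push linear_0[OF linear_tangent_map] by (metis injD)

lemma G_eq: "G p v w = g (f p) (push p v) (push p w)"
  by (simp add: induced_metric_def)

lemma bilinear_G: "bilinear (G p)"
  using bilinear_g[of "f p"] linear_tangent_map[of p]
  unfolding bilinear_def induced_metric_def
  by (auto simp: linear_iff)

lemma G_sym: "G p v w = G p w v"
  by (simp add: G_eq g_sym)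

lemma G_pos: "v \<noteq> 0 \<Longrightarrow> 0 < G p v v"
  unfolding G_eq using push_eq_0 g_pos by blast

lemma tan_part_unique:
  assumes "\<And>v. g (f p) (w - push p s) (push p v) = 0" "\<And>v. g (f p) (w - push p t) (push p v) = 0"
  shows "s = t"
proof -
  have "G p (s - t) v = 0" for v
    using assms[of v]
    by (simp add: G_eq linear_diff[OF linear_tangent_map] bilinear_lsub[OF bilinear_g])
  then have "s - t = 0" using G_pos[of "s - t" p] by fastforce
  then show ?thesis by simp
qed

text \<open>Representing v -> g(w, push v) by the induced metric produces a tangential part, and
  with uniqueness the description denotes.\<close>

lemma tan_part_normal: "g (f p) (w - push p (tanp p w)) (push p v) = 0"
proof -
  have l: "linear (\<lambda>v. g (f p) w (push p v))"
    using bilinear_g[of "f p"] linear_tangent_map[of p] unfolding bilinear_def by (auto simp: linear_iff)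
  obtain t where "\<forall>v. G p t v = g (f p) w (push p v)"
    using posdef_representation[OF bilinear_G G_pos l] by blast
  then have "\<forall>v. g (f p) (w - push p t) (push p v) = 0"
    by (simp add: G_eq bilinear_lsub[OF bilinear_g])
  then have "\<forall>v. g (f p) (w - push p (tanp p w)) (push p v) = 0"
    unfolding tan_part_def by (rule theI) (use tan_part_unique \<open>\<forall>v. g (f p) (w - push p t) (push p v) = 0\<close> in blast)
  then show ?thesis by blast
qed

lemma tan_part_eqI: "(\<And>v. g (f p) (w - push p t) (push p v) = 0) \<Longrightarrow> tanp p w = t"
  using tan_part_unique tan_part_normal by blast

lemma g_tan_part: "g (f p) (push p (tanp p w)) (push p v) = g (f p) w (push p v)"
  using tan_part_normal[of p w v] by (simp add: bilinear_lsub[OF bilinear_g])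

lemma tan_part_push [simp]: "tanp p (push p v) = v"
  by (rule tan_part_eqI) (simp add: bilinear_lzero[OF bilinear_g])

lemma linear_tan_part: "linear (tanp p)"
proof (rule linearI)
  show "tanp p (v + w) = tanp p v + tanp p w" for v w
    by (rule tan_part_eqI)
      (simp add: linear_add[OF linear_tangent_map] bilinear_lsub[OF bilinear_g] bilinear_ladd[OF bilinear_g] g_tan_part)
  show "tanp p (c *\<^sub>R v) = c *\<^sub>R tanp p v" for c v
    by (rule tan_part_eqI)
      (simp add: linear_scale[OF linear_tangent_map] bilinear_lsub[OF bilinear_g] bilinear_lmul[OF bilinear_g] g_tan_part)
qed

section \<open>The induced connection along the immersion\<close>

lemma
  assumes "vector_field A X" "along V"
  shows D_add: "along W \<Longrightarrow> D X (\<lambda>p. V p + W p) p = D X V p + D X W p"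
    and D_scale: "smooth_fun A u \<Longrightarrow> D X (\<lambda>p. u p *\<^sub>R V p) p = u p *\<^sub>R D X V p + dir_deriv A p (X p) u *\<^sub>R V p"
proof -
  have c: "\<And>W u. along W \<Longrightarrow> smooth_fun A u \<Longrightarrow>
        D X (\<lambda>p. V p + W p) = (\<lambda>p. D X V p + D X W p) \<and>
        D X (\<lambda>p. u p *\<^sub>R V p) = (\<lambda>p. u p *\<^sub>R D X V p + dir_deriv A p (X p) u *\<^sub>R V p)"
    using conn assms unfolding induced_connection_def by blast
  show "D X (\<lambda>p. V p + W p) p = D X V p + D X W p" if "along W"
    using c[OF that, of "\<lambda>p. 0"] by simp
  show "D X (\<lambda>p. u p *\<^sub>R V p) p = u p *\<^sub>R D X V p + dir_deriv A p (X p) u *\<^sub>R V p" if "smooth_fun A u"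
    using c[OF assms(2) that] by simp
qed

lemma D_restrict:
  "vector_field A X \<Longrightarrow> vector_field B E \<Longrightarrow> vector_field B W \<Longrightarrow> E (f p) = push p (X p) \<Longrightarrow>
    D X (W \<circ> f) p = nabbar E W (f p)"
  using conn unfolding induced_connection_def by blast

lemma D_diff:
  assumes "vector_field A X" "along V" "along W"
  shows "D X (\<lambda>p. V p - W p) p = D X V p - D X W p"
proof -
  have "along (\<lambda>p. (-1) *\<^sub>R W p)" by (intro along_scale assms) simp
  from D_add[OF assms(1,2) this] D_scale[OF assms(1,3) M.smooth_fun_on_const[of UNIV "-1"]]
  show ?thesis by simp
qed

lemma D_sum:
  assumes "vector_field A X" "\<And>i. i \<in> I \<Longrightarrow> along (V i)"
  shows "D X (\<lambda>p. \<Sum>i\<in>I. V i p) p = (\<Sum>i\<in>I. D X (V i) p)"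
  using assms(2)
proof (induction I rule: infinite_finite_induct)
  case empty
  have "along (\<lambda>p. 0)" using along_sum[of "{}"] by simp
  from D_scale[OF assms(1) this M.smooth_fun_on_const[of UNIV 0], of p] show ?case by simp
next
  case (insert i I)
  have "along (V i)" "along (\<lambda>p. \<Sum>i\<in>I. V i p)" using insert.prems by (auto intro: along_sum)
  from D_add[OF assms(1) this] show ?case using insert by simp
next
  case (infinite I)
  have "along (\<lambda>p. 0)" using along_sum[of "{}"] by simp
  from D_scale[OF assms(1) this M.smooth_fun_on_const[of UNIV 0], of p] show ?case using infinite by simp
qed

text \<open>The induced connection is a local operator, so it is determined by the coefficients in an
  ambient frame near the point.\<close>

lemma D_in_frame:
  assumes X: "vector_field A X" and V: "along V"
    and Q: "open Q" "p \<in> Q" "smooth_fun A \<rho>" "\<And>q. q \<in> Q \<Longrightarrow> \<rho> q = 1"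
    and v: "\<And>b. smooth_fun A (v b)" and E: "\<And>b. vector_field B (E b)"
    and repr: "\<And>q. \<rho> q *\<^sub>R V q = (\<Sum>b\<in>I. v b q *\<^sub>R E b (f q))"
  shows "D X V p = (\<Sum>b\<in>I. dir_deriv A p (X p) (v b) *\<^sub>R E b (f p) + v b p *\<^sub>R D X (E b \<circ> f) p)"
proof -
  \<comment> \<open>\<open>\<rho>\<close> is 1 near \<open>p\<close>, so its derivative there is 0
    and the Leibniz rule shows that multiplying \<open>V\<close> by it does not change
    \<open>D X V p\<close>.\<close>
  have "dir_deriv A p (X p) \<rho> = dir_deriv A p (X p) (\<lambda>q. 1)"
    by (rule M.dir_deriv_cong[OF Q(1,2,4)])
  then have "D X V p = D X (\<lambda>q. \<rho> q *\<^sub>R V q) p"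
    using D_scale[OF X V Q(3)] Q(4)[OF Q(2)] by simp
  also have "\<dots> = D X (\<lambda>q. \<Sum>b\<in>I. v b q *\<^sub>R (E b \<circ> f) q) p"
    by (simp add: repr)
  also have "\<dots> = (\<Sum>b\<in>I. D X (\<lambda>q. v b q *\<^sub>R (E b \<circ> f) q) p)"
    by (intro D_sum X along_scale v along_restrict E)
  also have "\<dots> = (\<Sum>b\<in>I. dir_deriv A p (X p) (v b) *\<^sub>R E b (f p) + v b p *\<^sub>R D X (E b \<circ> f) p)"
    using D_scale[OF X along_restrict[OF E] v] by (simp add: add.commute)
  finally show ?thesis .
qed

lemma along_local:
  assumes "\<And>p. \<exists>Q W. open Q \<and> p \<in> Q \<and> along W \<and> (\<forall>q\<in>Q. V q = W q)"
  shows "along V"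
  unfolding vector_field_along_def
proof clarify
  fix u assume u: "smooth_fun B u"
  show "smooth_fun A (\<lambda>p. dir_deriv B (f p) (V p) u)"
  proof (rule M.smooth_fun_on_local)
    fix p
    obtain Q W where Q: "open Q" "p \<in> Q" "along W" "\<And>q. q \<in> Q \<Longrightarrow> V q = W q"
      using assms[of p] by blast
    have "smooth_fun_on A Q (\<lambda>p. dir_deriv B (f p) (W p) u)"
      using vector_field_alongD[OF Q(3) u] by (rule M.smooth_fun_on_mono) simp
    then have "smooth_fun_on A Q (\<lambda>p. dir_deriv B (f p) (V p) u)"
      by (rule M.smooth_fun_on_cong[OF Q(1), rotated]) (simp add: Q(4))
    then show "\<exists>W. open W \<and> p \<in> W \<and> smooth_fun_on A W (\<lambda>p. dir_deriv B (f p) (V p) u)"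
      using Q by blast
  qed
qed

text \<open>As phi is linear on each fibre, phi V has with respect to the fields phi E_b the same
  coefficients as V with respect to E_b. The derivatives of the coefficients then match termwise,
  and for the fields themselves the ambient Kaehler condition applies.\<close>

lemma
  assumes V: "along V"
  shows phi_along: "along (\<lambda>q. \<phi> (f q) (V q))"
    and D_phi: "vector_field A X \<Longrightarrow> D X (\<lambda>q. \<phi> (f q) (V q)) p = \<phi> (f p) (D X V p)"
proof -
  have main: "\<exists>Q \<rho> E v. open Q \<and> p \<in> Q \<and> smooth_fun A \<rho> \<and> (\<forall>q\<in>Q. \<rho> q = 1) \<and>
     (\<forall>b. smooth_fun A (v b)) \<and> (\<forall>b. vector_field B (E b)) \<and>
     (\<forall>q. \<rho> q *\<^sub>R V q = (\<Sum>b\<in>Basis. v (b::'n) q *\<^sub>R E b (f q))) \<and>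
     (\<forall>q. \<rho> q *\<^sub>R \<phi> (f q) (V q) = (\<Sum>b\<in>Basis. v b q *\<^sub>R \<phi> (f q) (E b (f q))))" for p
  proof -
    obtain Q \<rho> and E :: "'n \<Rightarrow> 'q \<Rightarrow> 'n" and z :: "'n \<Rightarrow> 'q \<Rightarrow> real"
      where Q: "open Q" "p \<in> Q" "smooth_fun A \<rho>" "\<And>q. q \<in> Q \<Longrightarrow> \<rho> q = 1"
      and E: "\<And>b. vector_field B (E b)" and z: "\<And>b. smooth_fun B (z b)"
      and repr: "\<And>q (w::'n). \<rho> q *\<^sub>R w = (\<Sum>b\<in>Basis. (\<rho> q * dir_deriv B (f q) w (z b)) *\<^sub>R E b (f q))"
      by (rule ex_frame_along[of p]) (rule that)
    have 1: "smooth_fun A (\<lambda>q. \<rho> q * dir_deriv B (f q) (V q) (z b))" for b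
      by (intro M.smooth_fun_on_mult vector_field_alongD V z Q) simp
    have 2: "\<rho> q *\<^sub>R \<phi> (f q) (V q) = (\<Sum>b\<in>Basis. (\<rho> q * dir_deriv B (f q) (V q) (z b)) *\<^sub>R \<phi> (f q) (E b (f q)))" for q
    proof -
      have "\<rho> q *\<^sub>R \<phi> (f q) (V q) = \<phi> (f q) (\<rho> q *\<^sub>R V q)" by (simp add: linear_scale[OF linear_phi])
      also have "\<dots> = \<phi> (f q) (\<Sum>b\<in>Basis. (\<rho> q * dir_deriv B (f q) (V q) (z b)) *\<^sub>R E b (f q))"
        by (rule arg_cong[OF repr])
      finally show ?thesis by (simp add: linear_scale[OF linear_phi] linear_sum[OF linear_phi])
    qed
    show ?thesis
      using Q E
      by (intro exI[of _ Q] exI[of _ \<rho>] exI[of _ E] exI[of _ "\<lambda>b q. \<rho> q * dir_deriv B (f q) (V q) (z b)"] conjI allI 1 2 repr) auto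
  qed
  show al: "along (\<lambda>q. \<phi> (f q) (V q))"
  proof (rule along_local)
    fix p
    from main[of p] obtain Q \<rho> E v where Q: "open Q" "p \<in> Q" "smooth_fun A \<rho>" "\<forall>q\<in>Q. \<rho> q = 1"
      and v: "\<forall>b. smooth_fun A (v b)" and E: "\<forall>b. vector_field B (E b)"
      and repr: "\<forall>q. \<rho> q *\<^sub>R \<phi> (f q) (V q) = (\<Sum>b\<in>Basis. v (b::'n) q *\<^sub>R \<phi> (f q) (E b (f q)))"
      by blast
    have "along (\<lambda>q. \<Sum>b\<in>Basis. v b q *\<^sub>R ((\<lambda>r. \<phi> r (E b r)) \<circ> f) q)"
      using v E by (intro along_sum along_scale along_restrict phi_vf) auto
    moreover have "\<phi> (f q) (V q) = (\<Sum>b\<in>Basis. v b q *\<^sub>R ((\<lambda>r. \<phi> r (E b r)) \<circ> f) q)" if "q \<in> Q" for q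
      using repr[rule_format, of q] Q(4) that by simp
    ultimately show "\<exists>Q W. open Q \<and> p \<in> Q \<and> along W \<and> (\<forall>q\<in>Q. \<phi> (f q) (V q) = W q)"
      using Q by blast
  qed
  assume X: "vector_field A X"
  from main[of p] obtain Q \<rho> E v where Q: "open Q" "p \<in> Q" "smooth_fun A \<rho>" "\<forall>q\<in>Q. \<rho> q = 1"
    and v: "\<forall>b. smooth_fun A (v b)" and E: "\<forall>b. vector_field B (E b)"
    and repr: "\<forall>q. \<rho> q *\<^sub>R V q = (\<Sum>b\<in>Basis. v (b::'n) q *\<^sub>R E b (f q))"
    and repr': "\<forall>q. \<rho> q *\<^sub>R \<phi> (f q) (V q) = (\<Sum>b\<in>Basis. v b q *\<^sub>R \<phi> (f q) (E b (f q)))"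
    by blast
  \<comment> \<open>The axiom for restrictions compares the two directions at the single point only,
    so any ambient field with the right value there will do.\<close>
  obtain Xt where Xt: "vector_field B Xt" "Xt (f p) = push p (X p)"
    by (rule N.ex_vector_field) (rule that)
  have DE: "D X ((\<lambda>r. \<phi> r (E b r)) \<circ> f) p = \<phi> (f p) (D X (E b \<circ> f) p)" for b
    using D_restrict[OF X Xt(1) _ Xt(2)] nabbar_phi[OF Xt(1)] E phi_vf by simp
  have "D X (\<lambda>q. \<phi> (f q) (V q)) p = (\<Sum>b\<in>Basis. dir_deriv A p (X p) (v b) *\<^sub>R \<phi> (f p) (E b (f p)) +
      v b p *\<^sub>R D X ((\<lambda>r. \<phi> r (E b r)) \<circ> f) p)"
    by (rule D_in_frame[OF X al Q(1-3)]) (use Q v E repr' phi_vf in auto)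
  moreover have "D X V p = (\<Sum>b\<in>Basis. dir_deriv A p (X p) (v b) *\<^sub>R E b (f p) + v b p *\<^sub>R D X (E b \<circ> f) p)"
    by (rule D_in_frame[OF X V Q(1-3)]) (use Q v E repr in auto)
  ultimately show "D X (\<lambda>q. \<phi> (f q) (V q)) p = \<phi> (f p) (D X V p)"
    by (simp add: DE linear_sum[OF linear_phi] linear_add[OF linear_phi] linear_scale[OF linear_phi])
qed

lemma ambient_metric:
  "vector_field B X \<Longrightarrow> vector_field B Y \<Longrightarrow> vector_field B Z \<Longrightarrow>
    dir_deriv B q (X q) (\<lambda>r. g r (Y r) (Z r)) = g q (nabbar X Y q) (Z q) + g q (Y q) (nabbar X Z q)"
  using ambient_lc unfolding levi_civita_def by blast

text \<open>In a frame the product becomes a double sum of v_a w_b g(E_a, E_b): the Leibniz rule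
  treats the coefficients and metric compatibility of \<open>nabbar\<close> the last factor.\<close>

lemma
  assumes V: "along V" and W: "along W"
  shows g_along_smooth: "smooth_fun A (\<lambda>q. g (f q) (V q) (W q))"
    and D_metric: "vector_field A X \<Longrightarrow> dir_deriv A p (X p) (\<lambda>q. g (f q) (V q) (W q)) =
      g (f p) (D X V p) (W p) + g (f p) (V p) (D X W p)"
proof -
  have main: "\<exists>Q \<rho> E v w. open Q \<and> p \<in> Q \<and> smooth_fun A \<rho> \<and> (\<forall>q\<in>Q. \<rho> q = 1) \<and>
     (\<forall>b. smooth_fun A (v b)) \<and> (\<forall>b. smooth_fun A (w b)) \<and> (\<forall>b. vector_field B (E b)) \<and>
     (\<forall>q. \<rho> q *\<^sub>R V q = (\<Sum>b\<in>Basis. v (b::'n) q *\<^sub>R E b (f q))) \<and>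
     (\<forall>q. \<rho> q *\<^sub>R W q = (\<Sum>b\<in>Basis. w b q *\<^sub>R E b (f q)))" for p
  proof -
    obtain Q \<rho> and E :: "'n \<Rightarrow> 'q \<Rightarrow> 'n" and z :: "'n \<Rightarrow> 'q \<Rightarrow> real"
      where Q: "open Q" "p \<in> Q" "smooth_fun A \<rho>" "\<And>q. q \<in> Q \<Longrightarrow> \<rho> q = 1"
      and E: "\<And>b. vector_field B (E b)" and z: "\<And>b. smooth_fun B (z b)"
      and repr: "\<And>q (w::'n). \<rho> q *\<^sub>R w = (\<Sum>b\<in>Basis. (\<rho> q * dir_deriv B (f q) w (z b)) *\<^sub>R E b (f q))"
      by (rule ex_frame_along[of p]) (rule that)
    have 1: "smooth_fun A (\<lambda>q. \<rho> q * dir_deriv B (f q) (V q) (z b))" if "along V" for V b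
      by (intro M.smooth_fun_on_mult vector_field_alongD that z Q) simp
    show ?thesis
      using Q E
      by (intro exI[of _ Q] exI[of _ \<rho>] exI[of _ E] exI[of _ "\<lambda>b q. \<rho> q * dir_deriv B (f q) (V q) (z b)"]
          exI[of _ "\<lambda>b q. \<rho> q * dir_deriv B (f q) (W q) (z b)"] conjI allI 1 V W repr) auto
  qed
  have expand: "g q (\<Sum>a\<in>Basis. v a *\<^sub>R E a) (\<Sum>b\<in>Basis. w b *\<^sub>R F b) =
    (\<Sum>a\<in>Basis. \<Sum>b\<in>Basis. v a * w b * g q (E a) (F b))" for q and v w :: "'n \<Rightarrow> real" and E F :: "'n \<Rightarrow> 'n"
    by (simp add: bilinear_sum[OF bilinear_g] bilinear_lmul[OF bilinear_g] bilinear_rmul[OF bilinear_g]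
        sum.cartesian_product mult.assoc mult.left_commute)
  show "smooth_fun A (\<lambda>q. g (f q) (V q) (W q))"
  proof (rule M.smooth_fun_on_local)
    fix p
    from main[of p] obtain Q \<rho> E v w where Q: "open Q" "p \<in> Q" "\<forall>q\<in>Q. \<rho> q = 1"
      and v: "\<forall>b. smooth_fun A (v b)" and w: "\<forall>b. smooth_fun A (w b)" and E: "\<forall>b. vector_field B (E b)"
      and repr: "\<forall>q. \<rho> q *\<^sub>R V q = (\<Sum>b\<in>Basis. v (b::'n) q *\<^sub>R E b (f q))"
        "\<forall>q. \<rho> q *\<^sub>R W q = (\<Sum>b\<in>Basis. w b q *\<^sub>R E b (f q))"
      by blast
    have "smooth_fun A (\<lambda>q. \<Sum>a\<in>Basis. \<Sum>b\<in>Basis. v a q * w b q * g (f q) (E a (f q)) (E b (f q)))"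
      using v w smooth_fun_pullback[OF g_smooth] E
      by (intro M.smooth_fun_on_sum M.smooth_fun_on_mult open_UNIV) blast+
    then have "smooth_fun_on A Q (\<lambda>q. \<Sum>a\<in>Basis. \<Sum>b\<in>Basis. v a q * w b q * g (f q) (E a (f q)) (E b (f q)))"
      by (rule M.smooth_fun_on_mono) simp
    then have "smooth_fun_on A Q (\<lambda>q. g (f q) (V q) (W q))"
    proof (rule M.smooth_fun_on_cong[OF Q(1), rotated])
      fix q assume "q \<in> Q"
      then have "V q = (\<Sum>b\<in>Basis. v b q *\<^sub>R E b (f q))" "W q = (\<Sum>b\<in>Basis. w b q *\<^sub>R E b (f q))"
        using repr[rule_format, of q] Q(3) by auto
      then show "(\<Sum>a\<in>Basis. \<Sum>b\<in>Basis. v a q * w b q * g (f q) (E a (f q)) (E b (f q))) = g (f q) (V q) (W q)"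
        by (simp add: expand)
    qed
    then show "\<exists>Q. open Q \<and> p \<in> Q \<and> smooth_fun_on A Q (\<lambda>q. g (f q) (V q) (W q))" using Q by blast
  qed
  assume X: "vector_field A X"
  from main[of p] obtain Q \<rho> E v w where Q: "open Q" "p \<in> Q" "smooth_fun A \<rho>" "\<forall>q\<in>Q. \<rho> q = 1"
    and v: "\<forall>b. smooth_fun A (v b)" and w: "\<forall>b. smooth_fun A (w b)" and E: "\<forall>b. vector_field B (E b)"
    and repr: "\<forall>q. \<rho> q *\<^sub>R V q = (\<Sum>b\<in>Basis. v (b::'n) q *\<^sub>R E b (f q))"
      "\<forall>q. \<rho> q *\<^sub>R W q = (\<Sum>b\<in>Basis. w b q *\<^sub>R E b (f q))"
    by blast
  obtain Xt where Xt: "vector_field B Xt" "Xt (f p) = push p (X p)"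
    by (rule N.ex_vector_field) (rule that)
  have VW: "V q = (\<Sum>b\<in>Basis. v b q *\<^sub>R E b (f q))" "W q = (\<Sum>b\<in>Basis. w b q *\<^sub>R E b (f q))" if "q \<in> Q" for q
    using repr[rule_format, of q] Q(4) that by auto
  have DV: "D X V p = (\<Sum>b\<in>Basis. dir_deriv A p (X p) (v b) *\<^sub>R E b (f p)) + (\<Sum>b\<in>Basis. v b p *\<^sub>R D X (E b \<circ> f) p)"
    unfolding sum.distrib[symmetric] by (rule D_in_frame[OF X V Q(1-3)]) (use Q v E repr in auto)
  have DW: "D X W p = (\<Sum>b\<in>Basis. dir_deriv A p (X p) (w b) *\<^sub>R E b (f p)) + (\<Sum>b\<in>Basis. w b p *\<^sub>R D X (E b \<circ> f) p)"
    unfolding sum.distrib[symmetric] by (rule D_in_frame[OF X W Q(1-3)]) (use Q w E repr in auto)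
  let ?g = "\<lambda>a b q. g (f q) (E a (f q)) (E b (f q))"
  have gs: "smooth_fun A (?g a b)" for a b
    using smooth_fun_pullback[OF g_smooth] E by blast
  have dg: "dir_deriv A p (X p) (?g a b) =
      g (f p) (D X (E a \<circ> f) p) (E b (f p)) + g (f p) (E a (f p)) (D X (E b \<circ> f) p)" for a b
  proof -
    have "dir_deriv A p (X p) (?g a b) = dir_deriv B (f p) (Xt (f p)) (\<lambda>r. g r (E a r) (E b r))"
      using dir_deriv_tangent_map[OF g_smooth, of "E a" "E b" p "X p"] E Xt(2) by simp
    then show ?thesis using ambient_metric[OF Xt(1)] D_restrict[OF X Xt(1) _ Xt(2)] E by simp
  qed
  have "dir_deriv A p (X p) (\<lambda>q. g (f q) (V q) (W q)) =
    dir_deriv A p (X p) (\<lambda>q. \<Sum>a\<in>Basis. \<Sum>b\<in>Basis. v a q * w b q * ?g a b q)"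
    by (rule M.dir_deriv_cong[OF Q(1,2)]) (simp add: VW expand)
  also have "\<dots> = (\<Sum>a\<in>Basis. \<Sum>b\<in>Basis.
      (dir_deriv A p (X p) (v a) * w b p + v a p * dir_deriv A p (X p) (w b)) * ?g a b p +
      v a p * w b p * dir_deriv A p (X p) (?g a b))"
    using v w gs by (simp add: M.dir_deriv_sum M.diff_at_sum M.diff_at_mult M.dir_deriv_mult M.smooth_fun_diff_at)
  also have "\<dots> = g (f p) (D X V p) (W p) + g (f p) (V p) (D X W p)"
    unfolding DV DW VW[OF Q(2)] bilinear_ladd[OF bilinear_g] bilinear_radd[OF bilinear_g] expand dg
    by (simp add: sum.distrib algebra_simps)
  finally show "dir_deriv A p (X p) (\<lambda>q. g (f q) (V q) (W q)) =
      g (f p) (D X V p) (W p) + g (f p) (V p) (D X W p)" .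
qed

lemma
  assumes "vector_field B X" "vector_field B Y"
  shows nabbar_add: "vector_field B Z \<Longrightarrow> nabbar (\<lambda>p. X p + Z p) Y q = nabbar X Y q + nabbar Z Y q"
    and nabbar_scale: "nabbar (\<lambda>p. c *\<^sub>R X p) Y q = c *\<^sub>R nabbar X Y q"
    and nabbar_torsion: "nabbar X Y q - nabbar Y X q = lie_bracket B X Y q"
proof -
  have c: "\<And>Z u. vector_field B Z \<Longrightarrow> smooth_fun B u \<Longrightarrow>
        nabbar (\<lambda>p. X p + Z p) Y = (\<lambda>p. nabbar X Y p + nabbar Z Y p) \<and>
        nabbar (\<lambda>p. u p *\<^sub>R X p) Y = (\<lambda>p. u p *\<^sub>R nabbar X Y p)"
    using ambient_lc assms unfolding levi_civita_def affine_connection_def by blast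
  show "nabbar (\<lambda>p. X p + Z p) Y q = nabbar X Y q + nabbar Z Y q" if "vector_field B Z"
    using c[OF that N.smooth_fun_on_const[of _ 0]] by simp
  show "nabbar (\<lambda>p. c *\<^sub>R X p) Y q = c *\<^sub>R nabbar X Y q"
    using c[OF assms(1) N.smooth_fun_on_const[of _ c]] by simp
  have "(\<lambda>p. nabbar X Y p - nabbar Y X p) = lie_bracket B X Y"
    using ambient_lc assms unfolding levi_civita_def by blast
  then show "nabbar X Y q - nabbar Y X q = lie_bracket B X Y q" by (rule fun_cong)
qed

text \<open>Constant coefficients suffice because the direction matters only at one point: the
  pushed vector is extended by freezing its frame coefficients.\<close>

lemma nabbar_sum:
  assumes "\<And>a. vector_field B (E a)" "vector_field B W"
  shows "nabbar (\<lambda>q. \<Sum>a\<in>I. c a *\<^sub>R E a q) W q = (\<Sum>a\<in>I. c a *\<^sub>R nabbar (E a) W q)"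
proof (induction I rule: infinite_finite_induct)
  case empty
  show ?case using nabbar_scale[OF N.vector_field_on_zero assms(2), of 0 q] by simp
next
  case (insert i I)
  have vf: "vector_field B (\<lambda>q. c a *\<^sub>R E a q)" for a
    by (intro N.vector_field_on_scale assms) simp_all
  have "vector_field B (\<lambda>q. \<Sum>a\<in>I. c a *\<^sub>R E a q)"
    by (intro N.vector_field_on_sum vf) simp
  from nabbar_add[OF vf assms(2) this, of i q] show ?case
    using insert nabbar_scale[OF assms(1,2)] by simp
next
  case (infinite I)
  then show ?case using nabbar_scale[OF N.vector_field_on_zero assms(2), of 0 q] by simp
qed

text \<open>Both sides are compared as derivations of ambient functions. In each, the terms X(Y^b) -
  Y(X^b) appear; the remaining double sums agree after antisymmetrisation, because
  \<open>nabbar\<close> is torsion-free on the frame fields. These need not commute.\<close>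

lemma D_torsion:
  assumes X: "vector_field A X" and Y: "vector_field A Y"
  shows "D X (push_field A B f Y) p - D Y (push_field A B f X) p = push p (lie_bracket A X Y p)"
proof -
  obtain Q \<rho> and E :: "'n \<Rightarrow> 'q \<Rightarrow> 'n" and z :: "'n \<Rightarrow> 'q \<Rightarrow> real"
    where Q: "open Q" "p \<in> Q" "smooth_fun A \<rho>" "\<And>q. q \<in> Q \<Longrightarrow> \<rho> q = 1"
    and E: "\<And>b. vector_field B (E b)" and z: "\<And>b. smooth_fun B (z b)"
    and repr: "\<And>q (w::'n). \<rho> q *\<^sub>R w = (\<Sum>b\<in>Basis. (\<rho> q * dir_deriv B (f q) w (z b)) *\<^sub>R E b (f q))"
    by (rule ex_frame_along[of p]) (rule that)
  define co where "co X b q = \<rho> q * dir_deriv B (f q) (push_field A B f X q) (z b)" for X b q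
  have co: "smooth_fun A (co X b)" if "vector_field A X" for X b
    unfolding co_def[abs_def] by (intro M.smooth_fun_on_mult vector_field_alongD along_push that z Q) simp
  have pq: "push q (X q) = (\<Sum>b\<in>Basis. co X b q *\<^sub>R E b (f q))" if "q \<in> Q" for X q
    using repr[of q "push q (X q)"] Q(4)[OF that] by (simp add: co_def push_field_def)
  have DXY: "D X (push_field A B f Y) p = (\<Sum>b\<in>Basis. dir_deriv A p (X p) (co Y b) *\<^sub>R E b (f p)) +
      (\<Sum>a\<in>Basis. \<Sum>b\<in>Basis. (co X a p * co Y b p) *\<^sub>R nabbar (E a) (E b) (f p))"
    if X: "vector_field A X" and Y: "vector_field A Y" for X Y
  proof -
    have "D X (push_field A B f Y) p =
      (\<Sum>b\<in>Basis. dir_deriv A p (X p) (co Y b) *\<^sub>R E b (f p) + co Y b p *\<^sub>R D X (E b \<circ> f) p)"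
      by (rule D_in_frame[OF X along_push[OF Y] Q]) (simp_all add: co[OF Y] E, simp add: co_def repr)
    also have "\<dots> = (\<Sum>b\<in>Basis. dir_deriv A p (X p) (co Y b) *\<^sub>R E b (f p)) +
      (\<Sum>b\<in>Basis. co Y b p *\<^sub>R (\<Sum>a\<in>Basis. co X a p *\<^sub>R nabbar (E a) (E b) (f p)))"
    proof -
      \<comment> \<open>The coefficients are taken at \<open>p\<close>, not at \<open>q\<close>: the
        field has the pushed vector as its value at \<open>f p\<close>.\<close>
      let ?Xt = "\<lambda>q. \<Sum>a\<in>Basis. co X a p *\<^sub>R E a q"
      have "vector_field B ?Xt" by (intro N.vector_field_on_sum N.vector_field_on_scale E) simp_all
      then have "D X (E b \<circ> f) p = nabbar ?Xt (E b) (f p)" for b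
        by (rule D_restrict[OF X _ E]) (simp add: pq[OF Q(2)])
      then have "D X (E b \<circ> f) p = (\<Sum>a\<in>Basis. co X a p *\<^sub>R nabbar (E a) (E b) (f p))" for b
        by (simp add: nabbar_sum[OF E E])
      then show ?thesis by (simp add: sum.distrib)
    qed
    also have "(\<Sum>b\<in>Basis. co Y b p *\<^sub>R (\<Sum>a\<in>Basis. co X a p *\<^sub>R nabbar (E a) (E b) (f p))) =
      (\<Sum>a\<in>Basis. \<Sum>b\<in>Basis. (co X a p * co Y b p) *\<^sub>R nabbar (E a) (E b) (f p))"
      by (subst sum.swap) (simp add: scaleR_sum_right mult.commute)
    finally show ?thesis .
  qed
  have second: "dir_deriv A p (X p) (\<lambda>q. dir_deriv A q (Y q) (\<lambda>r. u (f r))) =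
      (\<Sum>b\<in>Basis. dir_deriv A p (X p) (co Y b) * dir_deriv B (f p) (E b (f p)) u) +
      (\<Sum>a\<in>Basis. \<Sum>b\<in>Basis. co X a p * co Y b p *
        dir_deriv B (f p) (E a (f p)) (\<lambda>q. dir_deriv B q (E b q) u))"
    if X: "vector_field A X" and Y: "vector_field A Y" and u: "smooth_fun B u" for X Y u
  proof -
    have Eu: "smooth_fun B (\<lambda>q. dir_deriv B q (E b q) u)" for b using N.vector_field_onD[OF E u] .
    have "dir_deriv A p (X p) (\<lambda>q. dir_deriv A q (Y q) (\<lambda>r. u (f r))) =
      dir_deriv A p (X p) (\<lambda>q. \<Sum>b\<in>Basis. co Y b q * dir_deriv B (f q) (E b (f q)) u)"
    proof (rule M.dir_deriv_cong[OF Q(1,2)])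
      fix q assume "q \<in> Q"
      then show "dir_deriv A q (Y q) (\<lambda>r. u (f r)) = (\<Sum>b\<in>Basis. co Y b q * dir_deriv B (f q) (E b (f q)) u)"
        using N.smooth_fun_diff_at[OF u]
        by (simp add: dir_deriv_tangent_map[OF u, symmetric] pq N.dir_deriv_vec_sum N.dir_deriv_vec_scale)
    qed
    also have "\<dots> = (\<Sum>b\<in>Basis. dir_deriv A p (X p) (co Y b) * dir_deriv B (f p) (E b (f p)) u) +
      (\<Sum>b\<in>Basis. co Y b p * dir_deriv A p (X p) (\<lambda>q. dir_deriv B (f q) (E b (f q)) u))"
      using M.smooth_fun_diff_at[OF smooth_fun_pullback[OF Eu]] M.smooth_fun_diff_at[OF co[OF Y]]
      by (simp add: M.dir_deriv_sum M.diff_at_mult M.dir_deriv_mult sum.distrib)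
    also have "(\<Sum>b\<in>Basis. co Y b p * dir_deriv A p (X p) (\<lambda>q. dir_deriv B (f q) (E b (f q)) u)) =
      (\<Sum>b\<in>Basis. \<Sum>a\<in>Basis. co X a p * co Y b p *
        dir_deriv B (f p) (E a (f p)) (\<lambda>q. dir_deriv B q (E b q) u))"
      using N.smooth_fun_diff_at[OF Eu]
      by (simp add: dir_deriv_tangent_map[OF Eu, symmetric] pq[OF Q(2)] N.dir_deriv_vec_sum
          N.dir_deriv_vec_scale sum_distrib_left mult.assoc mult.left_commute)
    also have "\<dots> = (\<Sum>a\<in>Basis. \<Sum>b\<in>Basis. co X a p * co Y b p *
        dir_deriv B (f p) (E a (f p)) (\<lambda>q. dir_deriv B q (E b q) u))"
      by (rule sum.swap)
    finally show ?thesis .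
  qed
  show ?thesis
  proof (rule N.tangent_vector_eqI[of "f p"])
    fix u assume u: "smooth_fun B u"
    note lin = N.dir_deriv_vec_sum[OF N.smooth_fun_diff_at[OF u]] N.dir_deriv_vec_scale[OF N.smooth_fun_diff_at[OF u]]
      N.dir_deriv_vec_add[OF N.smooth_fun_diff_at[OF u]] N.dir_deriv_vec_diff[OF N.smooth_fun_diff_at[OF u]]
    define n where "n a b = dir_deriv B (f p) (nabbar (E a) (E b) (f p)) u" for a b
    define e where "e a b = dir_deriv B (f p) (E a (f p)) (\<lambda>q. dir_deriv B q (E b q) u)" for a b
    \<comment> \<open>Torsion-freeness of \<open>nabbar\<close> on a pair of frame fields, with
      their bracket evaluated on \<open>u\<close>.\<close>
    have br: "n a b - n b a = e a b - e b a" for a b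
      unfolding n_def e_def using N.dir_deriv_lie_bracket[OF E E u, of "f p" a b]
      by (simp add: lin[symmetric] nabbar_torsion[OF E E])
    have "(\<Sum>a\<in>Basis. \<Sum>b\<in>Basis. co X a p * co Y b p * n a b) - (\<Sum>a\<in>Basis. \<Sum>b\<in>Basis. co Y a p * co X b p * n a b)
      = (\<Sum>a\<in>Basis. \<Sum>b\<in>Basis. co X a p * co Y b p * (n a b - n b a))"
      by (subst (2) sum.swap) (simp add: sum_subtractf algebra_simps)
    also have "\<dots> = (\<Sum>a\<in>Basis. \<Sum>b\<in>Basis. co X a p * co Y b p * e a b) -
        (\<Sum>a\<in>Basis. \<Sum>b\<in>Basis. co Y a p * co X b p * e a b)"
      unfolding br by (subst (3) sum.swap) (simp add: sum_subtractf algebra_simps)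
    finally have sums: "(\<Sum>a\<in>Basis. \<Sum>b\<in>Basis. co X a p * co Y b p * n a b) - (\<Sum>a\<in>Basis. \<Sum>b\<in>Basis. co Y a p * co X b p * n a b)
      = (\<Sum>a\<in>Basis. \<Sum>b\<in>Basis. co X a p * co Y b p * e a b) -
        (\<Sum>a\<in>Basis. \<Sum>b\<in>Basis. co Y a p * co X b p * e a b)" .
    have "dir_deriv B (f p) (push p (lie_bracket A X Y p)) u =
      dir_deriv A p (X p) (\<lambda>q. dir_deriv A q (Y q) (\<lambda>r. u (f r))) -
      dir_deriv A p (Y p) (\<lambda>q. dir_deriv A q (X q) (\<lambda>r. u (f r)))"
      by (simp add: dir_deriv_tangent_map[OF u] M.dir_deriv_lie_bracket[OF X Y smooth_fun_pullback[OF u]])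
    also have "\<dots> = dir_deriv B (f p) (D X (push_field A B f Y) p - D Y (push_field A B f X) p) u"
      unfolding second[OF X Y u] second[OF Y X u] DXY[OF X Y] DXY[OF Y X] lin
      using sums by (simp add: n_def e_def)
    finally show "dir_deriv B (f p) (D X (push_field A B f Y) p - D Y (push_field A B f X) p) u =
      dir_deriv B (f p) (push p (lie_bracket A X Y p)) u" by simp
  qed
qed

section \<open>Gauss and Weingarten formulas and the operator T\<close>

abbreviation "sff \<equiv> second_fundamental_form A B f D nab"
abbreviation "TX \<equiv> T_part A B f \<phi> g"
abbreviation "NX \<equiv> N_part A B f \<phi> g"

text \<open>T on single vectors rather than fields, so that membership in the distributions is
  decided by linear algebra in one tangent space.\<close>

definition Tp :: "'p \<Rightarrow> 'm \<Rightarrow> 'm" where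
  "Tp p v = tanp p (\<phi> (f p) (push p v))"

lemma T_part_eq: "TX X p = Tp p (X p)"
  by (simp add: T_part_def Tp_def push_field_def)

lemma linear_Tp: "linear (Tp p)"
  unfolding Tp_def
  using linear_compose[OF linear_compose[OF linear_tangent_map linear_phi] linear_tan_part]
  by (simp add: comp_def)

lemma nab_vf:
  assumes "vector_field A X" "vector_field A Y"
  shows "vector_field A (nab X Y)"
proof -
  \<comment> \<open>The connection axioms also quantify over a smooth function, so one has to be
    supplied.\<close>
  have "vector_field A (nab X Y)" if "smooth_fun A u" for u
    using lc assms that unfolding levi_civita_def affine_connection_def by blast
  from this[OF M.smooth_fun_on_const] show ?thesis .
qed

lemma nab_torsion:
  assumes "vector_field A X" "vector_field A Y"
  shows "nab X Y p - nab Y X p = lie_bracket A X Y p"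
proof -
  have "(\<lambda>p. nab X Y p - nab Y X p) = lie_bracket A X Y"
    using lc assms unfolding levi_civita_def by blast
  then show ?thesis by (rule fun_cong)
qed

lemma nab_metric:
  "vector_field A X \<Longrightarrow> vector_field A Y \<Longrightarrow> vector_field A Z \<Longrightarrow>
    dir_deriv A p (X p) (\<lambda>q. G q (Y q) (Z q)) = G p (nab X Y p) (Z p) + G p (Y p) (nab X Z p)"
  using lc unfolding levi_civita_def by blast

text \<open>Smoothness is inherited from the torsion-free connection, as the bracket is a difference
  of two of its values.\<close>

lemma lie_bracket_vf:
  assumes "vector_field A X" "vector_field A Y"
  shows "vector_field A (lie_bracket A X Y)"
proof -
  have "vector_field A (\<lambda>p. nab X Y p - nab Y X p)"
    by (intro M.vector_field_on_diff nab_vf assms) simp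
  then show ?thesis by (simp add: nab_torsion[OF assms])
qed

text \<open>Antisymmetrising either term of the definition gives the push-forward of the bracket, so
  the two contributions cancel.\<close>

lemma sff_sym:
  assumes "vector_field A X" "vector_field A Y"
  shows "sff X Y p = sff Y X p"
proof -
  have "D X (push_field A B f Y) p - D Y (push_field A B f X) p = push p (nab X Y p) - push p (nab Y X p)"
    unfolding D_torsion[OF assms] nab_torsion[OF assms, symmetric] by (rule linear_diff[OF linear_tangent_map])
  then show ?thesis
    unfolding second_fundamental_form_def push_field_def[of A B f "nab X Y"] push_field_def[of A B f "nab Y X"]
    by (metis (no_types, lifting) add_diff_cancel_left' diff_add_cancel diff_add_eq diff_diff_eq2)
qed

text \<open>The trilinear form \<open>g(h(X,Y),Z)\<close> is symmetric in the first two arguments because both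
  connections are torsion-free, and skew in the last two because both are metric; so it vanishes.\<close>

lemma sff_normal:
  assumes X: "vector_field A X" and Y: "vector_field A Y"
  shows "g (f p) (sff X Y p) (push p v) = 0"
proof -
  define t where "t X Y Z = g (f p) (sff X Y p) (push p (Z p))" for X Y Z
  have sym: "t X Y Z = t Y X Z" if "vector_field A X" "vector_field A Y" for X Y Z
    using sff_sym[OF that] by (simp add: t_def)
  have skew: "t X Y Z = - t X Z Y" if X: "vector_field A X" and Y: "vector_field A Y" and Z: "vector_field A Z" for X Y Z
  proof -
    have "dir_deriv A p (X p) (\<lambda>q. G q (Y q) (Z q)) =
      g (f p) (D X (push_field A B f Y) p) (push p (Z p)) + g (f p) (push p (Y p)) (D X (push_field A B f Z) p)"
      using D_metric[OF along_push[OF Y] along_push[OF Z] X, of p] by (simp add: G_eq push_field_def)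
    then show ?thesis
      using nab_metric[OF X Y Z, of p] g_sym
      by (simp add: t_def second_fundamental_form_def push_field_def G_eq bilinear_lsub[OF bilinear_g]
          bilinear_rsub[OF bilinear_g])
  qed
  obtain Z where Z: "vector_field A Z" "Z p = v"
    by (rule M.ex_vector_field) (rule that)
  have "t X Y Z = 0"
    \<comment> \<open>Alternating the two rules gives t(X,Y,Z) = t(Y,X,Z) = -t(Y,Z,X) = -t(Z,Y,X) =
      t(Z,X,Y) = t(X,Z,Y) = -t(X,Y,Z).\<close>
    using sym[OF X Y, of Z] sym[OF Y Z(1), of X] sym[OF X Z(1), of Y]
      skew[OF X Y Z(1)] skew[OF Y X Z(1)] skew[OF Z(1) X Y] by linarith
  then show ?thesis by (simp add: t_def Z)
qed

lemma tan_part_D_push: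
  assumes "vector_field A X" "vector_field A Y"
  shows "tanp p (D X (push_field A B f Y) p) = nab X Y p"
proof (rule tan_part_eqI)
  show "g (f p) (D X (push_field A B f Y) p - push p (nab X Y p)) (push p v) = 0" for v
    using sff_normal[OF assms, of p v] unfolding second_fundamental_form_def push_field_def[of A B f "nab X Y"] .
qed

text \<open>The coefficients of the tangential part in a local frame solve the Gram system of that
  frame, whose entries and right-hand side are smooth.\<close>

lemma tan_part_vf:
  assumes V: "along V"
  shows "vector_field A (\<lambda>p. tanp p (V p))"
  unfolding vector_field_on_def
proof clarify
  fix u assume u: "smooth_fun A u"
  show "smooth_fun A (\<lambda>p. dir_deriv A p (tanp p (V p)) u)"
  proof (rule M.smooth_fun_on_local)
    fix p
    obtain U and E :: "'m \<Rightarrow> 'p \<Rightarrow> 'm" and z where U: "open U" "p \<in> U"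
      and E: "\<And>b. vector_field A (E b)" and z: "\<And>b. smooth_fun A (z b)"
      and repr: "\<And>q (v::'m). q \<in> U \<Longrightarrow> v = (\<Sum>b\<in>Basis. dir_deriv A q v (z b) *\<^sub>R E b q)"
      and comm: "\<And>u a b. smooth_fun A u \<Longrightarrow> dir_deriv A p (E a p) (\<lambda>q. dir_deriv A q (E b q) u) =
        dir_deriv A p (E b p) (\<lambda>q. dir_deriv A q (E a q) u)"
      by (rule M.ex_frame[of p]) (rule that)
    define t where "t b q = dir_deriv A q (tanp q (V q)) (z b)" for b q
    have tq: "tanp q (V q) = (\<Sum>b\<in>Basis. t b q *\<^sub>R E b q)" if "q \<in> U" for q
      unfolding t_def by (rule repr[OF that])
    have ts: "smooth_fun_on A U (t b)" if "b \<in> Basis" for b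
    proof (rule M.posdef_system_smooth[OF finite_Basis U(1), of "\<lambda>a b q. G q (E a q) (E b q)"
          "\<lambda>a q. g (f q) (V q) (push q (E a q))" t])
      show "smooth_fun_on A U (\<lambda>q. G q (E a q) (E b q))" for a b
        using g_along_smooth[OF along_push[OF E] along_push[OF E], of a b]
        unfolding G_eq push_field_def by (rule M.smooth_fun_on_mono) simp
      show "smooth_fun_on A U (\<lambda>q. g (f q) (V q) (push q (E a q)))" for a
        using g_along_smooth[OF V along_push[OF E], of a]
        unfolding push_field_def by (rule M.smooth_fun_on_mono) simp
      show "G q (E a q) (E b q) = G q (E b q) (E a q)" for a b q by (rule G_sym)
      show "0 < (\<Sum>a\<in>Basis. \<Sum>b\<in>Basis. x a * x b * G q (E a q) (E b q))"
        if q: "q \<in> U" and i: "i \<in> Basis" "x i \<noteq> 0" for q x i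
      proof -
        \<comment> \<open>The frame is only known to span. As it is indexed by \<open>Basis\<close>,
          the coordinate map \<open>h\<close> is a surjective endomorphism, hence injective, so the
          frame is independent and its Gram matrix positive definite.\<close>
        define h where "h v = (\<Sum>b\<in>Basis. (v \<bullet> b) *\<^sub>R E b q)" for v
        have h: "linear h"
          by (rule linearI) (simp_all add: h_def inner_add_left scaleR_add_left sum.distrib scaleR_sum_right)
        have hx: "h (\<Sum>b\<in>Basis. x b *\<^sub>R b) = (\<Sum>b\<in>Basis. x b *\<^sub>R E b q)" for x
          by (simp add: h_def)
        have "surj h"
        proof (rule surjI)
          fix v show "h (\<Sum>b\<in>Basis. dir_deriv A q v (z b) *\<^sub>R b) = v"
            unfolding hx by (rule repr[OF q, symmetric])
        qed
        then have inj: "inj h" using linear_surjective_imp_injective[OF h] by blast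
        have "(\<Sum>b\<in>Basis. x b *\<^sub>R b) \<noteq> (0::'m)"
        proof
          assume "(\<Sum>b\<in>Basis. x b *\<^sub>R b) = (0::'m)"
          then have "(\<Sum>b\<in>Basis. x b *\<^sub>R b) \<bullet> i = 0" by simp
          then show False using i by simp
        qed
        then have "h (\<Sum>b\<in>Basis. x b *\<^sub>R b) \<noteq> 0"
          using inj linear_0[OF h] by (metis injD)
        then have "0 < G q (\<Sum>b\<in>Basis. x b *\<^sub>R E b q) (\<Sum>b\<in>Basis. x b *\<^sub>R E b q)"
          unfolding hx by (rule G_pos)
        then show ?thesis
          by (simp add: bilinear_sum[OF bilinear_G] bilinear_lmul[OF bilinear_G] bilinear_rmul[OF bilinear_G]
              sum.cartesian_product mult.assoc mult.left_commute)
      qed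
      show "(\<Sum>b\<in>Basis. G q (E a q) (E b q) * t b q) = g (f q) (V q) (push q (E a q))"
        if q: "q \<in> U" for q a
      proof -
        have "g (f q) (V q) (push q (E a q)) = G q (E a q) (tanp q (V q))"
          by (simp add: G_eq g_sym[of "f q" "push q (E a q)"] g_tan_part)
        also have "\<dots> = G q (E a q) (\<Sum>b\<in>Basis. t b q *\<^sub>R E b q)"
          by (simp only: tq[OF q])
        also have "\<dots> = (\<Sum>b\<in>Basis. t b q * G q (E a q) (E b q))"
        proof -
          have l: "linear (G q (E a q))" using bilinear_G by (simp add: bilinear_def)
          show ?thesis by (simp add: linear_sum[OF l] linear_scale[OF l])
        qed
        finally show ?thesis by (simp add: mult.commute)
      qed
    qed (use that in auto)
    have "smooth_fun_on A U (\<lambda>q. \<Sum>b\<in>Basis. t b q * dir_deriv A q (E b q) u)"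
      using M.vector_field_onD[OF E u]
      by (intro M.smooth_fun_on_sum M.smooth_fun_on_mult U ts) (auto intro: M.smooth_fun_on_mono)
    then have "smooth_fun_on A U (\<lambda>p. dir_deriv A p (tanp p (V p)) u)"
      by (rule M.smooth_fun_on_cong[OF U(1), rotated])
        (simp add: tq M.dir_deriv_vec_sum[OF M.smooth_fun_diff_at[OF u]] M.dir_deriv_vec_scale[OF M.smooth_fun_diff_at[OF u]])
    then show "\<exists>W. open W \<and> p \<in> W \<and> smooth_fun_on A W (\<lambda>p. dir_deriv A p (tanp p (V p)) u)"
      using U by blast
  qed
qed

lemma phi_push_along: "vector_field A X \<Longrightarrow> along (\<lambda>q. \<phi> (f q) (push_field A B f X q))"
  by (rule phi_along[OF along_push])

lemma T_part_vf: "vector_field A X \<Longrightarrow> vector_field A (TX X)"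
  using tan_part_vf[OF phi_push_along] unfolding T_part_def[abs_def] .

text \<open>By Weingarten applied to NX = phi X - TX, each shape operator contributes a derivative
  of TX or TY that cancels the one written in front; what is left is the tangential part of phi
  applied to the torsion of \<open>D\<close>.\<close>

lemma tangential_identity:
  assumes X: "vector_field A X" and Y: "vector_field A Y"
  shows "nab X (TX Y) p - nab Y (TX X) p + shape_operator A B f g D (NX X) Y p
    - shape_operator A B f g D (NX Y) X p = Tp p (lie_bracket A X Y p)"
proof -
  have sh: "shape_operator A B f g D (NX X) Y p = nab Y (TX X) p - tanp p (\<phi> (f p) (D Y (push_field A B f X) p))"
    if X: "vector_field A X" and Y: "vector_field A Y" for X Y
  proof -
    have "D Y (NX X) p = \<phi> (f p) (D Y (push_field A B f X) p) - D Y (push_field A B f (TX X)) p"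
      unfolding N_part_def[abs_def]
      using D_diff[OF Y phi_push_along[OF X] along_push[OF T_part_vf[OF X]]] D_phi[OF along_push[OF X] Y]
      by simp
    then show ?thesis
      by (simp add: shape_operator_def linear_diff[OF linear_tan_part] tan_part_D_push[OF Y T_part_vf[OF X]])
  qed
  have "nab X (TX Y) p - nab Y (TX X) p + shape_operator A B f g D (NX X) Y p
    - shape_operator A B f g D (NX Y) X p =
    tanp p (\<phi> (f p) (D X (push_field A B f Y) p - D Y (push_field A B f X) p))"
    unfolding sh[OF X Y] sh[OF Y X] linear_diff[OF linear_phi] linear_diff[OF linear_tan_part] by simp
  then show ?thesis by (simp add: D_torsion[OF X Y] Tp_def)
qed

text \<open>The last two hypotheses say that NX and NY vanish. Then TY is pushed to phi Y, and since
  \<open>D\<close> commutes with phi, h(X,TY) is phi of the derivative of Y minus a tangential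
  term.\<close>

lemma normal_identity:
  assumes X: "vector_field A X" and Y: "vector_field A Y"
    and "\<And>q. \<phi> (f q) (push q (X q)) = push q (Tp q (X q))" "\<And>q. \<phi> (f q) (push q (Y q)) = push q (Tp q (Y q))"
  shows "sff X (TX Y) p - sff (TX X) Y p =
    \<phi> (f p) (push p (lie_bracket A X Y p)) - push p (Tp p (lie_bracket A X Y p))"
proof -
  have s: "sff X (TX Y) p = \<phi> (f p) (D X (push_field A B f Y) p) - push p (nab X (TX Y) p)"
    if X: "vector_field A X" and Y: "vector_field A Y"
      and Yi: "\<And>q. \<phi> (f q) (push q (Y q)) = push q (Tp q (Y q))" for X Y
  proof -
    have "push_field A B f (TX Y) = (\<lambda>q. \<phi> (f q) (push_field A B f Y q))"
      by (simp add: fun_eq_iff push_field_def T_part_eq Yi)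
    then show ?thesis
      by (simp add: second_fundamental_form_def D_phi[OF along_push[OF Y] X]) (simp add: push_field_def)
  qed
  define w where "w = nab X (TX Y) p - nab Y (TX X) p"
  have eq: "sff X (TX Y) p - sff (TX X) Y p = \<phi> (f p) (push p (lie_bracket A X Y p)) - push p w"
    unfolding sff_sym[OF T_part_vf[OF X] Y] s[OF X Y assms(4)] s[OF Y X assms(3)] D_torsion[OF X Y, symmetric]
    by (simp add: w_def linear_diff[OF linear_phi] linear_diff[OF linear_tangent_map])
  \<comment> \<open>The left-hand side of \<open>eq\<close> is normal, so the correction
    \<open>w\<close> must be the tangential part of phi applied to the bracket.\<close>
  have "g (f p) (sff X (TX Y) p - sff (TX X) Y p) (push p v) = 0" for v
    by (simp add: bilinear_lsub[OF bilinear_g] sff_normal X Y T_part_vf)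
  then have "Tp p (lie_bracket A X Y p) = w"
    unfolding Tp_def eq by (rule tan_part_eqI)
  then show ?thesis using eq by simp
qed

section \<open>Angles in the ambient metric\<close>

lemma g_cauchy_schwarz: "\<bar>g q v w\<bar> \<le> sqrt (g q v v) * sqrt (g q w w)"
proof (cases "w = 0")
  case False
  let ?a = "g q v v" and ?b = "g q v w" and ?c = "g q w w"
  have c: "?c > 0" using g_pos False by blast
  have "0 \<le> g q (?c *\<^sub>R v - ?b *\<^sub>R w) (?c *\<^sub>R v - ?b *\<^sub>R w)" by (rule g_nonneg)
  also have "\<dots> = ?c * (?a * ?c - ?b * ?b)"
    by (simp add: bilinear_lsub[OF bilinear_g] bilinear_rsub[OF bilinear_g] bilinear_lmul[OF bilinear_g]
        bilinear_rmul[OF bilinear_g] g_sym[of q w v] algebra_simps)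
  finally have "?b\<^sup>2 \<le> ?a * ?c" using c by (simp add: zero_le_mult_iff power2_eq_square)
  then have "sqrt (?b\<^sup>2) \<le> sqrt (?a * ?c)" by (rule real_sqrt_le_mono)
  then show ?thesis by (simp add: real_sqrt_mult)
qed (simp add: bilinear_rzero[OF bilinear_g])

text \<open>Cauchy-Schwarz keeps the argument of \<open>arccos\<close> in [-1, 1]. The bound makes
  the infimum in \<open>subspace_angle\<close> one over a set bounded below.\<close>

lemma vec_angle_nonneg: "v \<noteq> 0 \<Longrightarrow> w \<noteq> 0 \<Longrightarrow> 0 \<le> vec_angle (g q) v w"
proof -
  assume "v \<noteq> 0" "w \<noteq> 0"
  then have pos: "0 < sqrt (g q v v) * sqrt (g q w w)" using g_pos by simp
  have "\<bar>g q v w / (sqrt (g q v v) * sqrt (g q w w))\<bar> \<le> 1"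
    using g_cauchy_schwarz[of q v w] pos unfolding abs_div_pos[OF pos, symmetric] by (simp only: divide_le_eq_1_pos)
  then show ?thesis unfolding vec_angle_def by (intro arccos_lbound) linarith+
qed

end

section \<open>Slant distributions\<close>

locale slant_submanifold = kaehler_submanifold A B f \<phi> g nabbar D nab
  for A :: "('p::{t2_space,second_countable_topology}, 'm::euclidean_space) chart set"
    and B :: "('q::{t2_space,second_countable_topology}, 'n::euclidean_space) chart set"
    and f :: "'p \<Rightarrow> 'q" and \<phi> g nabbar D nab +
  fixes k :: nat and \<D> :: "nat \<Rightarrow> 'p \<Rightarrow> 'm set" and \<theta> :: "nat \<Rightarrow> 'p \<Rightarrow> real"
  assumes slant: "pointwise_k_slant A B f \<phi> g k \<D> \<theta>"
begin

section \<open>Consequences of the slant decomposition\<close>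

lemma regular: "i \<le> k \<Longrightarrow> regular_distribution A (\<D> i)"
  using slant unfolding pointwise_k_slant_def by (elim conjE) simp

lemma orth: "i \<le> k \<Longrightarrow> j \<le> k \<Longrightarrow> i \<noteq> j \<Longrightarrow> v \<in> \<D> i p \<Longrightarrow> w \<in> \<D> j p \<Longrightarrow> G p v w = 0"
  using slant unfolding pointwise_k_slant_def by (elim conjE) simp

lemma decompose:
  obtains w where "\<And>i. i \<le> k \<Longrightarrow> w i \<in> \<D> i p" "v = (\<Sum>i\<le>k. w i)"
proof -
  have "\<exists>!w. w \<in> (\<Pi>\<^sub>E i\<in>{..k}. \<D> i p) \<and> v = (\<Sum>i\<le>k. w i)"
    using slant unfolding pointwise_k_slant_def by (elim conjE) simp
  then obtain w where "w \<in> (\<Pi>\<^sub>E i\<in>{..k}. \<D> i p)" "v = (\<Sum>i\<le>k. w i)" by (elim ex1E conjE)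
  then show ?thesis by (intro that[of w]) auto
qed

lemma phi_push_D0: "v \<in> \<D> 0 p \<Longrightarrow> \<phi> (f p) (push p v) = push p (Tp p v) \<and> Tp p v \<in> \<D> 0 p"
proof -
  assume v: "v \<in> \<D> 0 p"
  have "\<phi> (f p) ` push p ` \<D> 0 p \<subseteq> push p ` \<D> 0 p"
    using slant unfolding pointwise_k_slant_def by (elim conjE) simp
  then obtain w where "w \<in> \<D> 0 p" "\<phi> (f p) (push p v) = push p w" using v by blast
  then show ?thesis by (simp add: Tp_def)
qed

lemma Tp_D: "i \<le> k \<Longrightarrow> v \<in> \<D> i p \<Longrightarrow> Tp p v \<in> \<D> i p"
proof (cases "i = 0")
  case False
  assume "i \<le> k" "v \<in> \<D> i p"
  moreover have "\<forall>i\<in>{1..k}. \<forall>p. \<forall>v\<in>\<D> i p. Tp p v \<in> \<D> i p"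
    using slant unfolding pointwise_k_slant_def Tp_def by (elim conjE)
  ultimately show ?thesis using False by simp
qed (simp add: phi_push_D0)

lemma slant_angle:
  assumes "1 \<le> i" "i \<le> k" "v \<in> \<D> i p" "v \<noteq> 0"
  shows "subspace_angle (g (f p)) (\<phi> (f p) (push p v)) (push p ` \<D> i p) = \<theta> i p" "0 < \<theta> i p"
proof -
  have "\<forall>i\<in>{1..k}. (\<forall>p. \<D> i p \<noteq> {0}) \<and> pointwise_slant A B f \<phi> g (\<D> i) (\<theta> i) \<and>
        (\<forall>p. 0 < \<theta> i p \<and> \<theta> i p \<le> pi / 2)"
    using slant unfolding pointwise_k_slant_def by (elim conjE)
  then have i: "pointwise_slant A B f \<phi> g (\<D> i) (\<theta> i)" "0 < \<theta> i p" using assms by auto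
  then show "subspace_angle (g (f p)) (\<phi> (f p) (push p v)) (push p ` \<D> i p) = \<theta> i p" "0 < \<theta> i p"
    using assms unfolding pointwise_slant_def by auto
qed

lemma phi_push_nonzero: "v \<noteq> 0 \<Longrightarrow> \<phi> (f p) (push p v) \<noteq> 0"
  using phi_phi[of "f p" "push p v"] linear_0[OF linear_phi] push_eq_0 by (metis neg_equal_0_iff_equal)

text \<open>If phi v were tangent, it would lie in the pushed distribution because T preserves it.
  Then phi v itself competes in the infimum with angle 0, contradicting a positive slant
  angle.\<close>

lemma proper_slant:
  assumes i: "1 \<le> i" "i \<le> k" and v: "v \<in> \<D> i p" and eq: "\<phi> (f p) (push p v) = push p (Tp p v)"
  shows "v = 0"
proof (rule ccontr)
  assume nz: "v \<noteq> 0"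
  let ?w = "\<phi> (f p) (push p v)"
  have w: "?w \<in> push p ` \<D> i p - {0}"
    using phi_push_nonzero[OF nz] Tp_D[OF i(2) v] eq by auto
  have "bdd_below (vec_angle (g (f p)) ?w ` (push p ` \<D> i p - {0}))"
    using vec_angle_nonneg[OF phi_push_nonzero[OF nz]] by (intro bdd_belowI2[of _ 0]) auto
  from cINF_lower[OF this w] have "\<theta> i p \<le> vec_angle (g (f p)) ?w ?w"
    using slant_angle(1)[OF i v nz] by (simp add: subspace_angle_def)
  moreover have "g (f p) ?w ?w > 0" using g_pos phi_push_nonzero[OF nz] by blast
  then have "vec_angle (g (f p)) ?w ?w = 0" by (simp add: vec_angle_def)
  ultimately show False using slant_angle(2)[OF i v nz] by simp
qed

text \<open>For \<open>i = 0\<close>, phi v is tangent and hence equal to the pushed Tv, so phi v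
  would be 0. Otherwise Tv = 0 makes phi v orthogonal to all tangent vectors, so every angle in the
  infimum is a right angle.\<close>

lemma Tp_injective:
  assumes i: "i \<le> k" and v: "v \<in> \<D> i p" and eq: "Tp p v = 0" and "\<theta> i p \<noteq> pi / 2"
  shows "v = 0"
proof (rule ccontr)
  assume nz: "v \<noteq> 0"
  show False
  proof (cases "i = 0")
    case True
    then show False
      using phi_push_D0[of v p] v eq phi_push_nonzero[OF nz] linear_0[OF linear_tangent_map] by simp
  next
    case False
    then have i1: "1 \<le> i" by simp
    have "g (f p) (\<phi> (f p) (push p v)) (push p x) = 0" for x
      using g_tan_part[of p "\<phi> (f p) (push p v)" x] eq
      by (simp add: Tp_def linear_0[OF linear_tangent_map] bilinear_lzero[OF bilinear_g])
    then have "(INF w\<in>push p ` \<D> i p - {0}. vec_angle (g (f p)) (\<phi> (f p) (push p v)) w) =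
      (INF w\<in>push p ` \<D> i p - {0}. pi / 2)"
      by (intro INF_cong refl) (auto simp: vec_angle_def)
    also have "\<dots> = pi / 2"
    proof (rule cINF_const)
      have "push p v \<noteq> 0" using nz push_eq_0 by blast
      then show "push p ` \<D> i p - {0} \<noteq> {}" using v by blast
    qed
    finally show False
      using slant_angle(1)[OF i1 i v nz] assms(4) by (simp add: subspace_angle_def)
  qed
qed

lemma sections_vf: "X \<in> sections A (\<D> i) \<Longrightarrow> vector_field A X"
  and sections_mem: "X \<in> sections A (\<D> i) \<Longrightarrow> X p \<in> \<D> i p"
  by (simp_all add: sections_def)

section \<open>The three integrability criteria\<close>

text \<open>The bracket is smooth in any case, which reduces integrability to membership point by
  point.\<close>

lemma integrable_iff:
  "integrable_distribution A (\<D> i) \<longleftrightarrow>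
    (\<forall>X\<in>sections A (\<D> i). \<forall>Y\<in>sections A (\<D> i). \<forall>p. lie_bracket A X Y p \<in> \<D> i p)"
  unfolding integrable_distribution_def
proof (intro ball_cong refl)
  fix X Y assume "X \<in> sections A (\<D> i)" "Y \<in> sections A (\<D> i)"
  then have "vector_field A (lie_bracket A X Y)" by (intro lie_bracket_vf sections_vf)
  then show "lie_bracket A X Y \<in> sections A (\<D> i) \<longleftrightarrow> (\<forall>p. lie_bracket A X Y p \<in> \<D> i p)"
    by (simp add: sections_def)
qed

lemma G_sum_right: "G p v (\<Sum>i\<in>I. w i) = (\<Sum>i\<in>I. G p v (w i))"
  using bilinear_G[of p] unfolding bilinear_def by (simp add: linear_sum)

text \<open>The distributions are orthogonal and span, so each is the orthogonal complement of the
  others; pairing v with its component w_j leaves only the square of w_j.\<close>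

lemma D_mem_iff:
  assumes "i \<le> k"
  shows "v \<in> \<D> i p \<longleftrightarrow> (\<forall>j\<le>k. j \<noteq> i \<longrightarrow> (\<forall>z\<in>\<D> j p. G p v z = 0))"
proof
  assume "v \<in> \<D> i p"
  then show "\<forall>j\<le>k. j \<noteq> i \<longrightarrow> (\<forall>z\<in>\<D> j p. G p v z = 0)"
    using orth[OF assms] by blast
next
  assume R: "\<forall>j\<le>k. j \<noteq> i \<longrightarrow> (\<forall>z\<in>\<D> j p. G p v z = 0)"
  obtain w where w: "\<And>i. i \<le> k \<Longrightarrow> w i \<in> \<D> i p" "v = (\<Sum>i\<le>k. w i)"
    by (rule decompose) (rule that)
  have "w j = 0" if j: "j \<le> k" "j \<noteq> i" for j
  proof -
    have "G p (w j) v = (\<Sum>l\<le>k. G p (w j) (w l))" unfolding w(2) by (rule G_sum_right)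
    also have "\<dots> = (\<Sum>l\<le>k. if l = j then G p (w j) (w j) else 0)"
      using w(1) orth j by (intro sum.cong) auto
    finally have "G p (w j) (w j) = 0" using R j w(1) G_sym[of p v] by simp
    then show ?thesis using G_pos[of "w j" p] by fastforce
  qed
  then have "(\<Sum>l\<le>k. w l) = (\<Sum>l\<le>k. if l = i then w i else 0)"
    by (intro sum.cong) auto
  then show "v \<in> \<D> i p" using w assms by simp
qed

lemma integrable_iff_connection:
  assumes i: "i \<le> k"
  shows "integrable_distribution A (\<D> i) \<longleftrightarrow>
        (\<forall>X\<in>sections A (\<D> i). \<forall>Y\<in>sections A (\<D> i). \<forall>j\<le>k. j \<noteq> i \<longrightarrow>
           (\<forall>Z\<in>sections A (\<D> j). \<forall>p. G p (X p) (nab Y Z p) = G p (Y p) (nab X Z p)))"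
proof -
  have bracket: "G p (lie_bracket A X Y p) (Z p) = G p (X p) (nab Y Z p) - G p (Y p) (nab X Z p)"
    if X: "X \<in> sections A (\<D> i)" and Y: "Y \<in> sections A (\<D> i)" and j: "j \<le> k" "j \<noteq> i"
      and Z: "Z \<in> sections A (\<D> j)" for X Y Z j p
  proof -
    have "G p (nab X Y p) (Z p) = - G p (Y p) (nab X Z p)"
      if X: "X \<in> sections A (\<D> i)" and Y: "Y \<in> sections A (\<D> i)" for X Y
    proof -
      \<comment> \<open>The product vanishes identically, so its derivative does too, and metric
        compatibility moves the connection from Y to Z at the cost of a sign.\<close>
      have "(\<lambda>q. G q (Y q) (Z q)) = (\<lambda>q. 0)"
        using orth[OF i j(1) j(2)[symmetric] sections_mem[OF Y] sections_mem[OF Z]] by (simp add: fun_eq_iff)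
      then show ?thesis
        using nab_metric[OF sections_vf[OF X] sections_vf[OF Y] sections_vf[OF Z], of p] by simp
    qed
    from this[OF X Y] this[OF Y X] show ?thesis
      unfolding nab_torsion[OF sections_vf[OF X] sections_vf[OF Y], symmetric]
      by (simp add: bilinear_lsub[OF bilinear_G])
  qed
  have "lie_bracket A X Y p \<in> \<D> i p \<longleftrightarrow>
      (\<forall>j\<le>k. j \<noteq> i \<longrightarrow> (\<forall>Z\<in>sections A (\<D> j). G p (X p) (nab Y Z p) = G p (Y p) (nab X Z p)))"
    if X: "X \<in> sections A (\<D> i)" and Y: "Y \<in> sections A (\<D> i)" for X Y p
  proof -
    have "(\<forall>z\<in>\<D> j p. G p (lie_bracket A X Y p) z = 0) \<longleftrightarrow>
      (\<forall>Z\<in>sections A (\<D> j). G p (X p) (nab Y Z p) = G p (Y p) (nab X Z p))" if j: "j \<le> k" "j \<noteq> i" for j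
    proof safe
      fix Z assume a: "\<forall>z\<in>\<D> j p. G p (lie_bracket A X Y p) z = 0" and Z: "Z \<in> sections A (\<D> j)"
      then show "G p (X p) (nab Y Z p) = G p (Y p) (nab X Z p)"
        using bracket[OF X Y j Z, of p] sections_mem[OF Z] by simp
    next
      fix z assume a: "\<forall>Z\<in>sections A (\<D> j). G p (X p) (nab Y Z p) = G p (Y p) (nab X Z p)" and z: "z \<in> \<D> j p"
      obtain Z where Z: "Z \<in> sections A (\<D> j)" "Z p = z"
        by (rule M.ex_section[OF regular[OF j(1)] z]) (rule that)
      then show "G p (lie_bracket A X Y p) z = 0" using bracket[OF X Y j Z(1), of p] a by simp
    qed
    then show ?thesis unfolding D_mem_iff[OF i] by blast
  qed
  then show ?thesis unfolding integrable_iff by blast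
qed

lemma integrable_D0_iff_second_fundamental_form:
  "integrable_distribution A (\<D> 0) \<longleftrightarrow>
        (\<forall>X\<in>sections A (\<D> 0). \<forall>Y\<in>sections A (\<D> 0). sff X (TX Y) = sff (TX X) Y)"
proof -
  \<comment> \<open>The normal component N on single vectors, in parallel to
    \<open>Tp\<close>.\<close>
  define nv where "nv p v = \<phi> (f p) (push p v) - push p (Tp p v)" for p v
  have lin: "linear (nv p)" for p
    unfolding nv_def
    by (rule linearI) (simp_all add: linear_add[OF linear_tangent_map] linear_add[OF linear_phi] linear_add[OF linear_Tp]
        linear_scale[OF linear_tangent_map] linear_scale[OF linear_phi] linear_scale[OF linear_Tp] scaleR_diff_right)
  have g_nv: "g (f p) (nv p a) (nv p b) = G p a b - G p (Tp p a) (Tp p b)" for p a b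
  proof -
    have "g (f p) (nv p a) (nv p b) = g (f p) (nv p a) (\<phi> (f p) (push p b))"
      unfolding nv_def Tp_def by (simp add: bilinear_rsub[OF bilinear_g] tan_part_normal)
    also have "\<dots> = G p a b - g (f p) (\<phi> (f p) (push p b)) (push p (Tp p a))"
      unfolding nv_def bilinear_lsub[OF bilinear_g] g_phi G_eq
      by (simp only: g_sym[of "f p" "push p (Tp p a)"])
    also have "g (f p) (\<phi> (f p) (push p b)) (push p (Tp p a)) = G p (Tp p a) (Tp p b)"
      by (subst G_sym) (simp only: G_eq Tp_def[of p b] g_tan_part)
    finally show ?thesis .
  qed
  have mem: "v \<in> \<D> 0 p \<longleftrightarrow> nv p v = 0" for p v
  proof
    assume "v \<in> \<D> 0 p"
    then show "nv p v = 0" using phi_push_D0 by (simp add: nv_def)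
  next
    assume nv: "nv p v = 0"
    obtain w where w: "\<And>i. i \<le> k \<Longrightarrow> w i \<in> \<D> i p" "v = (\<Sum>i\<le>k. w i)"
      by (rule decompose) (rule that)
    have "w i = 0" if i: "1 \<le> i" "i \<le> k" for i
    proof -
      \<comment> \<open>Only the diagonal term survives: by \<open>g_nv\<close> the cross terms are
        combinations of products of w_i with w_j and of their images under T, all of them zero by
        orthogonality.\<close>
      have "g (f p) (nv p (w i)) (nv p v) = (\<Sum>j\<le>k. g (f p) (nv p (w i)) (nv p (w j)))"
      proof -
        have l: "linear (g (f p) (nv p (w i)))" using bilinear_g by (simp add: bilinear_def)
        show ?thesis unfolding w(2) linear_sum[OF lin] linear_sum[OF l] ..
      qed
      also have "\<dots> = (\<Sum>j\<le>k. if j = i then g (f p) (nv p (w i)) (nv p (w i)) else 0)"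
      proof (intro sum.cong refl)
        fix j assume "j \<in> {..k}"
        then show "g (f p) (nv p (w i)) (nv p (w j)) = (if j = i then g (f p) (nv p (w i)) (nv p (w i)) else 0)"
          using orth[OF i(2) _ _ w(1)[OF i(2)] w(1)] orth[OF i(2) _ _ Tp_D[OF i(2) w(1)[OF i(2)]] Tp_D[OF _ w(1)]]
          by (simp add: g_nv)
      qed
      finally have "g (f p) (nv p (w i)) (nv p (w i)) = 0"
        using i nv by (simp add: bilinear_rzero[OF bilinear_g])
      then have "nv p (w i) = 0" by (rule g_eq_0)
      then show ?thesis using proper_slant[OF i w(1)[OF i(2)]] by (simp add: nv_def)
    qed
    then have "(\<Sum>l\<le>k. w l) = (\<Sum>l\<le>k. if l = 0 then w 0 else 0)"
      by (intro sum.cong) auto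
    then show "v \<in> \<D> 0 p" using w by simp
  qed
  have "(\<forall>p. lie_bracket A X Y p \<in> \<D> 0 p) \<longleftrightarrow> sff X (TX Y) = sff (TX X) Y"
    if X: "X \<in> sections A (\<D> 0)" and Y: "Y \<in> sections A (\<D> 0)" for X Y
  proof -
    have diff: "sff X (TX Y) p - sff (TX X) Y p = nv p (lie_bracket A X Y p)" for p
      unfolding nv_def using phi_push_D0 sections_mem[OF X] sections_mem[OF Y]
      by (intro normal_identity sections_vf[OF X] sections_vf[OF Y]) simp_all
    show ?thesis unfolding mem diff[symmetric] by (simp add: fun_eq_iff)
  qed
  then show ?thesis unfolding integrable_iff by blast
qed

lemma integrable_iff_tangential:
  assumes i: "i \<le> k" and proper: "\<And>j p. j \<le> k \<Longrightarrow> j \<noteq> i \<Longrightarrow> \<theta> j p \<noteq> pi / 2"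
  shows "integrable_distribution A (\<D> i) \<longleftrightarrow>
          (\<forall>X\<in>sections A (\<D> i). \<forall>Y\<in>sections A (\<D> i).
             (\<lambda>p. nab X (TX Y) p - nab Y (TX X) p + shape_operator A B f g D (NX X) Y p
                  - shape_operator A B f g D (NX Y) X p) \<in> sections A (\<D> i))"
proof -
  \<comment> \<open>The components T w_j are mutually orthogonal, and T v in D_i is orthogonal to T
    w_j in D_j; so T w_j = 0, and injectivity of T on D_j removes w_j.\<close>
  have mem: "Tp p v \<in> \<D> i p \<longleftrightarrow> v \<in> \<D> i p" for p v
  proof
    assume T: "Tp p v \<in> \<D> i p"
    obtain w where w: "\<And>i. i \<le> k \<Longrightarrow> w i \<in> \<D> i p" "v = (\<Sum>i\<le>k. w i)"
      by (rule decompose) (rule that)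
    have "w j = 0" if j: "j \<le> k" "j \<noteq> i" for j
    proof -
      have "G p (Tp p (w j)) (Tp p v) = (\<Sum>l\<le>k. G p (Tp p (w j)) (Tp p (w l)))"
        unfolding w(2) linear_sum[OF linear_Tp] by (rule G_sum_right)
      also have "\<dots> = (\<Sum>l\<le>k. if l = j then G p (Tp p (w j)) (Tp p (w j)) else 0)"
        using w(1) orth j Tp_D by (intro sum.cong) auto
      finally have "G p (Tp p (w j)) (Tp p (w j)) = 0"
        using orth[OF j(1) i j(2) Tp_D[OF j(1) w(1)[OF j(1)]] T] j by simp
      then have "Tp p (w j) = 0" using G_pos[of "Tp p (w j)" p] by fastforce
      then show ?thesis using Tp_injective[OF j(1) w(1)[OF j(1)]] proper[OF j] by blast
    qed
    then have "(\<Sum>l\<le>k. w l) = (\<Sum>l\<le>k. if l = i then w i else 0)"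
      by (intro sum.cong) auto
    then show "v \<in> \<D> i p" using w i by simp
  qed (rule Tp_D[OF i])
  have "(\<lambda>p. nab X (TX Y) p - nab Y (TX X) p + shape_operator A B f g D (NX X) Y p
      - shape_operator A B f g D (NX Y) X p) \<in> sections A (\<D> i) \<longleftrightarrow> (\<forall>p. lie_bracket A X Y p \<in> \<D> i p)"
    if X: "X \<in> sections A (\<D> i)" and Y: "Y \<in> sections A (\<D> i)" for X Y
  proof -
    note vf = sections_vf[OF X] sections_vf[OF Y]
    \<comment> \<open>Membership in \<open>sections\<close> also demands smoothness; the expression
      is T of the bracket, a smooth field.\<close>
    have "vector_field A (\<lambda>p. Tp p (lie_bracket A X Y p))"
      using T_part_vf[OF lie_bracket_vf[OF vf]] by (simp add: T_part_eq[abs_def])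
    then show ?thesis unfolding tangential_identity[OF vf] sections_def by (simp add: mem)
  qed
  then show ?thesis unfolding integrable_iff by blast
qed

end

theorem theorem3p1:
  fixes A :: "('p::{t2_space,second_countable_topology}, 'm::euclidean_space) chart set"
    and B :: "('q::{t2_space,second_countable_topology}, 'n::euclidean_space) chart set"
    and f :: "'p \<Rightarrow> 'q"
    and \<phi> :: "'q \<Rightarrow> 'n \<Rightarrow> 'n"
    and g :: "'q \<Rightarrow> 'n \<Rightarrow> 'n \<Rightarrow> real"
    and nabbar :: "('q \<Rightarrow> 'n) \<Rightarrow> ('q \<Rightarrow> 'n) \<Rightarrow> 'q \<Rightarrow> 'n"
    and D :: "('p \<Rightarrow> 'm) \<Rightarrow> ('p \<Rightarrow> 'n) \<Rightarrow> 'p \<Rightarrow> 'n"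
    and nab :: "('p \<Rightarrow> 'm) \<Rightarrow> ('p \<Rightarrow> 'm) \<Rightarrow> 'p \<Rightarrow> 'm"
    and k :: nat
    and \<D> :: "nat \<Rightarrow> 'p \<Rightarrow> 'm set"
    and \<theta> :: "nat \<Rightarrow> 'p \<Rightarrow> real"
  assumes "kaehler B \<phi> g nabbar"
    and "smooth_atlas A"
    and "injective_immersion A B f"
    and "levi_civita A (induced_metric A B f g) nab"
    and "induced_connection A B f nabbar D"
    and "pointwise_k_slant A B f \<phi> g k \<D> \<theta>"
  shows
    "(\<forall>i\<le>k. integrable_distribution A (\<D> i) \<longleftrightarrow>
        (\<forall>X\<in>sections A (\<D> i). \<forall>Y\<in>sections A (\<D> i). \<forall>j\<le>k. j \<noteq> i \<longrightarrow>
           (\<forall>Z\<in>sections A (\<D> j). \<forall>p.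
              induced_metric A B f g p (X p) (nab Y Z p) =
              induced_metric A B f g p (Y p) (nab X Z p)))) \<and>
     (integrable_distribution A (\<D> 0) \<longleftrightarrow>
        (\<forall>X\<in>sections A (\<D> 0). \<forall>Y\<in>sections A (\<D> 0).
           second_fundamental_form A B f D nab X (T_part A B f \<phi> g Y) =
           second_fundamental_form A B f D nab (T_part A B f \<phi> g X) Y)) \<and>
     (\<forall>i\<le>k. (\<forall>j\<le>k. j \<noteq> i \<longrightarrow> (\<forall>p. \<theta> j p \<noteq> pi / 2)) \<longrightarrow>
        (integrable_distribution A (\<D> i) \<longleftrightarrow>
          (\<forall>X\<in>sections A (\<D> i). \<forall>Y\<in>sections A (\<D> i).
             (\<lambda>p. nab X (T_part A B f \<phi> g Y) p - nab Y (T_part A B f \<phi> g X) p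
                  + shape_operator A B f g D (N_part A B f \<phi> g X) Y p
                  - shape_operator A B f g D (N_part A B f \<phi> g Y) X p)
             \<in> sections A (\<D> i))))"
proof -
  interpret slant_submanifold A B f \<phi> g nabbar D nab k \<D> \<theta>
    by unfold_locales (fact assms)+
  show ?thesis
  proof (intro conjI allI impI)
    fix i assume "i \<le> k" "\<forall>j\<le>k. j \<noteq> i \<longrightarrow> (\<forall>p. \<theta> j p \<noteq> pi / 2)"
    then show "integrable_distribution A (\<D> i) \<longleftrightarrow>
      (\<forall>X\<in>sections A (\<D> i). \<forall>Y\<in>sections A (\<D> i).
        (\<lambda>p. nab X (TX Y) p - nab Y (TX X) p + shape_operator A B f g D (NX X) Y p
          - shape_operator A B f g D (NX Y) X p) \<in> sections A (\<D> i))"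
      by (intro integrable_iff_tangential) simp_all
  qed (fact integrable_iff_connection integrable_D0_iff_second_fundamental_form)+
qed

end
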